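(* Let $\Delta,k,r,n_0$ be positive integers and let $c,\alpha,d_2,d_3,\delta_2,\delta_3$ be positive constants such that $$1/n_0\ll 1/r\ll\delta_2\ll\min\{\delta_3,d_2\}\le\delta_3\ll\alpha\ll d_3,1/\Delta,1/k\quad\text{and}\quad c\ll\alpha,d_2.$$ Then the following holds for all integers $n\ge n_0$. Suppose that $\mathcal{H}$ is a $k$-partite complex of maximum degree at most $\Delta$ with vertex classes $X_1,\dots,X_k$ such that $|X_i|\le cn$ for all $i=1,\dots,k$. Suppose also that $\mathcal{G}$ is a $k$-partite $(d_3,\delta_3,d_2,\delta_2,r)$-regular complex with vertex classes $V_1,\dots,V_k$, all of size $n$, which respects the partition of $\mathcal{H}$. Then for every vertex $h$ of $\mathcal{H}$ we have $$|\mathcal{H}|_{\mathcal{G}}\ge(1-\alpha)\,n\,d_2^{e_2(\mathcal{H})-e_2(\mathcal{H}_h)}\,d_3^{e_3(\mathcal{H})-e_3(\mathcal{H}_h)}\,|\mathcal{H}_h|_{\mathcal{G}},$$ where $\mathcal{H}_h$ denotes the induced subcomplex of $\mathcal{H}$ obtained by removing $h$. In particular, $\mathcal{G}$ contains at least $((1-\alpha)n)^{|\mathcal{H}|}d_2^{e_2(\mathcal{H})}d_3^{e_3(\mathcal{H})}$ labelled partition-respecting copies of $\mathcal{H}$.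
   Context: Hierarchy notation. $0<a_1\ll a_2\ll a_3$ means that the constants can be chosen from right to left: there are increasing positive functions $f,g$ such that the result holds whenever, given $a_3$, one has $a_2\le f(a_3)$ and $a_1\le g(a_2)$. More generally, a result assuming a list of relations of the form $a\ll b_1,\dots,b_m$ asserts that there exist positive functions, increasing in each argument, one function $f$ for each such relation, such that the result holds for all choices of constants satisfying $a\le f(b_1,\dots,b_m)$ for each of the relations. The functions depend on nothing but their arguments. Complexes. A complex $\mathcal{H}$ consists of a finite vertex set $V(\mathcal{H})$, a set $E_2(\mathcal{H})$ of edges (unordered pairs of vertices) and a set $E_3(\mathcal{H})$ of hyperedges (unordered triples of vertices), such that each pair of vertices lying in a common hyperedge forms an edge. Set $|\mathcal{H}|=|V(\mathcal{H})|$ and $e_i(\mathcal{H})=|E_i(\mathcal{H})|$ for $i=2,3$. The underlying graph is $(V(\mathcal{H}),E_2(\mathcal{H}))$ and the underlying hypergraph is $(V(\mathcal{H}),E_3(\mathcal{H}))$. The complex is $k$-partite with given vertex classes if its underlying graph is, i.e. the classes partition the vertex set and no edge lies inside a class. The degree of a vertex is the maximum of its degree in the underlying graph and its degree (number of hyperedges containing it) in the underlying hypergraph; the maximum degree is the maximum over all vertices. The subcomplex induced by a set $X$ of vertices has vertex set $X$ and all edges and hyperedges contained in $X$. Graph regularity. For a bipartite graph with vertex classes $A,B$ and $X\subseteq A$, $Y\subseteq B$, let $d(X,Y)=e(X,Y)/(|X||Y|)$, where $e(X,Y)$ is the number of edges between $X$ and $Y$. Given $0<\delta,d\le 1$, the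 bipartite graph is $(d,\delta)$-regular if $(1-\delta)d<d(X,Y)<(1+\delta)d$ for all $X\subseteq A$, $Y\subseteq B$ with $|X|\ge\delta|A|$, $|Y|\ge\delta|B|$. A $k$-partite graph $P$ is $(d,\delta)$-regular if each of the $\binom k2$ bipartite subgraphs forming $P$ is $(d,\delta)$-regular or empty. Hypergraph regularity. A triad is a $3$-partite graph $P$ with vertex classes $V_i,V_j,V_k$, formed by bipartite graphs $P^{ij},P^{jk},P^{ik}$. $T(P)$ is the set of triangles in $P$ and $t(P)=|T(P)|$. For a $3$-partite $3$-uniform hypergraph $\mathcal{F}$ with the same vertex classes and hyperedge set $E(\mathcal{F})$, the density $d_{\mathcal{F}}(P)$ is $|E(\mathcal{F})\cap T(P)|/t(P)$ if $t(P)>0$, and $0$ otherwise. For an $r$-tuple $\vec Q=(Q(1),\dots,Q(r))$ of subtriads of $P$ (each $Q(s)$ is formed by bipartite graphs $Q^{ij}(s)\subseteq P^{ij}$, $Q^{jk}(s)\subseteq P^{jk}$, $Q^{ik}(s)\subseteq P^{ik}$), let $t(\vec Q)=|\bigcup_{s=1}^rT(Q(s))|$, and let $d_{\mathcal{F}}(\vec Q)=|E(\mathcal{F})\cap\bigcup_{s=1}^rT(Q(s))|/t(\vec Q)$ if $t(\vec Q)>0$, and $0$ otherwise. The triad $P$ is $(d_3,\delta_3,r)$-regular with respect to $\mathcal{F}$ if every $r$-tuple $\vec Q$ of subtriads with $t(\vec Q)\ge\delta_3t(P)$ satisfies $|d_3-d_{\mathcal{F}}(\vec Q)|<\delta_3$.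 A $k$-partite graph $P$ is $(d_3,\delta_3,r)$-regular with respect to a $k$-partite $3$-uniform hypergraph $\mathcal{F}$ with the same vertex classes if each triad $P'$ induced by $P$ on three of the vertex classes is either $(d_3,\delta_3,r)$-regular with respect to $\mathcal{F}$ or satisfies $d_{\mathcal{F}}(P')=0$. A $k$-partite complex $\mathcal{G}$ is $(d_3,\delta_3,d_2,\delta_2,r)$-regular if its underlying graph $P$ is $(d_2,\delta_2)$-regular and $P$ is $(d_3,\delta_3,r)$-regular with respect to the underlying hypergraph of $\mathcal{G}$. Respecting partitions and copies. Let $\mathcal{H},\mathcal{G}$ be $k$-partite complexes with vertex classes $X_1,\dots,X_k$ and $V_1,\dots,V_k$. $\mathcal{G}$ respects the partition of $\mathcal{H}$ if (1) for all $i<j<\ell$, $\mathcal{G}$ contains a hyperedge with vertices in $V_i,V_j,V_\ell$ whenever $\mathcal{H}$ contains a hyperedge with vertices in $X_i,X_j,X_\ell$; and (2) for all $i<j$, $\mathcal{G}$ contains an edge between $V_i$ and $V_j$ whenever $\mathcal{H}$ contains an edge between $X_i$ and $X_j$. A labelled partition-respecting copy of $\mathcal{H}$ in $\mathcal{G}$ is a labelled (not necessarily induced) subcomplex of $\mathcal{G}$ isomorphic to $\mathcal{H}$ such that the corresponding isomorphism maps each $X_i$ to a subset of $V_i$; equivalently, an injection $V(\mathcal{H})\to V(\mathcal{G})$ mapping $X_i$ into $V_i$, edges to edges and hyperedges to hyperedges. This extends to subcomplexes $\mathcal{H}'$ of $\mathcal{H}$ (with the induced vertex classes), and $|\mathcal{H}'|_{\mathcal{G}}$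 denotes the number of labelled partition-respecting copies of $\mathcal{H}'$ in $\mathcal{G}$. *)

theory Defs
  imports Complex_Main "HOL-Library.Ramsey" "HOL-Library.FuncSet" "HOL-Library.Disjoint_Sets"
begin

subsection \<open>Hierarchies of constants\<close>

text \<open>
  A hypothesis \<open>a \<ll> b\<^sub>1, \<dots>, b\<^sub>m\<close> is read as \<open>a \<le> f b\<^sub>1 \<dots> b\<^sub>m\<close> for a function \<open>f\<close>, positive and
  strictly increasing in each argument on the positive reals, that is chosen before all constants.
  (Demanding strict rather than weak monotonicity is no restriction: a positive weakly increasing
  \<open>f\<close> may be replaced by a smaller strictly increasing one, such as \<open>x \<mapsto> f x * (x / (1 + x))\<close>.)
\<close>

definition pos_incr1 :: "(real \<Rightarrow> real) \<Rightarrow> bool" where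
  "pos_incr1 f \<longleftrightarrow> (\<forall>x>0. f x > 0) \<and> strict_mono_on {0<..} f"

definition pos_incr2 :: "(real \<Rightarrow> real \<Rightarrow> real) \<Rightarrow> bool" where
  "pos_incr2 f \<longleftrightarrow>
     (\<forall>y>0. pos_incr1 (\<lambda>x. f x y)) \<and> (\<forall>x>0. pos_incr1 (\<lambda>y. f x y))"

definition pos_incr3 :: "(real \<Rightarrow> real \<Rightarrow> real \<Rightarrow> real) \<Rightarrow> bool" where
  "pos_incr3 f \<longleftrightarrow>
     (\<forall>y>0. \<forall>z>0. pos_incr1 (\<lambda>x. f x y z)) \<and>
     (\<forall>x>0. \<forall>z>0. pos_incr1 (\<lambda>y. f x y z)) \<and>
     (\<forall>x>0. \<forall>y>0. pos_incr1 (\<lambda>z. f x y z))"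


subsection \<open>Complexes\<close>

text \<open>
  Edges and hyperedges are sets of two and of three vertices; \<open>nsets A n\<close> is the library's set of
  all \<open>n\<close>-element subsets of \<open>A\<close>.
\<close>

record 'a hcomplex =
  verts :: "'a set"
  edges :: "'a set set"
  hyperedges :: "'a set set"

definition is_complex :: "'a hcomplex \<Rightarrow> bool" where
  "is_complex H \<longleftrightarrow>
     finite (verts H) \<and> edges H \<subseteq> nsets (verts H) 2 \<and> hyperedges H \<subseteq> nsets (verts H) 3 \<and>
     (\<forall>t\<in>hyperedges H. nsets t 2 \<subseteq> edges H)"

abbreviation e2 :: "'a hcomplex \<Rightarrow> nat" where "e2 H \<equiv> card (edges H)"
abbreviation e3 :: "'a hcomplex \<Rightarrow> nat" where "e3 H \<equiv> card (hyperedges H)"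

text \<open>
  The vertex classes are a family indexed by \<open>{1..k}\<close>. Classes may be empty, so
  \<^const>\<open>partition_on\<close> is not used.
\<close>

definition k_partite :: "nat \<Rightarrow> 'a hcomplex \<Rightarrow> (nat \<Rightarrow> 'a set) \<Rightarrow> bool" where
  "k_partite k H X \<longleftrightarrow>
     is_complex H \<and> disjoint_family_on X {1..k} \<and> (\<Union>i\<in>{1..k}. X i) = verts H \<and>
     (\<forall>e\<in>edges H. \<forall>i\<in>{1..k}. \<not> e \<subseteq> X i)"

definition degree :: "'a hcomplex \<Rightarrow> 'a \<Rightarrow> nat" where
  "degree H v = max (card {e \<in> edges H. v \<in> e}) (card {t \<in> hyperedges H. v \<in> t})"

text \<open>Inserting \<open>0\<close> only matters for the complex without vertices.\<close>

definition max_degree :: "'a hcomplex \<Rightarrow> nat" where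
  "max_degree H = Max (insert 0 (degree H ` verts H))"

definition induced :: "'a hcomplex \<Rightarrow> 'a set \<Rightarrow> 'a hcomplex" where
  "induced H S =
     \<lparr>verts = S, edges = {e \<in> edges H. e \<subseteq> S}, hyperedges = {t \<in> hyperedges H. t \<subseteq> S}\<rparr>"

definition del_vertex :: "'a hcomplex \<Rightarrow> 'a \<Rightarrow> 'a hcomplex" where
  "del_vertex H h = induced H (verts H - {h})"


subsection \<open>Graph regularity\<close>

definition edges_between :: "'a set set \<Rightarrow> 'a set \<Rightarrow> 'a set \<Rightarrow> 'a set set" where
  "edges_between E A B = {e \<in> E. \<exists>x\<in>A. \<exists>y\<in>B. e = {x, y}}"

definition edge_density :: "'a set set \<Rightarrow> 'a set \<Rightarrow> 'a set \<Rightarrow> real" where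
  "edge_density E A B = real (card (edges_between E A B)) / (real (card A) * real (card B))"

definition bipartite_regular :: "real \<Rightarrow> real \<Rightarrow> 'a set set \<Rightarrow> 'a set \<Rightarrow> 'a set \<Rightarrow> bool" where
  "bipartite_regular d \<delta> E A B \<longleftrightarrow>
     0 < \<delta> \<and> \<delta> \<le> 1 \<and> 0 < d \<and> d \<le> 1 \<and>
     (\<forall>X Y. X \<subseteq> A \<and> Y \<subseteq> B \<and>
        real (card X) \<ge> \<delta> * real (card A) \<and> real (card Y) \<ge> \<delta> * real (card B) \<longrightarrow>
        (1 - \<delta>) * d < edge_density E X Y \<and> edge_density E X Y < (1 + \<delta>) * d)"

definition graph_regular ::
    "nat \<Rightarrow> real \<Rightarrow> real \<Rightarrow> 'a set set \<Rightarrow> (nat \<Rightarrow> 'a set) \<Rightarrow> bool" where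
  "graph_regular k d \<delta> P V \<longleftrightarrow>
     (\<forall>i\<in>{1..k}. \<forall>j\<in>{1..k}. i < j \<longrightarrow>
        bipartite_regular d \<delta> (edges_between P (V i) (V j)) (V i) (V j) \<or>
        edges_between P (V i) (V j) = {})"


subsection \<open>Hypergraph regularity\<close>

text \<open>
  A triad is represented by its edge set, the union of its three bipartite graphs. As these are
  edge-disjoint, the subtriads of a triad \<open>P\<close> are exactly the subsets of \<open>P\<close>.
\<close>

definition triad :: "'a set set \<Rightarrow> 'a set \<Rightarrow> 'a set \<Rightarrow> 'a set \<Rightarrow> 'a set set" where
  "triad P A B C = edges_between P A B \<union> edges_between P B C \<union> edges_between P A C"

definition triangles :: "'a set set \<Rightarrow> 'a set set" where
  "triangles P = {t \<in> nsets UNIV 3. nsets t 2 \<subseteq> P}"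

text \<open>
  The proportion of a set of triangles \<open>T\<close> lying in the hypergraph \<open>F\<close>. With \<open>T = triangles P\<close> this
  is \<open>d\<^sub>F(P)\<close>, and with \<open>T\<close> the union of the triangle sets of a tuple of subtriads it is the density
  of \<open>F\<close> with respect to that tuple.
\<close>

definition triangle_density :: "'a set set \<Rightarrow> 'a set set \<Rightarrow> real" where
  "triangle_density F T = (if card T > 0 then real (card (F \<inter> T)) / real (card T) else 0)"

definition triad_regular ::
    "real \<Rightarrow> real \<Rightarrow> nat \<Rightarrow> 'a set set \<Rightarrow> 'a set set \<Rightarrow> bool" where
  "triad_regular d3 \<delta>3 r P F \<longleftrightarrow>
     (\<forall>Q :: nat \<Rightarrow> 'a set set.
        (\<forall>s\<in>{1..r}. Q s \<subseteq> P) \<and>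
        real (card (\<Union>s\<in>{1..r}. triangles (Q s))) \<ge> \<delta>3 * real (card (triangles P)) \<longrightarrow>
        \<bar>d3 - triangle_density F (\<Union>s\<in>{1..r}. triangles (Q s))\<bar> < \<delta>3)"

definition hypergraph_regular ::
    "nat \<Rightarrow> real \<Rightarrow> real \<Rightarrow> nat \<Rightarrow> 'a set set \<Rightarrow> 'a set set \<Rightarrow> (nat \<Rightarrow> 'a set) \<Rightarrow> bool" where
  "hypergraph_regular k d3 \<delta>3 r P F V \<longleftrightarrow>
     (\<forall>i\<in>{1..k}. \<forall>j\<in>{1..k}. \<forall>l\<in>{1..k}. i < j \<and> j < l \<longrightarrow>
        triad_regular d3 \<delta>3 r (triad P (V i) (V j) (V l)) F \<or>
        triangle_density F (triangles (triad P (V i) (V j) (V l))) = 0)"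

definition complex_regular ::
    "nat \<Rightarrow> real \<Rightarrow> real \<Rightarrow> real \<Rightarrow> real \<Rightarrow> nat \<Rightarrow> 'a hcomplex \<Rightarrow> (nat \<Rightarrow> 'a set) \<Rightarrow> bool" where
  "complex_regular k d3 \<delta>3 d2 \<delta>2 r G V \<longleftrightarrow>
     graph_regular k d2 \<delta>2 (edges G) V \<and>
     hypergraph_regular k d3 \<delta>3 r (edges G) (hyperedges G) V"


subsection \<open>Partition-respecting copies\<close>

definition respects_partition ::
    "nat \<Rightarrow> 'b hcomplex \<Rightarrow> (nat \<Rightarrow> 'b set) \<Rightarrow> 'a hcomplex \<Rightarrow> (nat \<Rightarrow> 'a set) \<Rightarrow> bool" where
  "respects_partition k G V H X \<longleftrightarrow>
     (\<forall>i\<in>{1..k}. \<forall>j\<in>{1..k}. \<forall>l\<in>{1..k}. i < j \<and> j < l \<longrightarrow>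
        (\<exists>x\<in>X i. \<exists>y\<in>X j. \<exists>z\<in>X l. {x, y, z} \<in> hyperedges H) \<longrightarrow>
        (\<exists>x\<in>V i. \<exists>y\<in>V j. \<exists>z\<in>V l. {x, y, z} \<in> hyperedges G)) \<and>
     (\<forall>i\<in>{1..k}. \<forall>j\<in>{1..k}. i < j \<longrightarrow>
        (\<exists>x\<in>X i. \<exists>y\<in>X j. {x, y} \<in> edges H) \<longrightarrow>
        (\<exists>x\<in>V i. \<exists>y\<in>V j. {x, y} \<in> edges G))"

text \<open>
  Copies of a subcomplex \<open>H\<close> are counted with respect to the induced classes, that is, the
  intersections of the given classes with \<open>verts H\<close>. Using extensional functions makes each
  injection count once.
\<close>

definition copies ::
    "nat \<Rightarrow> 'a hcomplex \<Rightarrow> (nat \<Rightarrow> 'a set) \<Rightarrow> 'b hcomplex \<Rightarrow> (nat \<Rightarrow> 'b set) \<Rightarrow> ('a \<Rightarrow> 'b) set" where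
  "copies k H X G V =
     {\<phi> \<in> verts H \<rightarrow>\<^sub>E verts G.
        inj_on \<phi> (verts H) \<and>
        (\<forall>i\<in>{1..k}. \<phi> ` (X i \<inter> verts H) \<subseteq> V i) \<and>
        (\<forall>e\<in>edges H. \<phi> ` e \<in> edges G) \<and>
        (\<forall>t\<in>hyperedges H. \<phi> ` t \<in> hyperedges G)}"

abbreviation num_copies ::
    "nat \<Rightarrow> 'a hcomplex \<Rightarrow> (nat \<Rightarrow> 'a set) \<Rightarrow> 'b hcomplex \<Rightarrow> (nat \<Rightarrow> 'b set) \<Rightarrow> nat" where
  "num_copies k H X G V \<equiv> card (copies k H X G V)"

end

theory Submission
  imports Defs
begin

text \<open>
  The number of copies of a complex is compared with the number of copies of the complex without a
  vertex \<open>h\<close>. A copy \<open>\<phi>\<close> of the smaller complex extends through every unused vertex \<open>v\<close> that forms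
  the required edges and hyperedges with the images of the neighbours of \<open>h\<close>. So the number of
  extensions depends only on the restriction \<open>\<beta>\<close> of \<open>\<phi>\<close> to the set \<open>B\<close> of neighbours of \<open>h\<close>, a
  set of bounded size, and the claim follows once few copies \<open>\<phi>\<close> restrict to a bad \<open>\<beta>\<close>, one
  with fewer than about \<open>n d\<^sub>2\<^bsup>|B|\<^esup> d\<^sub>3\<^bsup>l\<^esup>\<close> extensions, where \<open>l\<close> is the number of hyperedges at \<open>h\<close>.

  First, a bad \<open>\<beta>\<close> is rare among the graph copies of \<open>B\<close>: the number of bad \<open>\<beta>\<close> is a small
  multiple of \<open>n\<^bsup>|B|\<^esup> d\<^sub>2\<^bsup>e(B)\<^esup>\<close> (\<open>few_bad_links\<close>). To see this, the extensions of the bad \<open>\<beta>\<close> are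
  counted by replacing the indicator of each edge, and then of each hyperedge at \<open>h\<close>, by its
  density. For an edge \<open>xy\<close> one fixes the images of all other vertices; then the remaining
  conditions are a condition on \<open>x\<close> and a condition on \<open>y\<close>, and regularity of the graph applies
  (\<open>edge_replacement\<close>). For a hyperedge \<open>xyz\<close> one fixes an embedding \<open>s\<close> of all other vertices; the
  remaining conditions then restrict the three pairs separately and so cut out a subtriad \<open>Q(s)\<close>
  (\<open>hyperedge_replacement\<close>). As \<open>d\<^sub>2\<close> may be much smaller than \<open>\<delta>\<^sub>3\<close>, a single \<open>Q(s)\<close> has far too few
  triangles for the regularity of the triad. This is where the parameter \<open>r\<close> enters: if the
  replacement failed on average over \<open>s\<close>, a random tuple of embeddings, just long enough for the
  subtriads to cover a small but fixed proportion of all triangles, would have small overlaps and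
  hence would fail on the union as well, contradicting regularity for that tuple
  (\<open>exists_tuple_large_union_sum\<close>).

  Secondly, rare configurations \<open>\<beta>\<close> stay rare when counted with the number of copies extending them.
  Rarity relative to \<open>d\<^sub>2\<^bsup>e(B)\<^esup>\<close> is weak, since \<open>d\<^sub>2\<close> may be far smaller than the proportion of bad
  \<open>\<beta>\<close>, so it would be useless to bound the number of extensions of \<open>\<beta>\<close> by all copies of the rest of
  the complex: this loses a factor \<open>d\<^sub>2\<close> for each edge between \<open>B\<close> and the set \<open>S\<close> of outside
  neighbours of \<open>B\<close>. But these edges are independent of \<open>\<beta>\<close>: graph regularity with \<open>\<delta>\<^sub>2\<close> below every
  power of \<open>d\<^sub>2\<close> that occurs shows that all but a tiny number of maps of \<open>S\<close> are joined to at most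
  twice the expected number of bad \<open>\<beta>\<close> (\<open>few_atypical\<close>). Copies in which \<open>S\<close> is typical are
  compared with the copies of the complex without \<open>B\<close>, and copies in which \<open>S\<close> is atypical with the
  copies of the complex without \<open>B\<close> and \<open>S\<close>; in both cases induction on the number of vertices
  bounds these in terms of all copies (\<open>extend_one_vertex\<close>).
\<close>

section \<open>Sums over spaces of maps\<close>

lemma sum_PiE_insert:
  fixes g :: "('u \<Rightarrow> 'v) \<Rightarrow> real"
  assumes "x \<notin> U"
  shows "(\<Sum>\<phi>\<in>PiE (insert x U) W. g \<phi>) = (\<Sum>\<rho>\<in>PiE U W. \<Sum>a\<in>W x. g (\<rho>(x := a)))"
proof -
  have "(\<Sum>\<phi>\<in>PiE (insert x U) W. g \<phi>) = (\<Sum>(a, \<rho>)\<in>W x \<times> PiE U W. g (\<rho>(x := a)))"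
    unfolding PiE_insert_eq
    by (subst sum.reindex[OF inj_combinator[OF assms]]) (simp add: case_prod_unfold o_def)
  also have "\<dots> = (\<Sum>\<rho>\<in>PiE U W. \<Sum>a\<in>W x. g (\<rho>(x := a)))"
    by (simp add: sum.cartesian_product[symmetric]) (rule sum.swap)
  finally show ?thesis .
qed

lemma sum_PiE_Un:
  fixes g :: "('u \<Rightarrow> 'v) \<Rightarrow> real"
  assumes "B \<inter> S = {}"
  shows "(\<Sum>\<phi>\<in>PiE (B \<union> S) W. g \<phi>) =
    (\<Sum>\<beta>\<in>PiE B W. \<Sum>\<sigma>\<in>PiE S W. g (\<lambda>x. if x \<in> B then \<beta> x else \<sigma> x))"
proof -
  let ?i = "\<lambda>p x. if x \<in> B then fst p x else snd p x"
  have "(\<Sum>\<phi>\<in>PiE (B \<union> S) W. g \<phi>) = (\<Sum>p\<in>PiE B W \<times> PiE S W. g (?i p))"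
  proof (rule sum.reindex_bij_witness[where i = ?i and j = "\<lambda>\<phi>. (restrict \<phi> B, restrict \<phi> S)"])
    fix \<phi> assume \<phi>: "\<phi> \<in> PiE (B \<union> S) W"
    show eq: "?i (restrict \<phi> B, restrict \<phi> S) = \<phi>"
      using \<phi> by (auto simp: fun_eq_iff PiE_def extensional_def)
    show "g (?i (restrict \<phi> B, restrict \<phi> S)) = g \<phi>"
      by (simp only: eq)
    show "(restrict \<phi> B, restrict \<phi> S) \<in> PiE B W \<times> PiE S W"
      using \<phi> by auto
  next
    fix p assume p: "p \<in> PiE B W \<times> PiE S W"
    have "restrict (?i p) B = fst p" "restrict (?i p) S = snd p"
      using p assms by (auto simp: fun_eq_iff PiE_def extensional_def restrict_def)
    then show "(restrict (?i p) B, restrict (?i p) S) = p"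
      by simp
    show "?i p \<in> PiE (B \<union> S) W"
      using p by (auto simp: PiE_def Pi_def extensional_def)
  qed
  then show ?thesis
    by (simp add: sum.cartesian_product case_prod_unfold)
qed

lemma sum_PiE_coordinate:
  fixes g :: "'v \<Rightarrow> real"
  assumes "finite I" "j \<in> I" "finite S"
  shows "(\<Sum>s\<in>PiE I (\<lambda>_. S). g (s j)) = real (card S) ^ (card I - 1) * sum g S"
proof -
  have "(\<Sum>s\<in>PiE (insert j (I - {j})) (\<lambda>_. S). g (s j)) = real (card S) ^ (card I - 1) * sum g S"
    using assms by (subst sum_PiE_insert) (auto simp: card_PiE)
  then show ?thesis
    using assms(2) by (simp add: insert_absorb)
qed

section \<open>Replacing an edge by its density\<close>

text \<open>
  Closeness in the cut norm of the bipartite graph between \<open>A\<close> and \<open>B\<close> to the constant \<open>d\<close>. Unlike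
  regularity it concerns all pairs of subsets, small ones included, so it can be applied to
  neighbourhoods of any size.
\<close>
definition cut_close :: "'b set set \<Rightarrow> real \<Rightarrow> real \<Rightarrow> 'b set \<Rightarrow> 'b set \<Rightarrow> bool" where
  "cut_close E d \<eta> A B \<longleftrightarrow>
     (\<forall>X Y. X \<subseteq> A \<longrightarrow> Y \<subseteq> B \<longrightarrow> \<bar>\<Sum>x\<in>X. \<Sum>y\<in>Y. of_bool ({x, y} \<in> E) - d\<bar> \<le> \<eta>)"

lemma cut_close_sym: "cut_close E d \<eta> A B \<Longrightarrow> cut_close E d \<eta> B A"
  unfolding cut_close_def by (subst sum.swap) (simp add: insert_commute)

lemma card_edges_between:
  assumes "X \<inter> Y = {}" "finite X" "finite Y"
  shows "real (card (edges_between E X Y)) = (\<Sum>x\<in>X. \<Sum>y\<in>Y. of_bool ({x, y} \<in> E))"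
proof -
  let ?S = "{p \<in> X \<times> Y. {fst p, snd p} \<in> E}"
  have "inj_on (\<lambda>p. {fst p, snd p}) ?S"
    using assms(1) by (auto simp: inj_on_def doubleton_eq_iff)
  moreover have "edges_between E X Y = (\<lambda>p. {fst p, snd p}) ` ?S"
    unfolding edges_between_def by (auto simp: image_iff) blast+
  ultimately have "card (edges_between E X Y) = card ?S"
    by (simp add: card_image)
  also have "real (card ?S) = (\<Sum>p\<in>X \<times> Y. of_bool ({fst p, snd p} \<in> E))"
    using assms by (simp add: sum_of_bool_eq Int_def)
  also have "\<dots> = (\<Sum>x\<in>X. \<Sum>y\<in>Y. of_bool ({x, y} \<in> E))"
    by (simp add: sum.cartesian_product case_prod_unfold)
  finally show ?thesis .
qed

text \<open>
  Regularity says nothing about pairs with a part smaller than \<open>\<delta> n\<close>, but such a pair has at most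
  \<open>\<delta> n\<^sup>2\<close> edges and its expected number of edges is no larger.
\<close>
lemma bipartite_regular_imp_cut_close:
  assumes reg: "bipartite_regular d \<delta> (edges_between E A B) A B"
    and "A \<inter> B = {}" "finite A" "finite B" "card A = n" "card B = n"
  shows "cut_close E d (\<delta> * real n ^ 2) A B"
  unfolding cut_close_def
proof (intro allI impI)
  fix X Y assume X: "X \<subseteq> A" and Y: "Y \<subseteq> B"
  have fin: "finite X" "finite Y" and dis: "X \<inter> Y = {}"
    using X Y assms finite_subset by blast+
  have pars: "0 < \<delta>" "\<delta> \<le> 1" "0 < d" "d \<le> 1"
    using reg by (auto simp: bipartite_regular_def)
  define e where "e = (\<Sum>x\<in>X. \<Sum>y\<in>Y. of_bool ({x, y} \<in> E) :: real)"
  have e_alt: "e = real (card (edges_between (edges_between E A B) X Y))"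
  proof -
    have "edges_between (edges_between E A B) X Y = edges_between E X Y"
      using X Y unfolding edges_between_def by blast
    then show ?thesis
      using card_edges_between[OF dis fin] by (simp add: e_def)
  qed
  have eq: "(\<Sum>x\<in>X. \<Sum>y\<in>Y. of_bool ({x, y} \<in> E) - d) = e - d * (real (card X) * real (card Y))"
    by (simp add: e_def sum_subtractf)
  have cards: "real (card X) \<le> n" "real (card Y) \<le> n"
    using card_mono[OF assms(3) X] card_mono[OF assms(4) Y] assms(5,6) by simp_all
  have e_le: "e \<le> real (card X) * real (card Y)"
  proof -
    have "e \<le> (\<Sum>x\<in>X. \<Sum>y\<in>Y. 1)"
      unfolding e_def by (intro sum_mono) auto
    then show ?thesis by simp
  qed
  have e_ge: "0 \<le> e"
    unfolding e_def by (intro sum_nonneg) auto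
  let ?p = "real (card X) * real (card Y)"
  show "\<bar>\<Sum>x\<in>X. \<Sum>y\<in>Y. of_bool ({x, y} \<in> E) - d\<bar> \<le> \<delta> * real n ^ 2"
  proof (cases "real (card X) \<ge> \<delta> * n \<and> real (card Y) \<ge> \<delta> * n")
    case True
    have p_le: "?p \<le> real n ^ 2"
      using cards by (simp add: power2_eq_square mult_mono)
    show ?thesis
    proof (cases "?p = 0")
      case True
      then have "e = 0"
        using e_le e_ge by linarith
      then show ?thesis
        using eq True pars by simp
    next
      case False
      then have pos: "0 < ?p" by (auto simp: zero_less_mult_iff)
      have "X \<subseteq> A \<and> Y \<subseteq> B \<and> real (card X) \<ge> \<delta> * real (card A) \<and>
          real (card Y) \<ge> \<delta> * real (card B)"
        using True X Y assms(5,6) by simp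
      then have "(1 - \<delta>) * d < edge_density (edges_between E A B) X Y"
        "edge_density (edges_between E A B) X Y < (1 + \<delta>) * d"
        using reg unfolding bipartite_regular_def by simp_all
      moreover have "edge_density (edges_between E A B) X Y = e / ?p"
        by (simp add: edge_density_def e_alt)
      ultimately have "(1 - \<delta>) * d * ?p < e" "e < (1 + \<delta>) * d * ?p"
        using pos by (simp_all add: pos_less_divide_eq pos_divide_less_eq)
      then have "\<bar>e - d * ?p\<bar> \<le> \<delta> * d * ?p"
        by (simp add: algebra_simps abs_le_iff)
      also have "\<dots> \<le> \<delta> * 1 * real n ^ 2"
        using pars p_le by (intro mult_mono) auto
      finally show ?thesis
        using eq by simp
    qed
  next
    case False
    have p_le: "?p \<le> \<delta> * real n ^ 2"
    proof (cases "real (card X) < \<delta> * n")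
      case True
      then have "?p \<le> (\<delta> * n) * n"
        using cards pars by (intro mult_mono) auto
      then show ?thesis by (simp add: power2_eq_square)
    next
      case F: False
      then have "?p \<le> n * (\<delta> * n)"
        using False cards pars by (intro mult_mono) auto
      then show ?thesis by (simp add: power2_eq_square algebra_simps)
    qed
    have "0 \<le> d * ?p" "d * ?p \<le> ?p"
      using pars by (auto simp: mult_left_le_one_le)
    then show ?thesis
      using eq e_le e_ge p_le by linarith
  qed
qed

text \<open>
  When the values of \<open>\<phi>\<close> outside \<open>{x, y}\<close> are fixed, \<open>p\<close> becomes a condition on \<open>\<phi> y\<close> and \<open>q\<close> a
  condition on \<open>\<phi> x\<close>, so the inner sum runs over a product of two sets.
\<close>
lemma edge_replacement:
  fixes W :: "'u \<Rightarrow> 'b set"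
  assumes "finite U" and xy: "x \<in> U" "y \<in> U" "x \<noteq> y"
    and W: "\<And>u. u \<in> U \<Longrightarrow> finite (W u)" "\<And>u. u \<in> U \<Longrightarrow> card (W u) = n"
    and cut: "cut_close E d (\<delta> * real n ^ 2) (W x) (W y)"
    and p: "\<And>\<phi> a. p (\<phi>(x := a)) = p \<phi>" and q: "\<And>\<phi> a. q (\<phi>(y := a)) = q \<phi>"
  shows "\<bar>\<Sum>\<phi>\<in>PiE U W. of_bool (p \<phi> \<and> q \<phi>) * (of_bool ({\<phi> x, \<phi> y} \<in> E) - d)\<bar>
    \<le> \<delta> * real n ^ card U"
proof -
  define U' where "U' = U - {x, y}"
  have U: "U = insert x (insert y U')" and notin: "x \<notin> insert y U'" "y \<notin> U'" and fin: "finite U'"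
    using xy assms(1) by (auto simp: U'_def)
  let ?w = "\<lambda>a b. of_bool ({a, b} \<in> E) - d"
  define X where "X \<rho> = {a \<in> W x. q (\<rho>(x := a))}" for \<rho>
  define Y where "Y \<rho> = {b \<in> W y. p (\<rho>(y := b))}" for \<rho>
  have twist: "q (\<rho>(y := b, x := a)) = q (\<rho>(x := a))" for \<rho> a b
    using q[of "\<rho>(x := a)" b] xy(3) by (simp add: fun_upd_twist)
  have eq1: "(\<Sum>\<phi>\<in>PiE U W. of_bool (p \<phi> \<and> q \<phi>) * ?w (\<phi> x) (\<phi> y)) =
    (\<Sum>\<rho>\<in>PiE U' W. \<Sum>b\<in>W y. \<Sum>a\<in>W x. of_bool (p (\<rho>(y := b)) \<and> q (\<rho>(x := a))) * ?w a b)"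
    unfolding U sum_PiE_insert[OF notin(1)] sum_PiE_insert[OF notin(2)]
    using xy(3) p twist by (simp del: fun_upd_apply add: fun_upd_same fun_upd_other)
  have eq2: "\<dots> = (\<Sum>\<rho>\<in>PiE U' W. \<Sum>a\<in>X \<rho>. \<Sum>b\<in>Y \<rho>. ?w a b)"
  proof (rule sum.cong[OF refl])
    fix \<rho>
    have "(\<Sum>b\<in>W y. \<Sum>a\<in>W x. of_bool (p (\<rho>(y := b)) \<and> q (\<rho>(x := a))) * ?w a b) =
      (\<Sum>a\<in>W x. \<Sum>b\<in>W y. if q (\<rho>(x := a)) then (if p (\<rho>(y := b)) then ?w a b else 0) else 0)"
      by (subst sum.swap) (auto intro!: sum.cong)
    also have "\<dots> = (\<Sum>a\<in>W x. if q (\<rho>(x := a)) then \<Sum>b\<in>Y \<rho>. ?w a b else 0)"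
      unfolding Y_def using W xy by (auto intro!: sum.cong simp: sum.inter_filter)
    also have "\<dots> = (\<Sum>a\<in>X \<rho>. \<Sum>b\<in>Y \<rho>. ?w a b)"
      unfolding X_def using W xy by (auto simp: sum.inter_filter)
    finally show "(\<Sum>b\<in>W y. \<Sum>a\<in>W x. of_bool (p (\<rho>(y := b)) \<and> q (\<rho>(x := a))) * ?w a b) =
      (\<Sum>a\<in>X \<rho>. \<Sum>b\<in>Y \<rho>. ?w a b)" .
  qed
  have "\<bar>\<Sum>\<rho>\<in>PiE U' W. \<Sum>a\<in>X \<rho>. \<Sum>b\<in>Y \<rho>. ?w a b\<bar> \<le> (\<Sum>\<rho>\<in>PiE U' W. \<bar>\<Sum>a\<in>X \<rho>. \<Sum>b\<in>Y \<rho>. ?w a b\<bar>)"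
    by (rule sum_abs)
  also have "\<dots> \<le> (\<Sum>\<rho>\<in>PiE U' W. \<delta> * real n ^ 2)"
    using cut unfolding cut_close_def X_def Y_def by (intro sum_mono) auto
  also have "\<dots> = \<delta> * real n ^ card U"
  proof -
    have "card U = card U' + 2"
      using fin notin by (simp add: U)
    then show ?thesis
      using W fin by (simp add: card_PiE U power_add power2_eq_square)
  qed
  finally show ?thesis
    unfolding eq1 eq2 .
qed

text \<open>
  The form of a condition to which \<open>edge_replacement\<close> applies. The two parts are sets of maps rather
  than predicates only to keep unification first-order.
\<close>
definition splits_at :: "'u \<Rightarrow> 'u \<Rightarrow> (('u \<Rightarrow> 'v) \<Rightarrow> bool) \<Rightarrow> bool" where
  "splits_at x y g \<longleftrightarrow> (\<exists>P Q. (\<forall>\<phi>. g \<phi> \<longleftrightarrow> \<phi> \<in> P \<and> \<phi> \<in> Q) \<and>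
     (\<forall>\<phi> a. \<phi>(x := a) \<in> P \<longleftrightarrow> \<phi> \<in> P) \<and> (\<forall>\<phi> a. \<phi>(y := a) \<in> Q \<longleftrightarrow> \<phi> \<in> Q))"

text \<open>
  The edges are replaced one at a time: when the edge \<open>xy\<close> is replaced, every other edge misses \<open>x\<close>
  or misses \<open>y\<close>, so it can be moved to the appropriate side of the splitting.
\<close>
lemma hom_count:
  fixes W :: "'u \<Rightarrow> 'b set"
  assumes "finite U" "finite Fs"
    and W: "\<And>u. u \<in> U \<Longrightarrow> finite (W u)" "\<And>u. u \<in> U \<Longrightarrow> card (W u) = n"
    and d: "0 \<le> d" "d \<le> 1"
    and Fs: "\<And>e. e \<in> Fs \<Longrightarrow> \<exists>x\<in>U. \<exists>y\<in>U. x \<noteq> y \<and> e = {x, y} \<and>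
        cut_close E d (\<delta> * real n ^ 2) (W x) (W y) \<and>
        splits_at x y g"
  shows "\<bar>(\<Sum>\<phi>\<in>PiE U W. of_bool (g \<phi> \<and> (\<forall>e\<in>Fs. \<phi> ` e \<in> E))) -
      d ^ card Fs * (\<Sum>\<phi>\<in>PiE U W. of_bool (g \<phi>))\<bar> \<le> real (card Fs) * \<delta> * real n ^ card U"
  using \<open>finite Fs\<close> Fs
proof (induction Fs)
  case empty
  then show ?case by simp
next
  case (insert e Fs)
  let ?N = "\<lambda>Fs. \<Sum>\<phi>\<in>PiE U W. of_bool (g \<phi> \<and> (\<forall>e\<in>Fs. \<phi> ` e \<in> E)) :: real"
  let ?I = "\<Sum>\<phi>\<in>PiE U W. of_bool (g \<phi>) :: real"
  obtain x y where xy: "x \<in> U" "y \<in> U" "x \<noteq> y" "e = {x, y}"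
    and cut: "cut_close E d (\<delta> * real n ^ 2) (W x) (W y)" and split: "splits_at x y g"
    using insert.prems[of e] by blast
  obtain P Q where PQ: "(\<forall>\<phi>. g \<phi> \<longleftrightarrow> \<phi> \<in> P \<and> \<phi> \<in> Q) \<and>
     (\<forall>\<phi> a. \<phi>(x := a) \<in> P \<longleftrightarrow> \<phi> \<in> P) \<and> (\<forall>\<phi> a. \<phi>(y := a) \<in> Q \<longleftrightarrow> \<phi> \<in> Q)"
    using iffD1[OF splits_at_def split] by (elim exE)
  note g = PQ[THEN conjunct1, rule_format] and P = PQ[THEN conjunct2, THEN conjunct1, rule_format]
    and Q = PQ[THEN conjunct2, THEN conjunct2, rule_format]
  define p' where "p' \<phi> \<longleftrightarrow> \<phi> \<in> P \<and> (\<forall>e\<in>Fs. x \<notin> e \<longrightarrow> \<phi> ` e \<in> E)" for \<phi>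
  define q' where "q' \<phi> \<longleftrightarrow> \<phi> \<in> Q \<and> (\<forall>e\<in>Fs. x \<in> e \<longrightarrow> \<phi> ` e \<in> E)" for \<phi>
  have upd: "(\<phi>(u := a)) ` e' = \<phi> ` e'" if "u \<notin> e'" for \<phi> :: "'u \<Rightarrow> 'b" and u a e'
    using that by auto
  have noty: "y \<notin> e'" if e': "e' \<in> Fs" "x \<in> e'" for e'
  proof -
    obtain u v where "e' = {u, v}"
      using insert.prems[OF insertI2[OF e'(1)]] by blast
    then show ?thesis
      using e' xy insert.hyps(2) by (metis doubleton_eq_iff insertE singletonD)
  qed
  have p': "p' (\<phi>(x := a)) = p' \<phi>" for \<phi> a
  proof -
    have "\<forall>e\<in>Fs. x \<notin> e \<longrightarrow> (\<phi>(x := a)) ` e = \<phi> ` e"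
      using upd[of x _ \<phi> a] by blast
    then show ?thesis
      unfolding p'_def P[of \<phi> a] by (auto simp del: fun_upd_apply)
  qed
  have q': "q' (\<phi>(y := a)) = q' \<phi>" for \<phi> a
  proof -
    have "\<forall>e\<in>Fs. x \<in> e \<longrightarrow> (\<phi>(y := a)) ` e = \<phi> ` e"
      using upd[of y _ \<phi> a] noty by blast
    then show ?thesis
      unfolding q'_def Q[of \<phi> a] by (auto simp del: fun_upd_apply)
  qed
  have "?N (insert e Fs) - d * ?N Fs =
    (\<Sum>\<phi>\<in>PiE U W. of_bool (p' \<phi> \<and> q' \<phi>) * (of_bool ({\<phi> x, \<phi> y} \<in> E) - d))"
    unfolding sum_distrib_left sum_subtractf[symmetric]
    by (intro sum.cong refl) (auto simp: p'_def q'_def g xy(4))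
  then have step: "\<bar>?N (insert e Fs) - d * ?N Fs\<bar> \<le> \<delta> * real n ^ card U"
    using edge_replacement[OF assms(1) xy(1-3) W cut p' q'] by simp
  have "\<bar>?N Fs - d ^ card Fs * ?I\<bar> \<le> real (card Fs) * \<delta> * real n ^ card U" (is "?a \<le> ?b")
    using insert by simp
  then have "d * ?a \<le> ?b"
    using d mult_left_le_one_le[of ?a d] by linarith
  then have "\<bar>d * ?N Fs - d ^ card (insert e Fs) * ?I\<bar> \<le> ?b"
    using insert.hyps d abs_mult[of d "?N Fs - d ^ card Fs * ?I"] by (simp add: algebra_simps)
  with step have "\<bar>?N (insert e Fs) - d ^ card (insert e Fs) * ?I\<bar>
      \<le> \<delta> * real n ^ card U + real (card Fs) * \<delta> * real n ^ card U"
    by linarith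
  then show ?case
    using insert.hyps by (simp add: algebra_simps)
qed

lemma splits_at_True: "splits_at x y (\<lambda>_. True)"
  unfolding splits_at_def by blast

text \<open>
  A map \<open>\<sigma>\<close> of \<open>S\<close> is atypical if it is compatible with more than twice the expected number of
  members of \<open>A\<close>. Counting the compatible pairs over all atypical \<open>\<sigma>\<close> by \<open>hom_count\<close> gives both a
  lower bound of twice the expectation and an upper bound of once the expectation plus an error, so
  the error bounds the number of atypical \<open>\<sigma>\<close>. Edges inside \<open>B\<close> can be included when \<open>A\<close> imposes no
  condition; for general \<open>A\<close> the edges have to run between \<open>S\<close> and \<open>B\<close>, since an arbitrary
  condition on maps of \<open>B\<close> does not split at an edge inside \<open>B\<close>.
\<close>
lemma few_atypical:
  fixes W :: "'u \<Rightarrow> 'b set"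
  assumes fin: "finite S" "finite B" "finite Fs" and dis: "S \<inter> B = {}"
    and W: "\<And>u. u \<in> S \<union> B \<Longrightarrow> finite (W u)" "\<And>u. u \<in> S \<union> B \<Longrightarrow> card (W u) = n"
    and d: "0 < d" "d \<le> 1"
    and A: "A \<subseteq> PiE B W" "real (card A) \<le> a"
    and Fs: "\<And>e. e \<in> Fs \<Longrightarrow> \<exists>x\<in>S \<union> B. \<exists>y\<in>B. x \<noteq> y \<and> e = {x, y} \<and>
        (x \<in> S \<or> A = PiE B W) \<and> cut_close E d (\<delta> * real n ^ 2) (W x) (W y)"
  shows "d ^ card Fs * a * real (card {\<sigma> \<in> PiE S W.
      real (card {\<beta> \<in> A. \<forall>e\<in>Fs. (\<lambda>u. if u \<in> B then \<beta> u else \<sigma> u) ` e \<in> E}) > 2 * d ^ card Fs * a})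
    \<le> real (card Fs) * \<delta> * real n ^ (card S + card B)"
proof -
  define mg :: "('u \<Rightarrow> 'b) \<Rightarrow> ('u \<Rightarrow> 'b) \<Rightarrow> 'u \<Rightarrow> 'b"
    where "mg \<beta> \<sigma> = (\<lambda>u. if u \<in> B then \<beta> u else \<sigma> u)" for \<beta> \<sigma>
  define N where "N \<sigma> = card {\<beta> \<in> A. \<forall>e\<in>Fs. mg \<beta> \<sigma> ` e \<in> E}" for \<sigma>
  define Y where "Y = {\<sigma> \<in> PiE S W. real (N \<sigma>) > 2 * d ^ card Fs * a}"
  define g where "g \<phi> \<longleftrightarrow> restrict \<phi> S \<in> Y \<and> (A = PiE B W \<or> restrict \<phi> B \<in> A)" for \<phi>
  have finP: "finite (PiE B W)" "finite (PiE S W)"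
    using fin W by (auto intro!: finite_PiE)
  have finA: "finite A"
    using A(1) finP(1) finite_subset by blast
  have finY: "finite Y" "Y \<subseteq> PiE S W"
    using finP(2) by (auto simp: Y_def)
  have split: "splits_at x y g" if xy: "y \<in> B" "x \<in> S \<or> A = PiE B W" for x y
  proof (cases "A = PiE B W")
    case True
    have "restrict (\<phi>(y := a)) S = restrict \<phi> S" for \<phi> :: "'u \<Rightarrow> 'b" and a
      using xy dis by (auto simp: restrict_def fun_eq_iff)
    then show ?thesis
      using True unfolding splits_at_def g_def
      by - (rule exI[of _ UNIV], rule exI[of _ "{\<phi>. restrict \<phi> S \<in> Y}"], simp del: fun_upd_apply)
  next
    case False
    have "restrict (\<phi>(y := a)) S = restrict \<phi> S" "restrict (\<phi>(x := a)) B = restrict \<phi> B" for \<phi> :: "'u \<Rightarrow> 'b" and a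
      using xy dis False by (auto simp: restrict_def fun_eq_iff)
    then show ?thesis
      using False unfolding splits_at_def g_def
      by - (rule exI[of _ "{\<phi>. restrict \<phi> B \<in> A}"], rule exI[of _ "{\<phi>. restrict \<phi> S \<in> Y}"], auto simp del: fun_upd_apply)
  qed
  have "\<bar>(\<Sum>\<phi>\<in>PiE (B \<union> S) W. of_bool (g \<phi> \<and> (\<forall>e\<in>Fs. \<phi> ` e \<in> E))) -
      d ^ card Fs * (\<Sum>\<phi>\<in>PiE (B \<union> S) W. of_bool (g \<phi>))\<bar>
      \<le> real (card Fs) * \<delta> * real n ^ card (B \<union> S)"
  proof (rule hom_count)
    fix e assume "e \<in> Fs"
    then obtain x y where "x \<in> S \<union> B" "y \<in> B" "x \<noteq> y" "e = {x, y}" "x \<in> S \<or> A = PiE B W"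
      "cut_close E d (\<delta> * real n ^ 2) (W x) (W y)"
      using Fs by blast
    then show "\<exists>x\<in>B \<union> S. \<exists>y\<in>B \<union> S. x \<noteq> y \<and> e = {x, y} \<and>
        cut_close E d (\<delta> * real n ^ 2) (W x) (W y) \<and> splits_at x y g"
      using split by (intro bexI[of _ x] bexI[of _ y]) auto
  qed (use fin W d in auto)
  moreover have g_mg: "g (mg \<beta> \<sigma>) \<longleftrightarrow> \<sigma> \<in> Y \<and> \<beta> \<in> A" if "\<beta> \<in> PiE B W" "\<sigma> \<in> PiE S W" for \<beta> \<sigma>
  proof -
    have "restrict (mg \<beta> \<sigma>) S = \<sigma>" "restrict (mg \<beta> \<sigma>) B = \<beta>"
      using that dis by (auto simp: mg_def fun_eq_iff PiE_def extensional_def restrict_def)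
    then show ?thesis
      using that by (auto simp: g_def)
  qed
  have "(\<Sum>\<phi>\<in>PiE (B \<union> S) W. of_bool (g \<phi> \<and> (\<forall>e\<in>Fs. \<phi> ` e \<in> E))) = (\<Sum>\<sigma>\<in>Y. real (N \<sigma>))"
  proof -
    have "(\<Sum>\<phi>\<in>PiE (B \<union> S) W. of_bool (g \<phi> \<and> (\<forall>e\<in>Fs. \<phi> ` e \<in> E)) :: real) =
      (\<Sum>\<beta>\<in>PiE B W. \<Sum>\<sigma>\<in>PiE S W. of_bool (g (mg \<beta> \<sigma>) \<and> (\<forall>e\<in>Fs. mg \<beta> \<sigma> ` e \<in> E)))"
      unfolding mg_def using dis by (intro sum_PiE_Un) auto
    also have "\<dots> = (\<Sum>\<sigma>\<in>PiE S W. \<Sum>\<beta>\<in>PiE B W. of_bool (g (mg \<beta> \<sigma>) \<and> (\<forall>e\<in>Fs. mg \<beta> \<sigma> ` e \<in> E)))"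
      by (rule sum.swap)
    also have "\<dots> = (\<Sum>\<sigma>\<in>PiE S W. if \<sigma> \<in> Y then real (N \<sigma>) else 0)"
    proof (rule sum.cong[OF refl])
      fix \<sigma> assume \<sigma>: "\<sigma> \<in> PiE S W"
      have "(\<Sum>\<beta>\<in>PiE B W. of_bool (g (mg \<beta> \<sigma>) \<and> (\<forall>e\<in>Fs. mg \<beta> \<sigma> ` e \<in> E))) =
        real (card {\<beta> \<in> PiE B W. g (mg \<beta> \<sigma>) \<and> (\<forall>e\<in>Fs. mg \<beta> \<sigma> ` e \<in> E)})"
        using finP by (simp add: sum_of_bool_eq Int_def)
      also have "{\<beta> \<in> PiE B W. g (mg \<beta> \<sigma>) \<and> (\<forall>e\<in>Fs. mg \<beta> \<sigma> ` e \<in> E)} =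
        (if \<sigma> \<in> Y then {\<beta> \<in> A. \<forall>e\<in>Fs. mg \<beta> \<sigma> ` e \<in> E} else {})"
        using g_mg[OF _ \<sigma>] A(1) by auto
      finally show "(\<Sum>\<beta>\<in>PiE B W. of_bool (g (mg \<beta> \<sigma>) \<and> (\<forall>e\<in>Fs. mg \<beta> \<sigma> ` e \<in> E))) =
        (if \<sigma> \<in> Y then real (N \<sigma>) else 0)"
        by (simp add: N_def)
    qed
    also have "\<dots> = (\<Sum>\<sigma>\<in>Y. real (N \<sigma>))"
      using finP(2) finY by (simp add: sum.If_cases Int_absorb1)
    finally show ?thesis .
  qed
  moreover have "(\<Sum>\<phi>\<in>PiE (B \<union> S) W. of_bool (g \<phi>)) = real (card Y) * real (card A)"
  proof -
    have "(\<Sum>\<phi>\<in>PiE (B \<union> S) W. of_bool (g \<phi>) :: real) =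
      (\<Sum>\<beta>\<in>PiE B W. \<Sum>\<sigma>\<in>PiE S W. of_bool (g (mg \<beta> \<sigma>)))"
      unfolding mg_def using dis by (intro sum_PiE_Un) auto
    also have "\<dots> = (\<Sum>\<beta>\<in>PiE B W. \<Sum>\<sigma>\<in>PiE S W. of_bool (\<sigma> \<in> Y) * of_bool (\<beta> \<in> A))"
      by (intro sum.cong refl) (simp add: g_mg)
    also have "\<dots> = (\<Sum>\<beta>\<in>PiE B W. of_bool (\<beta> \<in> A)) * (\<Sum>\<sigma>\<in>PiE S W. of_bool (\<sigma> \<in> Y))"
      by (simp add: sum_product mult.commute)
    also have "\<dots> = real (card Y) * real (card A)"
      using finP finY A(1) by (simp add: sum_of_bool_eq Int_absorb1)
    finally show ?thesis .
  qed
  moreover have "card (B \<union> S) = card S + card B"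
    using fin dis by (simp add: card_Un_disjoint Int_commute)
  ultimately have "(\<Sum>\<sigma>\<in>Y. real (N \<sigma>)) \<le>
      d ^ card Fs * (real (card Y) * real (card A)) + real (card Fs) * \<delta> * real n ^ (card S + card B)"
    by (simp add: abs_le_iff)
  also have "\<dots> \<le> d ^ card Fs * (real (card Y) * a) + real (card Fs) * \<delta> * real n ^ (card S + card B)"
    using A(2) d by (intro add_right_mono mult_left_mono) auto
  finally have upper: "(\<Sum>\<sigma>\<in>Y. real (N \<sigma>)) \<le>
      d ^ card Fs * a * real (card Y) + real (card Fs) * \<delta> * real n ^ (card S + card B)"
    by (simp add: mult_ac)
  have "real (card Y) * (2 * d ^ card Fs * a) \<le> (\<Sum>\<sigma>\<in>Y. real (N \<sigma>))"
    by (rule sum_bounded_below) (simp add: Y_def)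
  with upper have "d ^ card Fs * a * real (card Y) \<le> real (card Fs) * \<delta> * real n ^ (card S + card B)"
    by (simp add: mult_ac)
  then show ?thesis
    by (simp add: Y_def N_def mg_def)
qed

section \<open>Replacing a hyperedge by its density\<close>

text \<open>
  For a random tuple \<open>s\<close> of length \<open>R\<close> the expected sum of \<open>f\<close> over the sets \<open>T (s i)\<close> is \<open>R\<close> times
  the average. Passing from the family to its union loses at most \<open>M\<close> for each element in the
  intersection of two members, and there are \<open>R (R - 1) / 2\<close> pairs. The bound below is the
  resulting expectation, multiplied by \<open>|S|\<^sup>2\<close>.
\<close>
lemma exists_tuple_large_union_sum:
  fixes f :: "'c \<Rightarrow> real" and T :: "'s \<Rightarrow> 'c set"
  assumes "finite S" "S \<noteq> {}" and fin: "\<And>s. s \<in> S \<Longrightarrow> finite (T s)"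
    and fM: "\<And>t. f t \<le> M" and "0 \<le> M"
  shows "\<exists>s. (\<forall>i<R. s i \<in> S) \<and>
    real (card S) ^ 2 * sum f (\<Union>i<R. T (s i)) \<ge>
      real R * real (card S) * (\<Sum>u\<in>S. sum f (T u)) -
      M * (real R * (real R - 1) / 2) * (\<Sum>u\<in>S. \<Sum>v\<in>S. real (card (T u \<inter> T v)))"
proof -
  define G where "G R s = (\<Sum>i<R. sum f (T (s i))) -
    M * (\<Sum>i<R. \<Sum>j<i. real (card (T (s j) \<inter> T (s i))))" for R :: nat and s
  let ?P = "\<lambda>R. PiE {..<R} (\<lambda>_. S)"
  let ?c = "real (card S)"
  let ?D = "\<Sum>u\<in>S. sum f (T u)" and ?O = "\<Sum>u\<in>S. \<Sum>v\<in>S. real (card (T u \<inter> T v))"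
  have c: "0 < ?c"
    using assms by (simp add: card_gt_0_iff)
  have union: "G R s \<le> sum f (\<Union>i<R. T (s i))" if "\<forall>i<R. s i \<in> S" for R s
    using that
  proof (induction R)
    case 0
    then show ?case by (simp add: G_def)
  next
    case (Suc R)
    let ?U = "\<Union>i<R. T (s i)"
    have finU: "finite ?U" and finT: "finite (T (s R))"
      using Suc.prems fin by auto
    have Un: "(\<Union>i<Suc R. T (s i)) = ?U \<union> T (s R)"
      by (auto simp: less_Suc_eq)
    have "sum f (?U \<inter> T (s R)) \<le> M * real (card (?U \<inter> T (s R)))"
      using sum_bounded_above[of "?U \<inter> T (s R)" f M] fM by (simp add: mult.commute)
    also have "\<dots> \<le> M * (\<Sum>j<R. real (card (T (s j) \<inter> T (s R))))"
    proof (rule mult_left_mono[OF _ \<open>0 \<le> M\<close>])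
      have "card (\<Union>j<R. T (s j) \<inter> T (s R)) \<le> (\<Sum>j<R. card (T (s j) \<inter> T (s R)))"
        by (rule card_UN_le) simp
      then show "real (card (?U \<inter> T (s R))) \<le> (\<Sum>j<R. real (card (T (s j) \<inter> T (s R))))"
        by (simp flip: of_nat_sum)
    qed
    finally have ov: "sum f (?U \<inter> T (s R)) \<le> M * (\<Sum>j<R. real (card (T (s j) \<inter> T (s R))))" .
    have "G (Suc R) s = G R s + sum f (T (s R)) - M * (\<Sum>j<R. real (card (T (s j) \<inter> T (s R))))"
      by (simp add: G_def algebra_simps)
    also have "\<dots> \<le> sum f ?U + sum f (T (s R)) - sum f (?U \<inter> T (s R))"
      using Suc ov by fastforce
    also have "\<dots> = sum f (\<Union>i<Suc R. T (s i))"
      unfolding Un by (rule sum_Un[OF finU finT, symmetric])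
    finally show ?case .
  qed
  have avg: "?c ^ 2 * (\<Sum>s\<in>?P R. G R s) =
    ?c ^ R * (real R * ?c * ?D - M * (real R * (real R - 1) / 2) * ?O)" for R
  proof (induction R)
    case 0
    then show ?case by (simp add: G_def)
  next
    case (Suc R)
    have upd: "G (Suc R) (s(R := u)) =
      G R s + sum f (T u) - M * (\<Sum>j<R. real (card (T (s j) \<inter> T u)))" for s u
    proof -
      have "(\<Sum>i<R. sum f (T ((s(R := u)) i))) = (\<Sum>i<R. sum f (T (s i)))"
        "(\<Sum>i<R. \<Sum>j<i. real (card (T ((s(R := u)) j) \<inter> T ((s(R := u)) i)))) =
          (\<Sum>i<R. \<Sum>j<i. real (card (T (s j) \<inter> T (s i))))"
        "(\<Sum>j<R. real (card (T ((s(R := u)) j) \<inter> T u))) = (\<Sum>j<R. real (card (T (s j) \<inter> T u)))"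
        by (intro sum.cong refl; simp)+
      then show ?thesis
        by (simp add: G_def algebra_simps)
    qed
    have cP: "real (card (?P R)) = ?c ^ R"
      by (simp add: card_PiE)
    have ovl: "?c * (\<Sum>s\<in>?P R. \<Sum>u\<in>S. \<Sum>j<R. real (card (T (s j) \<inter> T u))) = real R * ?c ^ R * ?O"
    proof -
      have "(\<Sum>s\<in>?P R. \<Sum>u\<in>S. \<Sum>j<R. real (card (T (s j) \<inter> T u))) =
        (\<Sum>s\<in>?P R. \<Sum>j<R. \<Sum>u\<in>S. real (card (T (s j) \<inter> T u)))"
        by (intro sum.cong[OF refl] sum.swap)
      also have "\<dots> = (\<Sum>j<R. \<Sum>s\<in>?P R. \<Sum>u\<in>S. real (card (T (s j) \<inter> T u)))"
        by (rule sum.swap)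
      also have "\<dots> = (\<Sum>j<R. ?c ^ (R - 1) * ?O)"
        using sum_PiE_coordinate[of "{..<R}" _ S "\<lambda>v. \<Sum>u\<in>S. real (card (T v \<inter> T u))"]
        by (intro sum.cong[OF refl]) (simp add: assms(1))
      finally show ?thesis
        by (cases R) auto
    qed
    have "(\<Sum>s\<in>?P (Suc R). G (Suc R) s) = (\<Sum>s\<in>?P R. \<Sum>u\<in>S. G (Suc R) (s(R := u)))"
      unfolding lessThan_Suc by (rule sum_PiE_insert) simp
    also have "\<dots> = ?c * (\<Sum>s\<in>?P R. G R s) + ?c ^ R * ?D -
        M * (\<Sum>s\<in>?P R. \<Sum>u\<in>S. \<Sum>j<R. real (card (T (s j) \<inter> T u)))"
      unfolding upd by (simp add: sum.distrib sum_subtractf sum_distrib_left cP)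
    finally have sumS: "(\<Sum>s\<in>?P (Suc R). G (Suc R) s) = ?c * (\<Sum>s\<in>?P R. G R s) + ?c ^ R * ?D -
        M * (\<Sum>s\<in>?P R. \<Sum>u\<in>S. \<Sum>j<R. real (card (T (s j) \<inter> T u)))" .
    have "?c ^ 2 * (\<Sum>s\<in>?P (Suc R). G (Suc R) s) =
        ?c * (?c ^ 2 * (\<Sum>s\<in>?P R. G R s)) + ?c ^ R * ?c ^ 2 * ?D -
        M * ?c * (?c * (\<Sum>s\<in>?P R. \<Sum>u\<in>S. \<Sum>j<R. real (card (T (s j) \<inter> T u))))"
      unfolding sumS by (simp add: algebra_simps power2_eq_square)
    also have "\<dots> = ?c ^ Suc R * (real (Suc R) * ?c * ?D -
        M * (real (Suc R) * (real (Suc R) - 1) / 2) * ?O)"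
      unfolding Suc.IH ovl by (simp add: field_simps power2_eq_square)
    finally show ?case .
  qed
  let ?B = "real R * ?c * ?D - M * (real R * (real R - 1) / 2) * ?O"
  have "\<exists>s\<in>?P R. ?c ^ 2 * G R s \<ge> ?B"
  proof (rule ccontr)
    assume "\<not> ?thesis"
    then have less: "?c ^ 2 * G R s < ?B" if "s \<in> ?P R" for s
      using that by (meson not_le)
    have "?P R \<noteq> {}"
      using assms(2) by (simp add: PiE_eq_empty_iff)
    then have "(\<Sum>s\<in>?P R. ?c ^ 2 * G R s) < (\<Sum>s\<in>?P R. ?B)"
      using assms(1) less by (intro sum_strict_mono finite_PiE) auto
    then show False
      using avg[of R] by (simp add: sum_distrib_left card_PiE)
  qed
  then obtain s where s: "s \<in> ?P R" "?c ^ 2 * G R s \<ge> ?B"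
    by blast
  then have sS: "\<forall>i<R. s i \<in> S"
    by (auto simp: PiE_iff)
  have "?c ^ 2 * G R s \<le> ?c ^ 2 * sum f (\<Union>i<R. T (s i))"
    using union[OF sS] c by (intro mult_left_mono) auto
  then show ?thesis
    using sS order_trans[OF s(2)] by blast
qed

definition triads_of :: "'b set set \<Rightarrow> 'b set \<Rightarrow> 'b set \<Rightarrow> 'b set \<Rightarrow> ('b \<times> 'b \<times> 'b) set" where
  "triads_of E A B C =
     {(a, b, c). a \<in> A \<and> b \<in> B \<and> c \<in> C \<and> {a, b} \<in> E \<and> {b, c} \<in> E \<and> {a, c} \<in> E}"

text \<open>
  The half of the regularity of a triad that is used in lower bounds, for families of subtriads
  given by three relations each. Triangles appear as ordered triples, so that they can serve as
  values of a map at three given vertices.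
\<close>
definition lower_regular ::
    "real \<Rightarrow> real \<Rightarrow> nat \<Rightarrow> 'b set set \<Rightarrow> 'b set set \<Rightarrow> 'b set \<Rightarrow> 'b set \<Rightarrow> 'b set \<Rightarrow> bool" where
  "lower_regular d \<delta> r E F A B C \<longleftrightarrow>
     (\<forall>QAB QBC QAC :: nat \<Rightarrow> 'b \<Rightarrow> 'b \<Rightarrow> bool.
        let T = (\<Union>i<r. {(a, b, c) \<in> triads_of E A B C. QAB i a b \<and> QBC i b c \<and> QAC i a c})
        in \<delta> * real (card (triads_of E A B C)) \<le> real (card T) \<longrightarrow>
           (\<Sum>(a, b, c)\<in>T. d - of_bool ({a, b, c} \<in> F)) \<le> \<delta> * real (card T))"

text \<open>
  Fixing the values \<open>s\<close> of \<open>\<phi>\<close> outside \<open>{x, y, z}\<close> turns \<open>p1\<close>, \<open>p2\<close>, \<open>p3\<close> into conditions on the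
  pairs \<open>yz\<close>, \<open>xz\<close>, \<open>xy\<close>, that is, into a subtriad with triangle set \<open>T s\<close>. All triangles lie in
  about \<open>d\<^bsup>C\<^esup> |S|\<close> of the sets \<open>T s\<close> at most, apart from few exceptions, where \<open>C\<close> counts the edges
  other than \<open>xy\<close>, \<open>yz\<close>, \<open>xz\<close>; hence on average two sets \<open>T s\<close> meet in a proportion of order
  \<open>d\<^bsup>2C\<^esup>\<close> of the triangles. A random tuple of about \<open>\<epsilon> / (18 d\<^bsup>C\<^esup>)\<close> of them then covers a proportion of
  order \<open>\<epsilon>\<close> with overlaps of order \<open>\<epsilon>\<^sup>2\<close>. If the conclusion fails, the sum of \<open>d3 - 1\<^sub>F\<close> over the union of a
  suitable tuple is of order \<open>\<epsilon>\<^sup>2\<close> times the number of triangles, which is too much for a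
  regular triad with \<open>\<delta>3\<close> small compared with \<open>\<epsilon>\<^sup>2\<close>.
\<close>
lemma hyperedge_replacement:
  fixes W :: "'u \<Rightarrow> 'b set" and E F :: "'b set set"
  assumes U: "finite U" "x \<in> U" "y \<in> U" "z \<in> U" and ne: "x \<noteq> y" "y \<noteq> z" "x \<noteq> z"
    and W: "\<And>u. u \<in> U \<Longrightarrow> finite (W u)" "\<And>u. u \<in> U \<Longrightarrow> card (W u) = n" and n: "0 < n"
    and Es: "finite Es" "{x, y} \<in> Es" "{y, z} \<in> Es" "{x, z} \<in> Es"
      "\<And>e. e \<in> Es \<Longrightarrow> \<exists>u\<in>U. \<exists>v\<in>U. u \<noteq> v \<and> e = {u, v} \<and> cut_close E d (\<delta> * real n ^ 2) (W u) (W v)"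
    and reg: "lower_regular d3 \<delta>3 r E F (W x) (W y) (W z)"
    and p: "\<And>\<phi> a. p1 (\<phi>(x := a)) = p1 \<phi>" "\<And>\<phi> a. p2 (\<phi>(y := a)) = p2 \<phi>"
      "\<And>\<phi> a. p3 (\<phi>(z := a)) = p3 \<phi>"
    and hom: "\<And>\<phi> e. \<phi> \<in> PiE U W \<Longrightarrow> p1 \<phi> \<Longrightarrow> p2 \<phi> \<Longrightarrow> p3 \<phi> \<Longrightarrow> e \<in> Es \<Longrightarrow> \<phi> ` e \<in> E"
    and d: "0 < d" "d \<le> 1" "0 \<le> d3" "d3 \<le> 2" "0 < \<epsilon>" "\<epsilon> \<le> 1"
    and C: "card Es = C + 3"
    and small: "3 * \<delta> \<le> d ^ 3" "real C * \<delta> \<le> d ^ (3 + 3 * C)" "2 \<le> real r * d ^ C"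
      "\<delta>3 \<le> \<epsilon> ^ 2 / 144"
  shows "(\<Sum>\<phi>\<in>{\<phi> \<in> PiE U W. p1 \<phi> \<and> p2 \<phi> \<and> p3 \<phi>}. d3 - of_bool ({\<phi> x, \<phi> y, \<phi> z} \<in> F))
    \<le> \<epsilon> * real n ^ card U * d ^ card Es"
proof (rule ccontr)
  define K where "K = {x, y, z}"
  define Ot where "Ot = U - K"
  define S where "S = PiE Ot W"
  define N3 where "N3 = real n ^ 3"
  define c where "c = real n ^ card Ot"
  define f where "f \<kappa> = d3 - of_bool ({\<kappa> x, \<kappa> y, \<kappa> z} \<in> F)" for \<kappa> :: "'u \<Rightarrow> 'b"
  define mg :: "('u \<Rightarrow> 'b) \<Rightarrow> ('u \<Rightarrow> 'b) \<Rightarrow> 'u \<Rightarrow> 'b"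
    where "mg \<beta> \<sigma> = (\<lambda>u. if u \<in> Ot then \<beta> u else \<sigma> u)" for \<beta> \<sigma>
  define \<Phi> where "\<Phi> = {\<phi> \<in> PiE U W. p1 \<phi> \<and> p2 \<phi> \<and> p3 \<phi>}"
  define T where "T s = {\<kappa> \<in> PiE K W. mg s \<kappa> \<in> \<Phi>}" for s
  define Ein where "Ein = {{x, y}, {y, z}, {x, z}}"
  define Eout where "Eout = {e \<in> Es. \<not> e \<subseteq> K}"
  define Tri where "Tri = {\<kappa> \<in> PiE K W. \<forall>e\<in>Ein. \<kappa> ` e \<in> E}"
  define N where "N \<kappa> = card {s \<in> S. \<forall>e\<in>Eout. mg s \<kappa> ` e \<in> E}" for \<kappa>
  assume "\<not> ?thesis"
  then have big: "\<epsilon> * real n ^ card U * d ^ card Es < (\<Sum>\<phi>\<in>\<Phi>. f \<phi>)"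
    by (simp add: \<Phi>_def f_def)
  have K: "K \<subseteq> U" "finite K" "card K = 3" "K \<inter> Ot = {}" "K \<union> Ot = U" "finite Ot"
    using U ne by (auto simp: K_def Ot_def)
  have cardU: "card U = 3 + card Ot"
    using K card_Un_disjoint[of K Ot] by simp
  have WK: "\<And>u. u \<in> K \<Longrightarrow> finite (W u)" "\<And>u. u \<in> K \<Longrightarrow> card (W u) = n"
    and WO: "\<And>u. u \<in> Ot \<Longrightarrow> finite (W u)" "\<And>u. u \<in> Ot \<Longrightarrow> card (W u) = n"
    using W K by auto
  have finPK: "finite (PiE K W)" and finS: "finite S"
    unfolding S_def using K WK WO by (auto intro!: finite_PiE)
  have cS: "real (card S) = c"
    unfolding S_def c_def using K WO by (simp add: card_PiE)
  have cpos: "0 < c" "0 < N3"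
    using n by (simp_all add: c_def N3_def)
  have mgO: "mg s \<kappa> x = \<kappa> x" "mg s \<kappa> y = \<kappa> y" "mg s \<kappa> z = \<kappa> z" for s \<kappa>
    by (auto simp: mg_def Ot_def K_def)
  have mgU: "mg s \<kappa> \<in> PiE U W" if "s \<in> S" "\<kappa> \<in> PiE K W" for s \<kappa>
    using that K(5) unfolding S_def mg_def by (auto simp: PiE_def Pi_def extensional_def)
  have fmg: "f (mg s \<kappa>) = f \<kappa>" for s \<kappa>
    by (simp add: f_def mgO)
  have sumT: "(\<Sum>\<phi>\<in>\<Phi>. f \<phi>) = (\<Sum>s\<in>S. sum f (T s))"
  proof -
    have "(\<Sum>\<phi>\<in>\<Phi>. f \<phi>) = (\<Sum>\<phi>\<in>PiE (Ot \<union> K) W. if \<phi> \<in> \<Phi> then f \<phi> else 0)"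
    proof (subst sum.inter_filter[symmetric])
      show "finite (PiE (Ot \<union> K) W)"
        using K W by (intro finite_PiE) auto
      have "\<Phi> = {\<phi> \<in> PiE (Ot \<union> K) W. \<phi> \<in> \<Phi>}"
        using K(5) by (auto simp: \<Phi>_def Un_commute)
      then show "sum f \<Phi> = sum f {\<phi> \<in> PiE (Ot \<union> K) W. \<phi> \<in> \<Phi>}"
        by simp
    qed
    also have "\<dots> = (\<Sum>s\<in>S. \<Sum>\<kappa>\<in>PiE K W. if mg s \<kappa> \<in> \<Phi> then f (mg s \<kappa>) else 0)"
      unfolding S_def mg_def using K(4) by (intro sum_PiE_Un) auto
    also have "\<dots> = (\<Sum>s\<in>S. sum f (T s))"
      unfolding fmg using finPK by (simp add: T_def sum.inter_filter)
    finally show ?thesis .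
  qed
  have Ein: "Ein = {e \<in> Es. e \<subseteq> K}" "card Ein = 3"
  proof -
    show "Ein = {e \<in> Es. e \<subseteq> K}"
    proof
      show "Ein \<subseteq> {e \<in> Es. e \<subseteq> K}"
        using Es by (auto simp: Ein_def K_def)
      show "{e \<in> Es. e \<subseteq> K} \<subseteq> Ein"
      proof
        fix e assume e: "e \<in> {e \<in> Es. e \<subseteq> K}"
        then obtain u v where uv: "u \<noteq> v" "e = {u, v}"
          using Es(5)[of e] by auto
        then have "u \<in> K" "v \<in> K"
          using e by auto
        then show "e \<in> Ein"
          using uv by (auto simp: Ein_def K_def doubleton_eq_iff)
      qed
    qed
    show "card Ein = 3"
      using ne by (simp add: Ein_def card_insert_if doubleton_eq_iff)
  qed
  have cEout: "card Eout = C" "finite Eout"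
  proof -
    have "Es = Ein \<union> Eout" "Ein \<inter> Eout = {}"
      using Ein by (auto simp: Eout_def)
    moreover show "finite Eout"
      using Es(1) by (simp add: Eout_def)
    moreover have "finite Ein"
      by (simp add: Ein_def)
    ultimately show "card Eout = C"
      using C Ein(2) card_Un_disjoint[of Ein Eout] by simp
  qed
  have Tri: "real (card Tri) \<le> 2 * d ^ 3 * N3" "finite Tri"
  proof -
    have "\<bar>(\<Sum>\<phi>\<in>PiE K W. of_bool (True \<and> (\<forall>e\<in>Ein. \<phi> ` e \<in> E))) -
        d ^ card Ein * (\<Sum>\<phi>\<in>PiE K W. of_bool True)\<bar> \<le> real (card Ein) * \<delta> * real n ^ card K"
    proof (rule hom_count)
      fix e assume "e \<in> Ein"
      then have "e \<in> Es" "e \<subseteq> K"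
        using Ein by auto
      then show "\<exists>u\<in>K. \<exists>v\<in>K. u \<noteq> v \<and> e = {u, v} \<and>
          cut_close E d (\<delta> * real n ^ 2) (W u) (W v) \<and> splits_at u v (\<lambda>_. True)"
        using Es(5)[of e] splits_at_True by fastforce
    qed (use K WK d Ein in \<open>auto simp: Ein_def\<close>)
    moreover have "(\<Sum>\<phi>\<in>PiE K W. of_bool (True \<and> (\<forall>e\<in>Ein. \<phi> ` e \<in> E))) = real (card Tri)"
      using finPK by (simp add: sum_of_bool_eq Int_def Tri_def)
    moreover have "(\<Sum>\<phi>\<in>PiE K W. of_bool True) = N3"
      using K WK by (simp add: card_PiE N3_def)
    ultimately have "\<bar>real (card Tri) - d ^ 3 * N3\<bar> \<le> 3 * \<delta> * N3"
      using Ein K by (simp add: N3_def)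
    moreover have "3 * \<delta> * N3 \<le> d ^ 3 * N3"
      using small(1) cpos by (intro mult_right_mono) auto
    ultimately show "real (card Tri) \<le> 2 * d ^ 3 * N3"
      by linarith
    show "finite Tri"
      using finPK by (simp add: Tri_def)
  qed
  define Y where "Y = {\<kappa> \<in> PiE K W. real (N \<kappa>) > 2 * d ^ C * c}"
  have finY: "finite Y"
    using finPK by (simp add: Y_def)
  have cardY: "real (card Y) \<le> d ^ (3 + 2 * C) * N3"
  proof -
    have "d ^ card Eout * c * real (card {\<kappa> \<in> PiE K W.
        real (card {s \<in> S. \<forall>e\<in>Eout. (\<lambda>u. if u \<in> Ot then s u else \<kappa> u) ` e \<in> E}) > 2 * d ^ card Eout * c})
      \<le> real (card Eout) * \<delta> * real n ^ (card K + card Ot)"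
    proof (rule few_atypical)
      show "S \<subseteq> PiE Ot W" "real (card S) \<le> c"
        by (simp_all add: S_def[symmetric] cS)
      fix e assume e: "e \<in> Eout"
      then have "e \<in> Es"
        by (simp add: Eout_def)
      then obtain u v where uv: "u \<in> U" "v \<in> U" "u \<noteq> v" "e = {u, v}" "cut_close E d (\<delta> * real n ^ 2) (W u) (W v)"
        using Es(5)[of e] by auto
      have "u \<in> Ot \<or> v \<in> Ot"
        using e uv by (auto simp: Eout_def Ot_def)
      then show "\<exists>u\<in>K \<union> Ot. \<exists>v\<in>Ot. u \<noteq> v \<and> e = {u, v} \<and> (u \<in> K \<or> S = PiE Ot W) \<and>
          cut_close E d (\<delta> * real n ^ 2) (W u) (W v)"
        using uv K(5) cut_close_sym[OF uv(5)] unfolding S_def by (metis insert_commute)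
    qed (use K W d cEout in auto)
    then have "d ^ C * c * real (card Y) \<le> real C * \<delta> * (N3 * c)"
      using K by (simp add: Y_def N_def mg_def cEout N3_def c_def power_add)
    also have "\<dots> \<le> d ^ (3 + 3 * C) * (N3 * c)"
      using small(2) cpos by (intro mult_right_mono) auto
    also have "\<dots> = (d ^ C * c) * (d ^ (3 + 2 * C) * N3)"
      by (simp add: power_add power_mult power2_eq_square power3_eq_cube power_mult_distrib)
    finally show ?thesis
      using d cpos by (simp add: mult_le_cancel_left_pos)
  qed
  have T_sub: "\<kappa> \<in> Tri" "\<forall>e\<in>Eout. mg s \<kappa> ` e \<in> E" if "\<kappa> \<in> T s" for s \<kappa>
  proof -
    have mgE: "mg s \<kappa> ` e \<in> E" if "e \<in> Es" for e
      using \<open>\<kappa> \<in> T s\<close> that hom[of "mg s \<kappa>" e] by (auto simp: T_def \<Phi>_def)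
    then show "\<forall>e\<in>Eout. mg s \<kappa> ` e \<in> E"
      by (auto simp: Eout_def)
    have "\<kappa> ` e \<in> E" if "e \<in> Ein" for e
    proof -
      have "mg s \<kappa> ` e = \<kappa> ` e"
        using that mgO by (auto simp: Ein_def)
      then show ?thesis
        using mgE[of e] that Ein(1) by auto
    qed
    then show "\<kappa> \<in> Tri"
      using \<open>\<kappa> \<in> T s\<close> by (auto simp: Tri_def T_def)
  qed
  have finT: "finite (T s)" for s
    using finPK by (simp add: T_def)
  let ?O = "\<Sum>s\<in>S. \<Sum>t\<in>S. real (card (T s \<inter> T t))"
  have overlap: "?O \<le> 9 * d ^ (3 + 2 * C) * N3 * c ^ 2"
  proof -
    have "?O = (\<Sum>s\<in>S. \<Sum>t\<in>S. \<Sum>\<kappa>\<in>Tri. of_bool (\<kappa> \<in> T s) * of_bool (\<kappa> \<in> T t))"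
    proof (intro sum.cong refl)
      fix s t
      have "T s \<inter> T t = {\<kappa> \<in> Tri. \<kappa> \<in> T s \<and> \<kappa> \<in> T t}"
        using T_sub(1) by auto
      then show "real (card (T s \<inter> T t)) = (\<Sum>\<kappa>\<in>Tri. of_bool (\<kappa> \<in> T s) * of_bool (\<kappa> \<in> T t))"
        using Tri(2) by (simp add: sum_of_bool_eq Int_def flip: of_bool_conj)
    qed
    also have "\<dots> = (\<Sum>s\<in>S. \<Sum>\<kappa>\<in>Tri. \<Sum>t\<in>S. of_bool (\<kappa> \<in> T s) * of_bool (\<kappa> \<in> T t))"
      by (rule sum.cong[OF refl]) (rule sum.swap)
    also have "\<dots> = (\<Sum>\<kappa>\<in>Tri. \<Sum>s\<in>S. \<Sum>t\<in>S. of_bool (\<kappa> \<in> T s) * of_bool (\<kappa> \<in> T t))"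
      by (rule sum.swap)
    also have "\<dots> = (\<Sum>\<kappa>\<in>Tri. (\<Sum>s\<in>S. of_bool (\<kappa> \<in> T s)) ^ 2)"
      by (simp add: power2_eq_square sum_product)
    also have "\<dots> \<le> (\<Sum>\<kappa>\<in>Tri. (2 * d ^ C * c) ^ 2 + of_bool (\<kappa> \<in> Y) * c ^ 2)"
    proof (rule sum_mono)
      fix \<kappa> assume \<kappa>: "\<kappa> \<in> Tri"
      have "(\<Sum>s\<in>S. of_bool (\<kappa> \<in> T s)) = real (card {s \<in> S. \<kappa> \<in> T s})"
        using finS by (simp add: sum_of_bool_eq Int_def)
      moreover have "card {s \<in> S. \<kappa> \<in> T s} \<le> N \<kappa>" "N \<kappa> \<le> card S"
        unfolding N_def using finS T_sub(2) by (auto intro!: card_mono)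
      ultimately have le: "(\<Sum>s\<in>S. of_bool (\<kappa> \<in> T s)) \<le> real (N \<kappa>)" "real (N \<kappa>) \<le> c"
        using cS by simp_all
      have ge: "0 \<le> (\<Sum>s\<in>S. of_bool (\<kappa> \<in> T s) :: real)"
        by (simp add: sum_nonneg)
      show "(\<Sum>s\<in>S. of_bool (\<kappa> \<in> T s)) ^ 2 \<le> (2 * d ^ C * c) ^ 2 + of_bool (\<kappa> \<in> Y) * c ^ 2"
      proof (cases "\<kappa> \<in> Y")
        case True
        have "(\<Sum>s\<in>S. of_bool (\<kappa> \<in> T s)) ^ 2 \<le> c ^ 2"
          using le ge by (intro power_mono) auto
        then show ?thesis
          using True by (simp add: add_increasing)
      next
        case False
        then have "real (N \<kappa>) \<le> 2 * d ^ C * c"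
          using \<kappa> by (auto simp: Y_def Tri_def)
        then have "(\<Sum>s\<in>S. of_bool (\<kappa> \<in> T s)) ^ 2 \<le> (2 * d ^ C * c) ^ 2"
          using le ge by (intro power_mono) auto
        then show ?thesis
          using False by simp
      qed
    qed
    also have "\<dots> = real (card Tri) * (2 * d ^ C * c) ^ 2 + real (card (Tri \<inter> Y)) * c ^ 2"
      using Tri(2) by (simp add: sum.distrib sum_of_bool_eq Int_def flip: sum_distrib_right)
    also have "\<dots> \<le> (2 * d ^ 3 * N3) * (2 * d ^ C * c) ^ 2 + (d ^ (3 + 2 * C) * N3) * c ^ 2"
    proof (intro add_mono mult_right_mono)
      have "card (Tri \<inter> Y) \<le> card Y"
        using finY by (intro card_mono) auto
      then show "real (card (Tri \<inter> Y)) \<le> d ^ (3 + 2 * C) * N3"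
        using cardY by linarith
    qed (use Tri in auto)
    also have "\<dots> = 9 * d ^ (3 + 2 * C) * N3 * c ^ 2"
      by (simp add: power_add power_mult power_mult_distrib mult.commute[of 2 C])
    finally show ?thesis .
  qed
  \<comment> \<open>The factor \<open>1 / 18\<close> makes the loss through overlaps at most half of the main term \<open>\<epsilon>\<close>.\<close>
  define R where "R = nat \<lceil>\<epsilon> / 18 / d ^ C\<rceil>"
  have dC: "0 < d ^ C" "d ^ C \<le> 1"
    using d by (auto simp: power_le_one)
  have q: "0 < \<epsilon> / 18 / d ^ C"
    using d dC by simp
  have R: "\<epsilon> / 18 / d ^ C \<le> real R" "real R - 1 \<le> \<epsilon> / 18 / d ^ C"
    using q unfolding R_def by linarith+
  have Rr: "R \<le> r"
  proof -
    have "real R * d ^ C \<le> \<epsilon> / 18 + d ^ C"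
      using iffD1[OF pos_le_divide_eq[OF dC(1)] R(2)] by (simp add: algebra_simps)
    also have "\<dots> \<le> real r * d ^ C"
      using small(3) d dC by linarith
    finally show ?thesis
      using dC by simp
  qed
  have Sne: "S \<noteq> {}"
    using cS cpos by auto
  have fM: "f t \<le> 2" for t
    using d(4) by (simp add: f_def)
  obtain s where s: "\<And>i. i < R \<Longrightarrow> s i \<in> S" and large:
    "real (card S) ^ 2 * sum f (\<Union>i<R. T (s i)) \<ge>
      real R * real (card S) * (\<Sum>u\<in>S. sum f (T u)) - 2 * (real R * (real R - 1) / 2) * ?O"
    using exists_tuple_large_union_sum[OF finS Sne, of T f 2 R] finT fM by auto
  define UT where "UT = (\<Union>i<R. T (s i))"
  have "c ^ 2 * sum f UT \<ge> c ^ 2 * (\<epsilon> ^ 2 / 36 * d ^ 3 * N3)"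
  proof -
    have Rpos: "0 < real R" "0 \<le> real R * (real R - 1)"
      using R(1) q by (auto simp: mult_nonneg_nonneg)
    have "real R * c * (\<epsilon> * (N3 * c) * (d ^ C * d ^ 3)) \<le> real R * c * (\<Sum>u\<in>S. sum f (T u))"
      using big Rpos cpos unfolding sumT C cardU
      by (intro mult_left_mono) (auto simp: power_add N3_def c_def)
    moreover have "real R * (real R - 1) * ?O \<le> real R * (real R - 1) * (9 * d ^ (3 + 2 * C) * N3 * c ^ 2)"
      using overlap Rpos by (intro mult_left_mono) auto
    ultimately have "c ^ 2 * sum f UT \<ge> real R * c * (\<epsilon> * (N3 * c) * (d ^ C * d ^ 3)) -
        real R * (real R - 1) * (9 * d ^ (3 + 2 * C) * N3 * c ^ 2)"
      using large unfolding UT_def cS by simp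
    also have "real R * c * (\<epsilon> * (N3 * c) * (d ^ C * d ^ 3)) -
        real R * (real R - 1) * (9 * d ^ (3 + 2 * C) * N3 * c ^ 2) =
        (c ^ 2 * N3 * d ^ 3) * ((real R * d ^ C) * (\<epsilon> - 9 * ((real R - 1) * d ^ C)))"
      by (simp add: power_add power_mult power2_eq_square algebra_simps)
    finally have *: "(c ^ 2 * N3 * d ^ 3) * ((real R * d ^ C) * (\<epsilon> - 9 * ((real R - 1) * d ^ C)))
        \<le> c ^ 2 * sum f UT" .
    have "\<epsilon> / 18 \<le> real R * d ^ C" "(real R - 1) * d ^ C \<le> \<epsilon> / 18"
      using iffD1[OF pos_divide_le_eq[OF dC(1)] R(1)] iffD1[OF pos_le_divide_eq[OF dC(1)] R(2)] .
    then have "\<epsilon> / 18 * (\<epsilon> / 2) \<le> (real R * d ^ C) * (\<epsilon> - 9 * ((real R - 1) * d ^ C))"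
      using d by (intro mult_mono) auto
    then have "(c ^ 2 * N3 * d ^ 3) * (\<epsilon> / 18 * (\<epsilon> / 2))
        \<le> (c ^ 2 * N3 * d ^ 3) * ((real R * d ^ C) * (\<epsilon> - 9 * ((real R - 1) * d ^ C)))"
      using cpos d by (intro mult_left_mono) auto
    then have "(c ^ 2 * N3 * d ^ 3) * (\<epsilon> / 18 * (\<epsilon> / 2)) \<le> c ^ 2 * sum f UT"
      using * by (rule order_trans)
    then show ?thesis
      by (simp add: power2_eq_square mult_ac)
  qed
  then have fUn: "\<epsilon> ^ 2 / 36 * d ^ 3 * N3 \<le> sum f UT"
    using cpos by (simp add: mult_le_cancel_left_pos)
  define j where "j \<kappa> = (\<kappa> x, \<kappa> y, \<kappa> z)" for \<kappa> :: "'u \<Rightarrow> 'b"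
  define k :: "'b \<Rightarrow> 'b \<Rightarrow> 'b \<Rightarrow> 'u \<Rightarrow> 'b"
    where "k a b c = (\<lambda>_. undefined)(x := a, y := b, z := c)" for a b c
  have kj: "k (\<kappa> x) (\<kappa> y) (\<kappa> z) = \<kappa>" if "\<kappa> \<in> PiE K W" for \<kappa>
    using that by (auto simp: k_def K_def fun_eq_iff PiE_def extensional_def)
  have k_PiE: "k a b c \<in> PiE K W" if "a \<in> W x" "b \<in> W y" "c \<in> W z" for a b c
    using that ne by (auto simp: k_def K_def PiE_def extensional_def)
  have k_val: "k a b c x = a" "k a b c y = b" "k a b c z = c" for a b c
    using ne by (simp_all add: k_def)
  have injj: "inj_on j (PiE K W)"
    using kj unfolding j_def inj_on_def by (metis prod.inject)
  have jTri: "j ` Tri = triads_of E (W x) (W y) (W z)"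
  proof
    show "j ` Tri \<subseteq> triads_of E (W x) (W y) (W z)"
      by (auto simp: j_def Tri_def Ein_def triads_of_def K_def PiE_iff)
    show "triads_of E (W x) (W y) (W z) \<subseteq> j ` Tri"
    proof
      fix t assume "t \<in> triads_of E (W x) (W y) (W z)"
      then obtain a b c where t: "t = (a, b, c)" "a \<in> W x" "b \<in> W y" "c \<in> W z"
        "{a, b} \<in> E" "{b, c} \<in> E" "{a, c} \<in> E"
        by (auto simp: triads_of_def)
      then have "k a b c \<in> Tri"
        using k_PiE by (auto simp: Tri_def Ein_def k_val)
      then show "t \<in> j ` Tri"
        using t k_val by (intro image_eqI[of _ _ "k a b c"]) (auto simp: j_def)
    qed
  qed
  have upd: "mg t (k a b c) = t(x := a, y := b, z := c)" if "t \<in> S" for t a b c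
    using that by (auto simp: mg_def k_def fun_eq_iff Ot_def K_def S_def PiE_def extensional_def)
  \<comment> \<open>The tuple of length \<open>R\<close> is padded to length \<open>r\<close> with empty subtriads.\<close>
  define QBC where "QBC i b c \<longleftrightarrow> i < R \<and> p1 ((s i)(y := b, z := c))" for i b c
  define QAC where "QAC i a c \<longleftrightarrow> p2 ((s i)(x := a, z := c))" for i a c
  define QAB where "QAB i a b \<longleftrightarrow> p3 ((s i)(x := a, y := b))" for i a b
  have Tk: "k a b c \<in> T t \<longleftrightarrow> p3 (t(x := a, y := b)) \<and> p1 (t(y := b, z := c)) \<and> p2 (t(x := a, z := c))"
    if "t \<in> S" "a \<in> W x" "b \<in> W y" "c \<in> W z" for t a b c
  proof -
    have "p1 (t(x := a, y := b, z := c)) = p1 (t(y := b, z := c))"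
      using p(1)[of "t(y := b, z := c)" a] ne by (simp add: fun_upd_twist)
    moreover have "p2 (t(x := a, y := b, z := c)) = p2 (t(x := a, z := c))"
      using p(2)[of "t(x := a, z := c)" b] ne by (simp add: fun_upd_twist)
    moreover have "p3 (t(x := a, y := b, z := c)) = p3 (t(x := a, y := b))"
      using p(3)[of "t(x := a, y := b)" c] by simp
    ultimately show ?thesis
      using mgU[OF that(1) k_PiE[OF that(2-4)]] k_PiE[OF that(2-4)] upd[OF that(1), of a b c]
      by (auto simp: T_def \<Phi>_def)
  qed
  let ?T = "\<Union>i<r. {(a, b, c) \<in> triads_of E (W x) (W y) (W z). QAB i a b \<and> QBC i b c \<and> QAC i a c}"
  have jUn: "j ` UT = ?T"
  proof
    show "j ` UT \<subseteq> ?T"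
    proof
      fix t assume "t \<in> j ` UT"
      then obtain i \<kappa> where i: "i < R" "\<kappa> \<in> T (s i)" "t = j \<kappa>"
        by (auto simp: UT_def)
      have \<kappa>: "\<kappa> \<in> PiE K W" "\<kappa> \<in> Tri"
        using i(2) T_sub(1) by (auto simp: T_def)
      have "t \<in> triads_of E (W x) (W y) (W z)"
        using jTri \<kappa> i by blast
      moreover have "\<kappa> x \<in> W x" "\<kappa> y \<in> W y" "\<kappa> z \<in> W z"
        using \<kappa> by (auto simp: K_def PiE_iff)
      ultimately show "t \<in> ?T"
        using i(1,2,3) Tk[OF s[OF i(1)], of "\<kappa> x" "\<kappa> y" "\<kappa> z"] kj[OF \<kappa>(1)] Rr
        by (auto simp: j_def QAB_def QAC_def QBC_def intro!: bexI[of _ i])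
    qed
    show "?T \<subseteq> j ` UT"
    proof
      fix t assume "t \<in> ?T"
      then obtain i a b c where t: "t = (a, b, c)" "t \<in> triads_of E (W x) (W y) (W z)"
        "QAB i a b" "QBC i b c" "QAC i a c"
        by auto
      then have i: "i < R"
        by (simp add: QBC_def)
      have "a \<in> W x" "b \<in> W y" "c \<in> W z"
        using t(1,2) by (auto simp: triads_of_def)
      then have "k a b c \<in> T (s i)"
        using t Tk[OF s[OF i]] by (auto simp: QAB_def QAC_def QBC_def)
      then show "t \<in> j ` UT"
        using i t(1) k_val by (intro image_eqI[of _ _ "k a b c"]) (auto simp: j_def UT_def)
    qed
  qed
  have UnTri: "UT \<subseteq> Tri" "UT \<subseteq> PiE K W" "Tri \<subseteq> PiE K W"
    using T_sub(1) by (auto simp: UT_def Tri_def)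
  have cards: "card ?T = card UT" "card (triads_of E (W x) (W y) (W z)) = card Tri"
  proof -
    show "card ?T = card UT"
      unfolding jUn[symmetric] by (rule card_image[OF inj_on_subset[OF injj UnTri(2)]])
    show "card (triads_of E (W x) (W y) (W z)) = card Tri"
      unfolding jTri[symmetric] by (rule card_image[OF inj_on_subset[OF injj UnTri(3)]])
  qed
  have sums: "(\<Sum>(a, b, c)\<in>?T. d3 - of_bool ({a, b, c} \<in> F)) = sum f UT"
    unfolding jUn[symmetric]
    by (subst sum.reindex[OF inj_on_subset[OF injj UnTri(2)]]) (simp add: j_def f_def o_def)
  have "sum f UT \<le> 2 * real (card UT)"
    using sum_bounded_above[of UT f 2] d(4) by (simp add: f_def mult.commute)
  then have "\<epsilon> ^ 2 / 72 * d ^ 3 * N3 \<le> real (card UT)"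
    using fUn by linarith
  moreover have "\<delta>3 * real (card Tri) \<le> \<epsilon> ^ 2 / 72 * d ^ 3 * N3"
  proof -
    have "\<delta>3 * real (card Tri) \<le> \<epsilon> ^ 2 / 144 * real (card Tri)"
      using small(4) by (intro mult_right_mono) auto
    also have "\<dots> \<le> \<epsilon> ^ 2 / 144 * (2 * d ^ 3 * N3)"
      using Tri by (intro mult_left_mono) auto
    finally show ?thesis by (simp add: mult_ac)
  qed
  ultimately have "\<delta>3 * real (card (triads_of E (W x) (W y) (W z))) \<le> real (card ?T)"
    unfolding cards by linarith
  then have "(\<Sum>(a, b, c)\<in>?T. d3 - of_bool ({a, b, c} \<in> F)) \<le> \<delta>3 * real (card ?T)"
    using reg unfolding lower_regular_def Let_def by blast
  then have "sum f UT \<le> \<delta>3 * real (card UT)"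
    unfolding sums cards .
  also have "\<dots> \<le> \<epsilon> ^ 2 / 144 * real (card UT)"
    using small(4) by (intro mult_right_mono) auto
  also have "\<dots> \<le> \<epsilon> ^ 2 / 144 * (2 * d ^ 3 * N3)"
    using Tri UnTri(1) card_mono[OF Tri(2) UnTri(1)] by (intro mult_left_mono) auto
  also have "\<dots> < \<epsilon> ^ 2 / 36 * d ^ 3 * N3"
    using d cpos by simp
  finally show False
    using fUn by linarith
qed

section \<open>Regular triads and ordered triples\<close>

text \<open>
  The union of three bipartite graphs given by relations: a common form for a triad and all its
  subtriads.
\<close>
definition tripartite_pairs ::
    "('b \<Rightarrow> 'b \<Rightarrow> bool) \<Rightarrow> ('b \<Rightarrow> 'b \<Rightarrow> bool) \<Rightarrow> ('b \<Rightarrow> 'b \<Rightarrow> bool) \<Rightarrow>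
     'b set \<Rightarrow> 'b set \<Rightarrow> 'b set \<Rightarrow> 'b set set" where
  "tripartite_pairs QAB QBC QAC A B C =
     {{a, b} | a b. a \<in> A \<and> b \<in> B \<and> QAB a b} \<union> {{b, c} | b c. b \<in> B \<and> c \<in> C \<and> QBC b c} \<union>
     {{a, c} | a c. a \<in> A \<and> c \<in> C \<and> QAC a c}"

text \<open>
  The three pairs inside a triangle join three different classes, so a triangle has exactly one
  vertex in each class.
\<close>
lemma triangles_tripartite:
  assumes dis: "A \<inter> B = {}" "B \<inter> C = {}" "A \<inter> C = {}"
  shows "triangles (tripartite_pairs QAB QBC QAC A B C) =
    (\<lambda>(a, b, c). {a, b, c}) `
      {(a, b, c). a \<in> A \<and> b \<in> B \<and> c \<in> C \<and> QAB a b \<and> QBC b c \<and> QAC a c}" (is "?L = ?R")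
proof
  let ?Q = "tripartite_pairs QAB QBC QAC A B C"
  show "?R \<subseteq> ?L"
  proof
    fix t assume "t \<in> ?R"
    then obtain a b c where t: "t = {a, b, c}" "a \<in> A" "b \<in> B" "c \<in> C" "QAB a b" "QBC b c" "QAC a c"
      by auto
    have ne: "a \<noteq> b" "b \<noteq> c" "a \<noteq> c"
      using t dis by auto
    have "nsets t 2 = {{a, b}, {b, c}, {a, c}}"
      using ne by (auto simp: t(1) nsets_def card_2_iff doubleton_eq_iff)
    moreover have "{a, b} \<in> ?Q" "{b, c} \<in> ?Q" "{a, c} \<in> ?Q"
      using t unfolding tripartite_pairs_def by blast+
    ultimately show "t \<in> ?L"
      using ne by (simp add: triangles_def nsets_def t(1))
  qed
  show "?L \<subseteq> ?R"
  proof
    fix t assume "t \<in> ?L"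
    then have "card t = 3" and sub: "nsets t 2 \<subseteq> ?Q"
      by (auto simp: triangles_def nsets_def)
    then obtain u v w where t: "t = {u, v, w}" and ne: "u \<noteq> v" "v \<noteq> w" "u \<noteq> w"
      by (auto simp: card_3_iff)
    have Q: "{u, v} \<in> ?Q" "{v, w} \<in> ?Q" "{u, w} \<in> ?Q"
      using sub ne by (auto simp: t nsets_def)
    have pair: "u \<in> A \<and> v \<in> B \<and> QAB u v \<or> v \<in> A \<and> u \<in> B \<and> QAB v u \<or>
        u \<in> B \<and> v \<in> C \<and> QBC u v \<or> v \<in> B \<and> u \<in> C \<and> QBC v u \<or>
        u \<in> A \<and> v \<in> C \<and> QAC u v \<or> v \<in> A \<and> u \<in> C \<and> QAC v u" if "{u, v} \<in> ?Q" for u v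
      using that by (auto simp: tripartite_pairs_def doubleton_eq_iff)
    have from_A: "{u, v, w} \<in> ?R"
      if h: "u \<in> A" "{u, v} \<in> ?Q" "{v, w} \<in> ?Q" "{u, w} \<in> ?Q" for u v w
    proof -
      consider "v \<in> B" "w \<in> C" | "v \<in> C" "w \<in> B"
        using h(1) dis pair[OF h(2)] pair[OF h(3)] pair[OF h(4)] by blast
      then show ?thesis
      proof cases
        case 1
        then have "QAB u v" "QBC v w" "QAC u w"
          using h(1) dis pair[OF h(2)] pair[OF h(3)] pair[OF h(4)] by blast+
        then show ?thesis
          using 1 h(1) by (intro image_eqI[of _ _ "(u, v, w)"]) auto
      next
        case 2
        then have "QAB u w" "QBC w v" "QAC u v"
          using h(1) dis pair[OF h(2)] pair[OF h(3)] pair[OF h(4)] by blast+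
        then show ?thesis
          using 2 h(1) by (intro image_eqI[of _ _ "(u, w, v)"]) auto
      qed
    qed
    have "u \<in> A \<or> v \<in> A \<or> w \<in> A"
      using dis pair[OF Q(1)] pair[OF Q(2)] pair[OF Q(3)] by blast
    then consider "u \<in> A" | "v \<in> A" | "w \<in> A"
      by blast
    then show "t \<in> ?R"
    proof cases
      case 1
      then show ?thesis using from_A[OF 1] Q by (simp add: t)
    next
      case 2
      then show ?thesis using from_A[OF 2, of u w] Q by (simp add: t insert_commute)
    next
      case 3
      then show ?thesis using from_A[OF 3, of u v] Q by (simp add: t insert_commute)
    qed
  qed
qed

lemma triad_eq_tripartite_pairs:
  "triad E A B C = tripartite_pairs (\<lambda>a b. {a, b} \<in> E) (\<lambda>b c. {b, c} \<in> E) (\<lambda>a c. {a, c} \<in> E) A B C"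
  unfolding triad_def tripartite_pairs_def edges_between_def by blast

text \<open>
  As the classes are disjoint, an unordered triangle of the triad determines its ordered triple.
\<close>
lemma triad_regular_imp_lower_regular:
  assumes reg: "triad_regular d \<delta> r (triad E A B C) F"
    and dis: "A \<inter> B = {}" "B \<inter> C = {}" "A \<inter> C = {}" and fin: "finite A" "finite B" "finite C"
  shows "lower_regular d \<delta> r E F A B C"
  unfolding lower_regular_def Let_def
proof (intro allI impI)
  fix QAB QBC QAC :: "nat \<Rightarrow> 'a \<Rightarrow> 'a \<Rightarrow> bool"
  let ?\<tau> = "\<lambda>(a, b, c). {a, b, c}"
  let ?all = "triads_of E A B C"
  let ?Ti = "\<lambda>i. {(a, b, c) \<in> ?all. QAB i a b \<and> QBC i b c \<and> QAC i a c}"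
  let ?T = "\<Union>i<r. ?Ti i"
  assume large: "\<delta> * real (card ?all) \<le> real (card ?T)"
  \<comment> \<open>Tuples of subtriads are indexed from \<open>1\<close>, families of relations from \<open>0\<close>.\<close>
  define Q where "Q s = tripartite_pairs (\<lambda>a b. {a, b} \<in> E \<and> QAB (s - 1) a b)
      (\<lambda>b c. {b, c} \<in> E \<and> QBC (s - 1) b c) (\<lambda>a c. {a, c} \<in> E \<and> QAC (s - 1) a c) A B C" for s
  have sub: "\<forall>s\<in>{1..r}. Q s \<subseteq> triad E A B C"
    unfolding Q_def triad_eq_tripartite_pairs tripartite_pairs_def by blast
  have inj: "inj_on ?\<tau> ?all"
  proof (rule inj_onI)
    fix p q
    assume pq: "p \<in> ?all" "q \<in> ?all" and "?\<tau> p = ?\<tau> q"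
    moreover obtain a b c a' b' c' where p: "p = (a, b, c)" and q: "q = (a', b', c')"
      by (metis prod_cases3)
    ultimately have eq: "{a, b, c} = {a', b', c'}"
      by simp
    have "a \<in> A" "b \<in> B" "c \<in> C" "a' \<in> A" "b' \<in> B" "c' \<in> C"
      using pq unfolding p q by (auto simp: triads_of_def)
    moreover from this have "{a} = {a, b, c} \<inter> A" "{b} = {a, b, c} \<inter> B" "{c} = {a, b, c} \<inter> C"
      "{a'} = {a', b', c'} \<inter> A" "{b'} = {a', b', c'} \<inter> B" "{c'} = {a', b', c'} \<inter> C"
      using dis by blast+
    ultimately have "a = a' \<and> b = b' \<and> c = c'"
      using eq by (metis singleton_inject)
    then show "p = q"
      by (simp add: p q)
  qed
  have all: "triangles (triad E A B C) = ?\<tau> ` ?all"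
    unfolding triad_eq_tripartite_pairs triangles_tripartite[OF dis] triads_of_def
    by (rule arg_cong[where f = "image ?\<tau>"]) auto
  have Ti: "triangles (Q s) = ?\<tau> ` ?Ti (s - 1)" for s
    unfolding Q_def triangles_tripartite[OF dis] triads_of_def
    by (rule arg_cong[where f = "image ?\<tau>"]) auto
  have T: "(\<Union>s\<in>{1..r}. triangles (Q s)) = ?\<tau> ` ?T"
  proof -
    have "(\<Union>s\<in>{1..r}. triangles (Q s)) = (\<Union>i<r. triangles (Q (Suc i)))"
      unfolding image_Suc_lessThan[symmetric] by blast
    also have "\<dots> = ?\<tau> ` ?T"
      unfolding Ti by (simp add: image_UN)
    finally show ?thesis .
  qed
  have finall: "finite ?all"
    by (rule finite_subset[of _ "A \<times> B \<times> C"]) (use fin in \<open>auto simp: triads_of_def\<close>)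
  have Tsub: "?T \<subseteq> ?all"
    by blast
  have injT: "inj_on ?\<tau> ?T"
    by (rule inj_on_subset[OF inj Tsub])
  have finT: "finite ?T"
    by (rule finite_subset[OF Tsub finall])
  have card_all: "card (triangles (triad E A B C)) = card ?all"
    unfolding all by (rule card_image[OF inj])
  have card_T: "card (\<Union>s\<in>{1..r}. triangles (Q s)) = card ?T"
    unfolding T by (rule card_image[OF injT])
  have F: "card (F \<inter> ?\<tau> ` ?T) = card {t \<in> ?T. ?\<tau> t \<in> F}"
  proof -
    have "F \<inter> ?\<tau> ` ?T = ?\<tau> ` {t \<in> ?T. ?\<tau> t \<in> F}"
      by blast
    then show ?thesis
      by (simp only:) (rule card_image[OF inj_on_subset[OF injT]], blast)
  qed
  have sum: "(\<Sum>(a, b, c)\<in>?T. d - of_bool ({a, b, c} \<in> F)) =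
    d * real (card ?T) - real (card (F \<inter> ?\<tau> ` ?T))"
  proof -
    have "(\<Sum>(a, b, c)\<in>?T. d - of_bool ({a, b, c} \<in> F)) = (\<Sum>t\<in>?T. d - of_bool (?\<tau> t \<in> F))"
      by (intro sum.cong) auto
    also have "\<dots> = d * real (card ?T) - real (card {t \<in> ?T. ?\<tau> t \<in> F})"
    proof -
      have "(\<Sum>t\<in>?T. of_bool (?\<tau> t \<in> F)) = real (card (?T \<inter> {t. ?\<tau> t \<in> F}))"
        by (rule sum_of_bool_eq) (rule finT)+
      then show ?thesis
        by (simp only: sum_subtractf sum_constant Int_def mem_Collect_eq mult.commute)
    qed
    finally show ?thesis
      by (simp only: F)
  qed
  have "\<bar>d - triangle_density F (?\<tau> ` ?T)\<bar> < \<delta>"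
    using reg sub large unfolding triad_regular_def card_all[symmetric] card_T[symmetric] T[symmetric]
    by blast
  then have less: "d - triangle_density F (?\<tau> ` ?T) \<le> \<delta>"
    by linarith
  show "(\<Sum>(a, b, c)\<in>?T. d - of_bool ({a, b, c} \<in> F)) \<le> \<delta> * real (card ?T)"
  proof (cases "card ?T = 0")
    case True
    then have "?T = {}"
      using finT by (simp only: card_0_eq)
    then show ?thesis
      by (simp only: sum.empty card.empty)
  next
    case False
    then have pos: "0 < real (card ?T)"
      by simp
    have "triangle_density F (?\<tau> ` ?T) = real (card (F \<inter> ?\<tau> ` ?T)) / real (card ?T)"
      using False unfolding triangle_density_def card_image[OF injT] by simp
    then have "(d - \<delta>) * real (card ?T) \<le> real (card (F \<inter> ?\<tau> ` ?T))"
      using less pos by (simp only: pos_le_divide_eq[symmetric])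
    then show ?thesis
      unfolding sum by (simp only: left_diff_distrib)
  qed
qed

lemma triad_rotate: "triad E B C A = triad E A B C"
  unfolding triad_def edges_between_def by (auto simp: insert_commute)

lemma triad_swap: "triad E B A C = triad E A B C"
  unfolding triad_def edges_between_def by (auto simp: insert_commute)

lemma triad_perm:
  "triad E A C B = triad E A B C" "triad E B A C = triad E A B C" "triad E B C A = triad E A B C"
  "triad E C A B = triad E A B C" "triad E C B A = triad E A B C"
  using triad_rotate triad_swap by metis+

lemma triangle_density_le_1: "triangle_density F T \<le> 1"
proof (cases "card T > 0")
  case True
  then have "card (F \<inter> T) \<le> card T"
    by (intro card_mono) (auto simp: card_gt_0_iff)
  then show ?thesis
    using True by (simp add: triangle_density_def)
qed (simp add: triangle_density_def)

text \<open>
  The tuple all of whose members are the whole triad shows that \<open>d\<close> is within \<open>\<delta>\<close> of an actual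
  density.
\<close>
lemma triad_regular_density_le:
  assumes "triad_regular d \<delta> r P F" "0 < r" "\<delta> \<le> 1"
  shows "d \<le> 2"
proof -
  have "(\<Union>s\<in>{1..r}. triangles P) = triangles P"
    using assms(2) by auto
  moreover have "\<delta> * real (card (triangles P)) \<le> real (card (triangles P))"
    using mult_right_mono[OF assms(3), of "real (card (triangles P))"] by simp
  ultimately have "\<bar>d - triangle_density F (triangles P)\<bar> < \<delta>"
    using assms(1) unfolding triad_regular_def by (elim allE[of _ "\<lambda>_. P"]) auto
  then show ?thesis
    using triangle_density_le_1[of F "triangles P"] assms(3) by linarith
qed

lemma triangle_density_pos:
  assumes "finite T" "t \<in> F" "t \<in> T"
  shows "triangle_density F T \<noteq> 0"
proof -
  have "0 < card T" "0 < card (F \<inter> T)"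
    using assms by (auto simp: card_gt_0_iff)
  then show ?thesis
    by (simp add: triangle_density_def)
qed

lemma finite_triangles:
  assumes "finite S" "P \<subseteq> nsets S 2"
  shows "finite (triangles P)"
proof (rule finite_subset)
  show "triangles P \<subseteq> Pow S"
  proof clarify
    fix t x assume t: "t \<in> triangles P" and x: "x \<in> t"
    then have "card t = 3" "finite t" "nsets t 2 \<subseteq> P"
      by (auto simp: triangles_def nsets_def card_ge_0_finite)
    moreover obtain y where "y \<in> t" "y \<noteq> x"
      using \<open>card t = 3\<close> x by (auto simp: card_3_iff)
    ultimately have "{x, y} \<in> P"
      using x by (auto simp: nsets_def subset_iff)
    then show "x \<in> S"
      using assms(2) by (auto simp: nsets_def)
  qed
qed (use assms in simp)

section \<open>Extending copies by one vertex\<close>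

text \<open>
  A pattern with vertices \<open>VH\<close>, edges \<open>EH\<close> and hyperedges \<open>TH\<close> is mapped into a host with edges \<open>E\<close>
  and hyperedges \<open>F\<close>, where \<open>x\<close> may be mapped to the elements of \<open>W x\<close>, its vertex class. All
  constants have to satisfy explicit inequalities; the exponents are generous, chosen to dominate
  all the polynomials in the maximum degree \<open>D\<close> that come up.
\<close>
locale extension_setting =
  fixes VH :: "'a set" and EH TH :: "'a set set" and W :: "'a \<Rightarrow> 'b set" and E F :: "'b set set"
    and n r D :: nat and d2 d3 \<delta>2 \<delta>3 \<alpha> c :: real
  assumes finVH: "finite VH" and EH: "EH \<subseteq> nsets VH 2" and TH: "TH \<subseteq> nsets VH 3"
    and closed: "t \<in> TH \<Longrightarrow> nsets t 2 \<subseteq> EH"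
    and degE: "x \<in> VH \<Longrightarrow> card {e \<in> EH. x \<in> e} \<le> D"
    and degT: "x \<in> VH \<Longrightarrow> card {t \<in> TH. x \<in> t} \<le> D"
    and W: "x \<in> VH \<Longrightarrow> finite (W x)" "x \<in> VH \<Longrightarrow> card (W x) = n" and n: "0 < n"
    and cut: "{x, y} \<in> EH \<Longrightarrow> cut_close E d2 (\<delta>2 * real n ^ 2) (W x) (W y)"
    and reg: "{x, y, z} \<in> TH \<Longrightarrow> lower_regular d3 \<delta>3 r E F (W x) (W y) (W z)"
    and class_small: "x \<in> VH \<Longrightarrow> real (card {y \<in> VH. W x \<inter> W y \<noteq> {}}) \<le> c * real n"
    and D: "1 \<le> D" and d2: "0 < d2" "d2 \<le> 1" and d3: "\<alpha> \<le> d3" "d3 \<le> 2"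
    and \<alpha>: "0 < \<alpha>" "\<alpha> \<le> 1 / 4" "\<alpha> * real D \<le> 1"
    and \<delta>2: "0 \<le> \<delta>2" "\<delta>2 \<le> (\<alpha> * d2) ^ (20 * D ^ 3)"
    and r: "2 \<le> real r * d2 ^ (D ^ 2 + D)"
    and \<delta>3: "\<delta>3 \<le> \<alpha> ^ (22 * D ^ 2)"
    and c: "c \<le> \<alpha> ^ (D + 2) * d2 ^ D"
begin

definition emb :: "'a set \<Rightarrow> ('a \<Rightarrow> 'b) set" where
  "emb Z = {\<phi> \<in> PiE Z W. inj_on \<phi> Z \<and> (\<forall>e\<in>EH. e \<subseteq> Z \<longrightarrow> \<phi> ` e \<in> E) \<and>
     (\<forall>t\<in>TH. t \<subseteq> Z \<longrightarrow> \<phi> ` t \<in> F)}"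

definition num :: "'a set \<Rightarrow> real" where "num Z = real (card (emb Z))"

definition nb :: "'a set \<Rightarrow> 'a \<Rightarrow> 'a set" where "nb Z h = {b \<in> Z. {h, b} \<in> EH}"

definition link :: "'a set \<Rightarrow> 'a \<Rightarrow> 'a set set" where
  "link Z h = (\<lambda>t. t - {h}) ` {t \<in> TH. t \<subseteq> Z \<and> h \<in> t}"

text \<open>
  The images that \<open>h\<close> may receive in an extension of \<open>\<beta>\<close>, apart from the values of \<open>\<beta>\<close> that are
  already used. The link consists of the pairs that form a hyperedge with \<open>h\<close>.
\<close>
definition ext :: "'a set \<Rightarrow> 'a \<Rightarrow> ('a \<Rightarrow> 'b) \<Rightarrow> 'b set" where
  "ext Z h \<beta> = {v \<in> W h. (\<forall>b\<in>nb Z h. {v, \<beta> b} \<in> E) \<and> (\<forall>e\<in>link Z h. insert v (\<beta> ` e) \<in> F)}"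

lemma finEH: "finite EH" and finTH: "finite TH"
  using finVH EH TH by (meson finite_subset finite_imp_finite_nsets)+

lemma edgeE:
  assumes "e \<in> EH"
  obtains x y where "e = {x, y}" "x \<noteq> y" "x \<in> VH" "y \<in> VH"
  using assms EH by (auto simp: nsets_def card_2_iff)

lemma card_edges_meeting:
  assumes "M \<subseteq> VH"
  shows "card {e \<in> EH. e \<inter> M \<noteq> {}} \<le> D * card M" "card {t \<in> TH. t \<inter> M \<noteq> {}} \<le> D * card M"
proof -
  have fin: "finite M"
    using assms finVH finite_subset by blast
  have bound: "card {e \<in> X. e \<inter> M \<noteq> {}} \<le> D * card M"
    if "\<And>x. x \<in> VH \<Longrightarrow> card {e \<in> X. x \<in> e} \<le> D" for X :: "'a set set"
  proof -
    have "{e \<in> X. e \<inter> M \<noteq> {}} = (\<Union>x\<in>M. {e \<in> X. x \<in> e})"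
      by blast
    then have "card {e \<in> X. e \<inter> M \<noteq> {}} \<le> (\<Sum>x\<in>M. card {e \<in> X. x \<in> e})"
      by (simp only:) (rule card_UN_le[OF fin])
    also have "\<dots> \<le> (\<Sum>x\<in>M. D)"
      using that assms by (intro sum_mono) blast
    finally show ?thesis
      by (simp add: mult.commute)
  qed
  show "card {e \<in> EH. e \<inter> M \<noteq> {}} \<le> D * card M" "card {t \<in> TH. t \<inter> M \<noteq> {}} \<le> D * card M"
    using bound degE degT by blast+
qed

lemma card_nb:
  assumes "h \<in> Z" "Z \<subseteq> VH"
  shows "card (nb Z h) = card {e \<in> EH. e \<subseteq> Z \<and> h \<in> e}" "card (nb Z h) \<le> D" "h \<notin> nb Z h"
    "nb Z h \<subseteq> Z" "finite (nb Z h)"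
proof -
  show fin: "finite (nb Z h)" and "nb Z h \<subseteq> Z"
    using finite_subset[OF assms(2) finVH] unfolding nb_def by auto
  show "h \<notin> nb Z h"
    using EH by (auto simp: nb_def nsets_def)
  have "inj_on (\<lambda>b. {h, b}) (nb Z h)"
    by (auto simp: inj_on_def doubleton_eq_iff)
  moreover have "(\<lambda>b. {h, b}) ` nb Z h = {e \<in> EH. e \<subseteq> Z \<and> h \<in> e}"
  proof
    show "(\<lambda>b. {h, b}) ` nb Z h \<subseteq> {e \<in> EH. e \<subseteq> Z \<and> h \<in> e}"
      using assms by (auto simp: nb_def)
    show "{e \<in> EH. e \<subseteq> Z \<and> h \<in> e} \<subseteq> (\<lambda>b. {h, b}) ` nb Z h"
    proof
      fix e assume e: "e \<in> {e \<in> EH. e \<subseteq> Z \<and> h \<in> e}"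
      then obtain b where "e = {h, b}"
        using edgeE by (metis (no_types, lifting) insert_commute insertE mem_Collect_eq singletonD)
      then show "e \<in> (\<lambda>b. {h, b}) ` nb Z h"
        using e by (auto simp: nb_def)
    qed
  qed
  ultimately show eq: "card (nb Z h) = card {e \<in> EH. e \<subseteq> Z \<and> h \<in> e}"
    by (metis card_image)
  have "card {e \<in> EH. e \<subseteq> Z \<and> h \<in> e} \<le> card {e \<in> EH. h \<in> e}"
    using finEH by (intro card_mono) auto
  then show "card (nb Z h) \<le> D"
    using eq degE[of h] assms by auto
qed

lemma card_link:
  assumes "h \<in> Z" "Z \<subseteq> VH"
  shows "card (link Z h) = card {t \<in> TH. t \<subseteq> Z \<and> h \<in> t}" "card (link Z h) \<le> D" "finite (link Z h)"
proof -
  have "inj_on (\<lambda>t. t - {h}) {t \<in> TH. t \<subseteq> Z \<and> h \<in> t}"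
    by (auto simp: inj_on_def)
  then show eq: "card (link Z h) = card {t \<in> TH. t \<subseteq> Z \<and> h \<in> t}"
    unfolding link_def by (rule card_image)
  have "card {t \<in> TH. t \<subseteq> Z \<and> h \<in> t} \<le> card {t \<in> TH. h \<in> t}"
    using finTH by (intro card_mono) auto
  then show "card (link Z h) \<le> D"
    using eq degT[of h] assms by auto
  show "finite (link Z h)"
    unfolding link_def using finTH by simp
qed

lemma linkE:
  assumes "e \<in> link Z h"
  obtains y z where "e = {y, z}" "y \<noteq> z" "y \<in> nb Z h" "z \<in> nb Z h" "{h, y, z} \<in> TH" "{y, z} \<in> EH"
    "h \<noteq> y" "h \<noteq> z" "{h, y} \<in> EH" "{h, z} \<in> EH"
proof -
  obtain t where t: "t \<in> TH" "t \<subseteq> Z" "h \<in> t" "e = t - {h}"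
    using assms by (auto simp: link_def)
  then have "card t = 3" "finite t"
    using TH by (auto simp: nsets_def)
  then have "card e = 2"
    using t by (simp add: card_Diff_singleton)
  then obtain y z where yz: "e = {y, z}" "y \<noteq> z"
    by (auto simp: card_2_iff)
  have t_eq: "t = {h, y, z}" and ne: "h \<noteq> y" "h \<noteq> z"
    using t yz by auto
  have "{y, z} \<in> nsets t 2" "{h, y} \<in> nsets t 2" "{h, z} \<in> nsets t 2"
    using ne yz by (auto simp: t_eq nsets_def)
  then show thesis
    using closed[OF t(1)] t yz t_eq ne by (intro that[of y z]) (auto simp: nb_def)
qed

lemma delta2_le:
  assumes "p \<le> 20 * D ^ 3" "q \<le> 20 * D ^ 3"
  shows "\<delta>2 \<le> \<alpha> ^ p * d2 ^ q"
proof -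
  have "\<delta>2 \<le> \<alpha> ^ (20 * D ^ 3) * d2 ^ (20 * D ^ 3)"
    using \<delta>2(2) by (simp add: power_mult_distrib)
  also have "\<dots> \<le> \<alpha> ^ p * d2 ^ q"
    using assms \<alpha> d2 by (intro mult_mono power_decreasing) auto
  finally show ?thesis .
qed

text \<open>Every factor \<open>D\<close> in an error term can be paid for by a factor \<open>\<alpha>\<close>.\<close>
lemma alpha_power_absorbs:
  assumes "real m \<le> real D ^ k"
  shows "real m * \<alpha> ^ k \<le> 1"
proof -
  have "real m * \<alpha> ^ k \<le> real D ^ k * \<alpha> ^ k"
    using assms \<alpha> by (intro mult_right_mono) auto
  also have "\<dots> = (\<alpha> * real D) ^ k"
    by (simp add: power_mult_distrib mult.commute)
  also have "\<dots> \<le> 1"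
    using \<alpha> by (intro power_le_one) auto
  finally show ?thesis .
qed

lemma D_powers: "D \<le> D ^ 3" "D ^ 2 \<le> D ^ 3" "1 \<le> D ^ 3" "D \<le> D ^ 2" "1 \<le> D ^ 2"
  using D by (auto intro: power_increasing self_le_power)

text \<open>
  Let \<open>A\<close> consist of graph copies of \<open>B\<close> with too few extensions to \<open>h\<close>. Counting the extensions of
  all members of \<open>A\<close> by replacing the edges at \<open>h\<close> and then the hyperedges at \<open>h\<close> one at a time
  shows that they have about \<open>|A| n d2\<^bsup>|B|\<^esup> d3\<^bsup>l\<^esup>\<close> extensions in total, up to an error that is
  small compared with \<open>n\<^bsup>|B| + 1\<^esup> d2\<^bsup>e(B) + |B|\<^esup>\<close>. As the total is too small by a factor \<open>1 - \<alpha> / 2\<close>,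
  the size of \<open>A\<close> is bounded by the error divided by \<open>\<alpha> / 2\<close>. Membership in \<open>A\<close> may be an arbitrary
  condition on the values on \<open>B\<close>, because it does not depend on the image of \<open>h\<close>.
\<close>
lemma few_bad_links:
  assumes Z: "h \<in> Z" "Z \<subseteq> VH" and B_def: "B = nb Z h"
    and A: "A \<subseteq> {\<beta> \<in> PiE B W. \<forall>e\<in>EH. e \<subseteq> B \<longrightarrow> \<beta> ` e \<in> E}"
    and bad: "\<And>\<beta>. \<beta> \<in> A \<Longrightarrow>
      real (card (ext Z h \<beta>)) \<le> (1 - \<alpha> / 2) * real n * d2 ^ card B * d3 ^ card (link Z h)"
  shows "real (card A) \<le> \<alpha> ^ (D ^ 2 + D + 3) * real n ^ card B * d2 ^ card {e \<in> EH. e \<subseteq> B}"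
proof -
  define U where "U = insert h B"
  define Es where "Es = {e \<in> EH. e \<subseteq> U}"
  define L where "L = link Z h"
  define eB where "eB = card {e \<in> EH. e \<subseteq> B}"
  define \<epsilon> where "\<epsilon> = \<alpha> ^ (D ^ 2 + 2 * D + 6)"
  define err where "err = \<epsilon> * real n ^ card U * d2 ^ card Es"
  have B: "finite B" "h \<notin> B" "B \<subseteq> Z" "card B \<le> D"
    using card_nb[OF Z] by (auto simp: B_def)
  have U: "finite U" "U \<subseteq> VH" "card U = Suc (card B)"
    using B Z by (auto simp: U_def)
  have WU: "\<And>u. u \<in> U \<Longrightarrow> finite (W u)" "\<And>u. u \<in> U \<Longrightarrow> card (W u) = n"
    using W U by auto
  have finP: "finite (PiE U W)" "finite (PiE B W)"
    using U(1) B(1) WU by (auto simp: U_def intro!: finite_PiE)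
  have finA: "finite A"
    using A finP(2) by (metis (no_types, lifting) finite_subset mem_Collect_eq subsetI subsetD)
  have hb: "{h, b} \<in> EH" if "b \<in> B" for b
    using that by (simp add: B_def nb_def)
  have cardEs: "card Es = eB + card B"
  proof -
    have "inj_on (\<lambda>b. {h, b}) B"
      by (auto simp: inj_on_def doubleton_eq_iff)
    then have "card ((\<lambda>b. {h, b}) ` B) = card B"
      by (rule card_image)
    moreover have "Es = {e \<in> EH. e \<subseteq> B} \<union> (\<lambda>b. {h, b}) ` B"
    proof
      show "Es \<subseteq> {e \<in> EH. e \<subseteq> B} \<union> (\<lambda>b. {h, b}) ` B"
      proof
        fix e assume e: "e \<in> Es"
        then have "e \<in> EH"
          by (simp add: Es_def)
        then obtain x y where "e = {x, y}" "x \<noteq> y"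
          by (rule edgeE)
        then show "e \<in> {e \<in> EH. e \<subseteq> B} \<union> (\<lambda>b. {h, b}) ` B"
          using e by (auto simp: Es_def U_def insert_commute)
      qed
    qed (use hb in \<open>auto simp: Es_def U_def\<close>)
    moreover have "{e \<in> EH. e \<subseteq> B} \<inter> (\<lambda>b. {h, b}) ` B = {}"
      using B by auto
    ultimately show ?thesis
      using B finEH by (simp add: card_Un_disjoint eB_def)
  qed
  have eB: "eB \<le> D ^ 2"
  proof -
    have "{e \<in> EH. e \<subseteq> B} \<subseteq> {e \<in> EH. e \<inter> B \<noteq> {}}"
      using edgeE by blast
    then have "eB \<le> card {e \<in> EH. e \<inter> B \<noteq> {}}"
      unfolding eB_def using finEH by (intro card_mono) auto
    also have "\<dots> \<le> D * card B"
      using card_edges_meeting[of B] B Z by auto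
    finally show ?thesis
      using B(4) by (simp add: power2_eq_square order_trans[OF _ mult_le_mono2])
  qed
  have Es_le: "card Es \<le> D ^ 2 + D"
    using cardEs eB B(4) by linarith
  have finEs: "finite Es"
    using finEH by (simp add: Es_def)
  have eps: "0 < \<epsilon>" "\<epsilon> \<le> 1"
    using \<alpha> by (auto simp: \<epsilon>_def power_le_one)
  define P where "P L' \<phi> \<longleftrightarrow> restrict \<phi> B \<in> A \<and> (\<forall>b\<in>B. {\<phi> h, \<phi> b} \<in> E) \<and>
      (\<forall>e\<in>L'. insert (\<phi> h) (\<phi> ` e) \<in> F)" for L' \<phi>
  define N where "N L' = real (card {\<phi> \<in> PiE U W. P L' \<phi>})" for L'
  \<comment> \<open>One hyperedge \<open>{h, y, z}\<close> is replaced. The conditions that involve \<open>y\<close> are collected in \<open>p3\<close>; they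
    avoid \<open>z\<close>, as \<open>{y, z}\<close> is the only pair of the link containing both.\<close>
  have step: "d3 * N L' - err \<le> N (insert e L')" if L': "L' \<subseteq> L" and e: "e \<in> L" "e \<notin> L'" for e L'
  proof -
 
    have "e \<in> link Z h"
      using e by (simp add: L_def)
    then obtain y z where yz: "e = {y, z}" "y \<noteq> z" "y \<in> B" "z \<in> B" "{h, y, z} \<in> TH" "{y, z} \<in> EH"
      "h \<noteq> y" "h \<noteq> z" "{h, y} \<in> EH" "{h, z} \<in> EH"
      unfolding B_def by (rule linkE)
    define p1 where "p1 \<phi> \<longleftrightarrow> restrict \<phi> B \<in> A" for \<phi>
    define p2 where "p2 \<phi> \<longleftrightarrow> (\<forall>b\<in>B - {y}. {\<phi> h, \<phi> b} \<in> E) \<and>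
      (\<forall>e'\<in>L'. y \<notin> e' \<longrightarrow> insert (\<phi> h) (\<phi> ` e') \<in> F)" for \<phi>
    define p3 where "p3 \<phi> \<longleftrightarrow> {\<phi> h, \<phi> y} \<in> E \<and>
      (\<forall>e'\<in>L'. y \<in> e' \<longrightarrow> insert (\<phi> h) (\<phi> ` e') \<in> F)" for \<phi>
    have P_iff: "P L' \<phi> \<longleftrightarrow> p1 \<phi> \<and> p2 \<phi> \<and> p3 \<phi>" for \<phi>
      unfolding P_def p1_def p2_def p3_def using yz(3) by blast
    have upd: "(\<phi>(u := a)) ` e' = \<phi> ` e'" if "u \<notin> e'" for \<phi> :: "'a \<Rightarrow> 'b" and u a e'
      using that by auto
    have noz: "z \<notin> e'" if e': "e' \<in> L'" "y \<in> e'" for e'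
    proof -
      have "e' \<in> link Z h"
        using e' L' by (auto simp: L_def)
      then obtain u v where "e' = {u, v}"
        by (rule linkE)
      then show ?thesis
        using e' e(2) yz(1,2) by (metis doubleton_eq_iff insertE singletonD)
    qed
    have "{h, y} \<in> Es" "{y, z} \<in> Es" "{h, z} \<in> Es"
      using yz by (auto simp: Es_def U_def)
    moreover from this have "{{h, y}, {y, z}, {h, z}} \<subseteq> Es"
      by simp
    then have "card {{h, y}, {y, z}, {h, z}} \<le> card Es"
      using finEs by (rule card_mono[rotated])
    moreover have "card {{h, y}, {y, z}, {h, z}} = 3"
      using yz by (simp add: card_insert_if doubleton_eq_iff)
    ultimately have in_Es: "{h, y} \<in> Es" "{y, z} \<in> Es" "{h, z} \<in> Es" and C: "card Es = (card Es - 3) + 3"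
      by auto
    let ?C = "card Es - 3"
    have "(\<Sum>\<phi>\<in>{\<phi> \<in> PiE U W. p1 \<phi> \<and> p2 \<phi> \<and> p3 \<phi>}. d3 - of_bool ({\<phi> h, \<phi> y, \<phi> z} \<in> F))
        \<le> \<epsilon> * real n ^ card U * d2 ^ card Es"
    proof (rule hyperedge_replacement[OF U(1) _ _ _ _ _ _ WU n finEs in_Es, where C = ?C])
      show "h \<in> U" "y \<in> U" "z \<in> U" "h \<noteq> y" "y \<noteq> z" "h \<noteq> z"
        using yz by (auto simp: U_def)
      show "lower_regular d3 \<delta>3 r E F (W h) (W y) (W z)"
        using reg yz by blast
      show "0 < d2" "d2 \<le> 1" "0 \<le> d3" "d3 \<le> 2" "0 < \<epsilon>" "\<epsilon> \<le> 1" "card Es = ?C + 3"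
        using d2 d3 \<alpha> eps C by auto
      show "p1 (\<phi>(h := a)) = p1 \<phi>" for \<phi> a
      proof -
        have "restrict (\<phi>(h := a)) B = restrict \<phi> B"
          using B(2) by (auto simp: restrict_def fun_eq_iff)
        then show ?thesis
          unfolding p1_def by simp
      qed
      show "p2 (\<phi>(y := a)) = p2 \<phi>" for \<phi> a
      proof -
        have "\<forall>e'\<in>L'. y \<notin> e' \<longrightarrow> (\<phi>(y := a)) ` e' = \<phi> ` e'"
          using upd[of y _ \<phi> a] by blast
        then show ?thesis
          unfolding p2_def using yz(7) by auto
      qed
      show "p3 (\<phi>(z := a)) = p3 \<phi>" for \<phi> a
      proof -
        have "\<forall>e'\<in>L'. y \<in> e' \<longrightarrow> (\<phi>(z := a)) ` e' = \<phi> ` e'"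
          using upd[of z _ \<phi> a] noz by blast
        then show ?thesis
          unfolding p3_def using yz(2,8) by auto
      qed
      show "\<exists>u\<in>U. \<exists>v\<in>U. u \<noteq> v \<and> e' = {u, v} \<and> cut_close E d2 (\<delta>2 * real n ^ 2) (W u) (W v)"
        if "e' \<in> Es" for e'
      proof -
        have e': "e' \<in> EH" "e' \<subseteq> U"
          using that by (auto simp: Es_def)
        obtain u v where "e' = {u, v}" "u \<noteq> v"
          using e'(1) by (rule edgeE)
        then show ?thesis
          using e' cut by blast
      qed
      show "\<phi> ` e' \<in> E" if p: "p1 \<phi>" "p2 \<phi>" "p3 \<phi>" "e' \<in> Es" for \<phi> e'
      proof (cases "e' \<subseteq> B")
        case True
        then have "restrict \<phi> B ` e' = \<phi> ` e'"
          by (intro image_cong) auto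
        moreover have "restrict \<phi> B ` e' \<in> E"
          using A p True unfolding p1_def Es_def by blast
        ultimately show ?thesis
          by (simp only:)
      next
        case False
        have "e' \<in> EH" "e' \<subseteq> U"
          using p(4) by (auto simp: Es_def)
        then obtain u v where uv: "e' = {u, v}" "u \<noteq> v"
          by (metis edgeE)
        obtain b where "b \<in> B" "e' = {h, b}"
        proof (cases "u = h")
          case True
          then show ?thesis
            using uv \<open>e' \<subseteq> U\<close> that[of v] by (auto simp: U_def)
        next
          case u: False
          then show ?thesis
            using uv False \<open>e' \<subseteq> U\<close> that[of u] by (auto simp: U_def insert_commute)
        qed
        moreover have "{\<phi> h, \<phi> b} \<in> E"
          using p(2,3) \<open>b \<in> B\<close> unfolding p2_def p3_def by (cases "b = y") auto
        ultimately show ?thesis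
          by simp
      qed
      show "3 * \<delta>2 \<le> d2 ^ 3"
      proof -
        have "\<delta>2 \<le> \<alpha> ^ 1 * d2 ^ 3"
          using D_powers by (intro delta2_le) auto
        also have "\<dots> \<le> 1 / 4 * d2 ^ 3"
          using \<alpha> d2 by (intro mult_right_mono) auto
        finally show ?thesis
          using d2 zero_le_power[of d2 3] by linarith
      qed
      have C_le: "?C \<le> D ^ 2 + D"
        using Es_le by linarith
      show "real ?C * \<delta>2 \<le> d2 ^ (3 + 3 * ?C)"
      proof -
        have "real ?C \<le> 2 * real (D ^ 2)"
          using C_le D_powers(4) by linarith
        moreover have "\<delta>2 \<le> \<alpha> ^ 3 * d2 ^ (3 + 3 * ?C)"
          using C_le D_powers by (intro delta2_le) auto
        ultimately have "real ?C * \<delta>2 \<le> (2 * real (D ^ 2)) * (\<alpha> ^ 3 * d2 ^ (3 + 3 * ?C))"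
          using \<delta>2 by (intro mult_mono) auto
        also have "\<dots> = (2 * \<alpha>) * (real (D ^ 2) * \<alpha> ^ 2) * d2 ^ (3 + 3 * ?C)"
          by (simp add: power2_eq_square power3_eq_cube)
        also have "\<dots> \<le> 1 * 1 * d2 ^ (3 + 3 * ?C)"
          using \<alpha> d2 alpha_power_absorbs[of "D ^ 2" 2] by (intro mult_mono mult_nonneg_nonneg) auto
        finally show ?thesis by simp
      qed
      show "2 \<le> real r * d2 ^ ?C"
      proof -
        have "real r * d2 ^ (D ^ 2 + D) \<le> real r * d2 ^ ?C"
          using C_le d2 by (intro mult_left_mono power_decreasing) auto
        then show ?thesis
          using r by linarith
      qed
      show "\<delta>3 \<le> \<epsilon> ^ 2 / 144"
      proof -
        have "\<alpha> ^ 4 \<le> (1 / 4) ^ 4"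
          using \<alpha> by (intro power_mono) auto
        then have a4: "\<alpha> ^ 4 \<le> 1 / 144"
          by (simp add: power_divide)
        have "2 * (D ^ 2 + 2 * D + 6) + 4 \<le> 22 * D ^ 2"
        proof -
          have "4 * D + 16 * 1 \<le> 4 * D ^ 2 + 16 * D ^ 2"
            by (intro add_mono mult_le_mono2 D_powers)
          then show ?thesis
            by (simp add: algebra_simps)
        qed
        then have "\<alpha> ^ (22 * D ^ 2) \<le> \<alpha> ^ (2 * (D ^ 2 + 2 * D + 6) + 4)"
          using \<alpha> by (intro power_decreasing) auto
        also have "\<dots> = \<epsilon> ^ 2 * \<alpha> ^ 4"
          unfolding \<epsilon>_def power_add[of \<alpha> "2 * (D ^ 2 + 2 * D + 6)"]
          by (simp only: power_mult[symmetric] mult.commute)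
        also have "\<dots> \<le> \<epsilon> ^ 2 * (1 / 144)"
          using a4 by (intro mult_left_mono) auto
        finally show ?thesis
          using \<delta>3 by simp
      qed
    qed
    moreover have "(\<Sum>\<phi>\<in>{\<phi> \<in> PiE U W. p1 \<phi> \<and> p2 \<phi> \<and> p3 \<phi>}. d3 - of_bool ({\<phi> h, \<phi> y, \<phi> z} \<in> F)) =
      d3 * N L' - N (insert e L')"
    proof -
      have "{\<phi> \<in> PiE U W. P L' \<phi>} \<inter> {\<phi>. {\<phi> h, \<phi> y, \<phi> z} \<in> F} = {\<phi> \<in> PiE U W. P (insert e L') \<phi>}"
        unfolding P_def yz(1) by auto
      then show ?thesis
        using finP unfolding P_iff[symmetric]
        by (simp add: sum_subtractf sum_of_bool_eq N_def mult.commute)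
    qed
    ultimately show ?thesis
      by (simp add: err_def)
  qed
  have d3pos: "0 < d3"
    using d3 \<alpha> by linarith
  have err0: "0 \<le> err"
    using eps d2 by (simp add: err_def)
  \<comment> \<open>The error is measured relative to \<open>d3 ^ card L'\<close>, which costs at most a factor \<open>\<alpha> ^ D\<close>.\<close>
  have chain: "d3 ^ card L' * (N {} - real (card L') * (err / \<alpha> ^ D)) \<le> N L'"
    if "finite L'" "L' \<subseteq> L" for L'
    using that
  proof (induction L')
    case empty
    then show ?case by simp
  next
    case (insert e L')
    have "card (insert e L') \<le> D"
      using insert.prems card_link(2,3)[OF Z] card_mono[of L "insert e L'"] by (simp add: L_def)
    then have "\<alpha> ^ D \<le> \<alpha> ^ card (insert e L')"
      using \<alpha> by (intro power_decreasing) auto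
    also have "\<dots> \<le> d3 ^ card (insert e L')"
      using \<alpha> d3 by (intro power_mono) auto
    finally have "err \<le> d3 ^ card (insert e L') * (err / \<alpha> ^ D)"
      using err0 \<alpha> mult_right_mono[of "\<alpha> ^ D" "d3 ^ card (insert e L')" "err / \<alpha> ^ D"] by simp
    moreover have "d3 * (d3 ^ card L' * (N {} - real (card L') * (err / \<alpha> ^ D))) \<le> d3 * N L'"
      using insert d3pos by (intro mult_left_mono) auto
    moreover have "d3 * N L' - err \<le> N (insert e L')"
      using insert by (intro step) auto
    ultimately show ?case
      using insert.hyps by (simp add: algebra_simps add_divide_distrib)
  qed
  have N0: "real (card A) * real n * d2 ^ card B - real (card B) * \<delta>2 * real n ^ card U \<le> N {}"
  proof -
    define g where "g \<phi> \<longleftrightarrow> restrict \<phi> B \<in> A" for \<phi>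
    let ?Fs = "(\<lambda>b. {h, b}) ` B"
    have restr: "restrict (\<beta>(h := v)) B = \<beta>" if "\<beta> \<in> PiE B W" for \<beta> v
      using that B(2) by (auto simp: restrict_def fun_eq_iff PiE_def extensional_def)
    have "\<bar>(\<Sum>\<phi>\<in>PiE U W. of_bool (g \<phi> \<and> (\<forall>e\<in>?Fs. \<phi> ` e \<in> E))) -
      d2 ^ card ?Fs * (\<Sum>\<phi>\<in>PiE U W. of_bool (g \<phi>))\<bar> \<le> real (card ?Fs) * \<delta>2 * real n ^ card U"
    proof (rule hom_count)
      fix e assume "e \<in> ?Fs"
      then obtain b where b: "b \<in> B" "e = {h, b}"
        by blast
      have "splits_at h b g"
      proof -
        have "restrict (\<phi>(h := a)) B = restrict \<phi> B" for \<phi> :: "'a \<Rightarrow> 'b" and a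
          using B(2) by (auto simp: restrict_def fun_eq_iff)
        then show ?thesis
          unfolding splits_at_def g_def
          by - (rule exI[of _ "{\<phi>. restrict \<phi> B \<in> A}"], rule exI[of _ UNIV], simp del: fun_upd_apply)
      qed
      then show "\<exists>x\<in>U. \<exists>y\<in>U. x \<noteq> y \<and> e = {x, y} \<and>
          cut_close E d2 (\<delta>2 * real n ^ 2) (W x) (W y) \<and> splits_at x y g"
        using b B(2) cut[OF hb[OF b(1)]] by (intro bexI[of _ h] bexI[of _ b]) (auto simp: U_def)
    qed (use U WU d2 B in auto)
    moreover have "card ?Fs = card B"
      by (rule card_image) (auto simp: inj_on_def doubleton_eq_iff)
    moreover have "(\<Sum>\<phi>\<in>PiE U W. of_bool (g \<phi>)) = real (card A) * real n"
    proof -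
      have "(\<Sum>\<phi>\<in>PiE U W. of_bool (g \<phi>) :: real) = (\<Sum>\<beta>\<in>PiE B W. \<Sum>v\<in>W h. of_bool (g (\<beta>(h := v))))"
        unfolding U_def by (rule sum_PiE_insert[OF B(2)])
      also have "\<dots> = (\<Sum>\<beta>\<in>PiE B W. real n * of_bool (\<beta> \<in> A))"
        using WU(2)[of h] unfolding g_def
        by (intro sum.cong refl) (simp add: restr U_def del: fun_upd_apply)
      also have "\<dots> = real n * real (card (PiE B W \<inter> A))"
        using finP by (simp add: sum_of_bool_eq flip: sum_distrib_left)
      also have "PiE B W \<inter> A = A"
        using A by blast
      finally show ?thesis
        by simp
    qed
    moreover have "(\<Sum>\<phi>\<in>PiE U W. of_bool (g \<phi> \<and> (\<forall>e\<in>?Fs. \<phi> ` e \<in> E))) = N {}"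
      using finP by (simp add: sum_of_bool_eq N_def P_def g_def Int_def)
    ultimately show ?thesis
      by (simp add: abs_le_iff algebra_simps)
  qed
  have NL: "N L \<le> real (card A) * ((1 - \<alpha> / 2) * real n * d2 ^ card B * d3 ^ card L)"
  proof -
    have "N L = (\<Sum>\<phi>\<in>PiE U W. of_bool (P L \<phi>))"
      using finP by (simp add: sum_of_bool_eq N_def Int_def)
    also have "\<dots> = (\<Sum>\<beta>\<in>PiE B W. \<Sum>v\<in>W h. of_bool (P L (\<beta>(h := v))))"
      unfolding U_def by (rule sum_PiE_insert[OF B(2)])
    also have "\<dots> = (\<Sum>\<beta>\<in>PiE B W. if \<beta> \<in> A then real (card (ext Z h \<beta>)) else 0)"
    proof (rule sum.cong[OF refl])
      fix \<beta> assume \<beta>: "\<beta> \<in> PiE B W"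
      have restr: "restrict (\<beta>(h := v)) B = \<beta>" for v
        using \<beta> B(2) by (auto simp: restrict_def fun_eq_iff PiE_def extensional_def)
      have img: "(\<beta>(h := v)) ` e = \<beta> ` e" if "e \<in> L" for e v
      proof -
        have "h \<notin> e"
          using that by (auto simp: L_def link_def)
        then show ?thesis
          by auto
      qed
      have "P L (\<beta>(h := v)) \<longleftrightarrow> \<beta> \<in> A \<and> (\<forall>b\<in>B. {v, \<beta> b} \<in> E) \<and> (\<forall>e\<in>L. insert v (\<beta> ` e) \<in> F)" for v
        unfolding P_def restr using img B(2) by (auto simp del: image_insert)
      then have "{v \<in> W h. P L (\<beta>(h := v))} = (if \<beta> \<in> A then ext Z h \<beta> else {})"
        by (auto simp: ext_def L_def B_def)
      moreover have "(\<Sum>v\<in>W h. of_bool (P L (\<beta>(h := v)))) = real (card {v \<in> W h. P L (\<beta>(h := v))})"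
        using WU(1)[of h] by (simp add: sum_of_bool_eq U_def Int_def)
      ultimately show "(\<Sum>v\<in>W h. of_bool (P L (\<beta>(h := v)))) = (if \<beta> \<in> A then real (card (ext Z h \<beta>)) else 0)"
        by simp
    qed
    also have "\<dots> = (\<Sum>\<beta>\<in>A. real (card (ext Z h \<beta>)))"
    proof -
      have "PiE B W \<inter> A = A"
        using A by blast
      then show ?thesis
        using finP by (simp add: sum.If_cases)
    qed
    also have "\<dots> \<le> real (card A) * ((1 - \<alpha> / 2) * real n * d2 ^ card B * d3 ^ card L)"
      using bad by (intro sum_bounded_above) (auto simp: L_def)
    finally show ?thesis .
  qed
  have finL: "finite L" "card L \<le> D"
    using card_link[OF Z] by (auto simp: L_def)
  have "d3 ^ card L * (N {} - real (card L) * (err / \<alpha> ^ D)) \<le>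
      d3 ^ card L * (real (card A) * ((1 - \<alpha> / 2) * real n * d2 ^ card B))"
    using chain[OF finL(1) order_refl] NL by (simp add: mult_ac)
  then have "N {} - real (card L) * (err / \<alpha> ^ D) \<le> real (card A) * ((1 - \<alpha> / 2) * real n * d2 ^ card B)"
    using d3pos by (simp add: mult_le_cancel_left_pos)
  then have "real (card A) * (\<alpha> / 2) * (real n * d2 ^ card B) \<le>
      real (card B) * \<delta>2 * real n ^ card U + real (card L) * (err / \<alpha> ^ D)"
  proof -
    have "real (card A) * ((1 - \<alpha> / 2) * real n * d2 ^ card B) =
      real (card A) * real n * d2 ^ card B - real (card A) * (\<alpha> / 2) * (real n * d2 ^ card B)"
      by (simp add: field_simps)
    then show ?thesis
      using N0 \<open>N {} - _ \<le> _\<close> by linarith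
  qed
  also have "\<dots> \<le> 2 * \<alpha> ^ (D ^ 2 + D + 5) * d2 ^ card Es * real n ^ card U"
  proof -
    have "real (card B) * \<delta>2 \<le> real D * (\<alpha> ^ (D ^ 2 + D + 6) * d2 ^ card Es)"
    proof (intro mult_mono delta2_le)
      show "D ^ 2 + D + 6 \<le> 20 * D ^ 3" "card Es \<le> 20 * D ^ 3"
        using Es_le D_powers by linarith+
    qed (use B \<delta>2 in auto)
    also have "\<dots> = (\<alpha> * real D) * (\<alpha> ^ (D ^ 2 + D + 5) * d2 ^ card Es)"
      by (simp add: power_add numeral_eq_Suc)
    also have "\<dots> \<le> 1 * (\<alpha> ^ (D ^ 2 + D + 5) * d2 ^ card Es)"
      using \<alpha> d2 by (intro mult_right_mono) auto
    finally have 1: "real (card B) * \<delta>2 * real n ^ card U \<le> \<alpha> ^ (D ^ 2 + D + 5) * d2 ^ card Es * real n ^ card U"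
      by (intro mult_right_mono) auto
    have "real (card L) * (err / \<alpha> ^ D) \<le> real D * (err / \<alpha> ^ D)"
      using finL err0 \<alpha> by (intro mult_right_mono) auto
    also have "\<dots> = (\<alpha> * real D) * (\<alpha> ^ (D ^ 2 + D + 5) * d2 ^ card Es * real n ^ card U)"
    proof -
      have "\<epsilon> = \<alpha> * \<alpha> ^ (D ^ 2 + D + 5) * \<alpha> ^ D"
        by (simp add: \<epsilon>_def power_add numeral_eq_Suc)
      then show ?thesis
        using \<alpha> by (simp add: err_def)
    qed
    also have "\<dots> \<le> 1 * (\<alpha> ^ (D ^ 2 + D + 5) * d2 ^ card Es * real n ^ card U)"
      using \<alpha> d2 by (intro mult_right_mono) auto
    finally show ?thesis
      using 1 by simp
  qed
  also have "\<dots> = (2 * \<alpha> ^ (D ^ 2 + D + 5) * d2 ^ eB * real n ^ card B) * (real n * d2 ^ card B)"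
    by (simp add: cardEs U power_add)
  finally have "real (card A) * (\<alpha> / 2) \<le> 2 * \<alpha> ^ (D ^ 2 + D + 5) * d2 ^ eB * real n ^ card B"
    using n d2 by (simp add: mult_le_cancel_right_pos)
  also have "\<dots> = (4 * \<alpha>) * (\<alpha> ^ (D ^ 2 + D + 3) * real n ^ card B * d2 ^ eB) * (\<alpha> / 2)"
    by (simp add: power_add numeral_eq_Suc)
  also have "\<dots> \<le> 1 * (\<alpha> ^ (D ^ 2 + D + 3) * real n ^ card B * d2 ^ eB) * (\<alpha> / 2)"
    using \<alpha> d2 by (intro mult_right_mono) auto
  finally show ?thesis
    using \<alpha> by (simp add: eB_def)
qed

lemma emb_restrict:
  assumes "\<phi> \<in> emb Z" "Z' \<subseteq> Z"
  shows "restrict \<phi> Z' \<in> emb Z'"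
proof -
  have img: "restrict \<phi> Z' ` e = \<phi> ` e" if "e \<subseteq> Z'" for e
    using that by (intro image_cong) auto
  have "inj_on (restrict \<phi> Z') Z'"
    using assms inj_on_subset[of \<phi> Z Z'] by (auto simp: emb_def inj_on_def)
  moreover have "restrict \<phi> Z' \<in> PiE Z' W"
    using assms by (auto simp: emb_def)
  moreover have "\<forall>e\<in>EH. e \<subseteq> Z' \<longrightarrow> restrict \<phi> Z' ` e \<in> E"
  proof (intro ballI impI)
    fix e assume "e \<in> EH" "e \<subseteq> Z'"
    then show "restrict \<phi> Z' ` e \<in> E"
      unfolding img[OF \<open>e \<subseteq> Z'\<close>] using assms by (auto simp: emb_def)
  qed
  moreover have "\<forall>t\<in>TH. t \<subseteq> Z' \<longrightarrow> restrict \<phi> Z' ` t \<in> F"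
  proof (intro ballI impI)
    fix t assume "t \<in> TH" "t \<subseteq> Z'"
    then show "restrict \<phi> Z' ` t \<in> F"
      unfolding img[OF \<open>t \<subseteq> Z'\<close>] using assms by (auto simp: emb_def)
  qed
  ultimately show ?thesis
    by (simp add: emb_def)
qed

lemma finite_emb: "Z \<subseteq> VH \<Longrightarrow> finite (emb Z)"
  unfolding emb_def using W finVH
  by (intro finite_subset[OF _ finite_PiE[of Z W]]) (auto intro: finite_subset)

lemma num_nonneg: "0 \<le> num Z"
  by (simp add: num_def)

text \<open>The inequality to be proved, for the subcomplex induced by \<open>Z\<close> and its vertex \<open>h\<close>.\<close>
definition extends_well :: "'a set \<Rightarrow> 'a \<Rightarrow> bool" where
  "extends_well Z h \<longleftrightarrow> num Z \<ge> (1 - \<alpha>) * real n * d2 ^ card {e \<in> EH. e \<subseteq> Z \<and> h \<in> e} *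
     d3 ^ card {t \<in> TH. t \<subseteq> Z \<and> h \<in> t} * num (Z - {h})"

text \<open>Removing the vertices of \<open>M\<close> one after the other.\<close>
lemma num_ge_iterated:
  assumes "M \<subseteq> Z" "Z \<subseteq> VH" and well: "\<And>Z' x. Z' \<subseteq> Z \<Longrightarrow> x \<in> Z' \<Longrightarrow> extends_well Z' x"
  shows "num Z \<ge> ((1 - \<alpha>) * real n) ^ card M * d2 ^ card {e \<in> EH. e \<subseteq> Z \<and> e \<inter> M \<noteq> {}} *
    d3 ^ card {t \<in> TH. t \<subseteq> Z \<and> t \<inter> M \<noteq> {}} * num (Z - M)"
proof -
  have "finite M"
    using assms finVH by (meson finite_subset)
  then show ?thesis
    using \<open>M \<subseteq> Z\<close>
  proof (induction M)
    case empty
    then show ?case by simp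
  next
    case (insert x M)
    let ?a = "\<lambda>M. card {e \<in> EH. e \<subseteq> Z \<and> e \<inter> M \<noteq> {}}"
    let ?b = "\<lambda>M. card {t \<in> TH. t \<subseteq> Z \<and> t \<inter> M \<noteq> {}}"
    have split: "card {e \<in> X. e \<subseteq> Z \<and> e \<inter> insert x M \<noteq> {}} =
        card {e \<in> X. e \<subseteq> Z \<and> e \<inter> M \<noteq> {}} + card {e \<in> X. e \<subseteq> Z - M \<and> x \<in> e}" if "finite X" for X
    proof -
      have "{e \<in> X. e \<subseteq> Z \<and> e \<inter> insert x M \<noteq> {}} =
        {e \<in> X. e \<subseteq> Z \<and> e \<inter> M \<noteq> {}} \<union> {e \<in> X. e \<subseteq> Z - M \<and> x \<in> e}"
        by blast
      moreover have "{e \<in> X. e \<subseteq> Z \<and> e \<inter> M \<noteq> {}} \<inter> {e \<in> X. e \<subseteq> Z - M \<and> x \<in> e} = {}"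
        by blast
      ultimately show ?thesis
        using that by (simp add: card_Un_disjoint)
    qed
    have pos: "0 \<le> (1 - \<alpha>) * real n" "0 \<le> d2" "0 \<le> d3"
      using \<alpha> d2 d3 by auto
    have "extends_well (Z - M) x"
      using insert by (intro well) auto
    then have "((1 - \<alpha>) * real n) ^ card M * d2 ^ ?a M * d3 ^ ?b M *
        ((1 - \<alpha>) * real n * d2 ^ card {e \<in> EH. e \<subseteq> Z - M \<and> x \<in> e} *
          d3 ^ card {t \<in> TH. t \<subseteq> Z - M \<and> x \<in> t} * num (Z - M - {x}))
      \<le> ((1 - \<alpha>) * real n) ^ card M * d2 ^ ?a M * d3 ^ ?b M * num (Z - M)"
      unfolding extends_well_def using pos \<alpha> by (intro mult_left_mono mult_nonneg_nonneg zero_le_power) auto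
    also have "\<dots> \<le> num Z"
      using insert by auto
    also have "Z - M - {x} = Z - insert x M"
      by blast
    finally show ?case
      unfolding split[OF finEH] split[OF finTH] using insert.hyps by (simp add: power_add mult_ac)
  qed
qed

text \<open>
  A copy of the complex without \<open>h\<close> is bad if its restriction to the set \<open>B\<close> of neighbours of \<open>h\<close>
  lies in the set \<open>A\<close> of graph copies of \<open>B\<close> with too few extensions. A bad copy is determined by
  its restrictions to \<open>B\<close> and to the other vertices, and the latter has to be joined correctly to
  the former. Let \<open>S\<close> be the set of
  vertices outside \<open>B \<union> {h}\<close> with a neighbour in \<open>B\<close>. If the restriction to \<open>S\<close> is typical, there are at
  most \<open>2 d2\<^bsup>f\<^esup> a\<close> choices on \<open>B\<close>, where \<open>f\<close> counts the edges between \<open>S\<close> and \<open>B\<close> and \<open>a\<close> bounds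
  \<open>|A|\<close>; this has the right power of \<open>d2\<close> for a comparison with the copies of the complex without
  \<open>B\<close>. If it is atypical, there are at most \<open>|Y|\<close> choices on \<open>S\<close>, so few that all
  powers of \<open>d2\<close> coming from the edges at \<open>B \<union> S\<close> can be given away. Every other copy has at
  least \<open>(1 - \<alpha> / 2) \<mu>\<close> extensions, of which at most \<open>c n\<close> are lost to vertices used already.
\<close>
lemma extend_one_vertex:
  assumes Z: "Z \<subseteq> VH" "h \<in> Z"
    and well: "\<And>Z' x. Z' \<subset> Z \<Longrightarrow> x \<in> Z' \<Longrightarrow> extends_well Z' x"
  shows "extends_well Z h"
proof -
  define B where "B = nb Z h"
  define Z1 where "Z1 = Z - {h}"
  define S where "S = {s \<in> Z1 - B. \<exists>b\<in>B. {s, b} \<in> EH}"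
  define Fs where "Fs = {e \<in> EH. e \<subseteq> Z1 \<and> e \<inter> B \<noteq> {} \<and> \<not> e \<subseteq> B}"
  define \<mu> where "\<mu> = real n * d2 ^ card B * d3 ^ card (link Z h)"
  define A where "A = {\<beta> \<in> PiE B W. (\<forall>e\<in>EH. e \<subseteq> B \<longrightarrow> \<beta> ` e \<in> E) \<and>
      real (card (ext Z h \<beta>)) \<le> (1 - \<alpha> / 2) * \<mu>}"
  define eB where "eB = card {e \<in> EH. e \<subseteq> B}"
  define f where "f = card Fs"
  define a where "a = \<alpha> ^ (D ^ 2 + D + 3) * real n ^ card B * d2 ^ eB"
  define mg :: "('a \<Rightarrow> 'b) \<Rightarrow> ('a \<Rightarrow> 'b) \<Rightarrow> 'a \<Rightarrow> 'b"
    where "mg \<beta> \<sigma> = (\<lambda>u. if u \<in> B then \<beta> u else \<sigma> u)" for \<beta> \<sigma>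
  define N where "N \<sigma> = card {\<beta> \<in> A. \<forall>e\<in>Fs. mg \<beta> \<sigma> ` e \<in> E}" for \<sigma>
  define Y where "Y = {\<sigma> \<in> PiE S W. real (N \<sigma>) > 2 * d2 ^ f * a}"
  define Bad where "Bad = {\<phi> \<in> emb Z1. restrict \<phi> B \<in> A}"
  have B: "finite B" "h \<notin> B" "B \<subseteq> Z" "card B \<le> D" "card B = card {e \<in> EH. e \<subseteq> Z \<and> h \<in> e}"
    using card_nb[OF Z(2,1)] by (auto simp: B_def)
  have Z1: "Z1 \<subset> Z" "Z1 \<subseteq> VH" "B \<subseteq> Z1" "finite Z1"
    using Z B finVH by (auto simp: Z1_def intro: finite_subset)
  have S: "S \<subseteq> Z1" "S \<inter> B = {}" "finite S" "B \<subseteq> VH" "S \<subseteq> VH"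
    using Z1 finite_subset[of S Z1] by (auto simp: S_def)
  have finFs: "finite Fs"
    using finEH by (simp add: Fs_def)
  have WB: "\<And>u. u \<in> B \<Longrightarrow> finite (W u)" "\<And>u. u \<in> S \<union> B \<Longrightarrow> finite (W u)"
    "\<And>u. u \<in> S \<union> B \<Longrightarrow> card (W u) = n"
    using W S by auto
  have finPB: "finite (PiE B W)" "finite (PiE S W)"
    using B(1) S(3) WB by (auto intro!: finite_PiE)
  have finA: "finite A"
    using finPB by (simp add: A_def)
  have finY: "finite Y"
    using finPB by (simp add: Y_def)
  have cardA: "real (card A) \<le> a"
    unfolding a_def eB_def
  proof (rule few_bad_links[OF Z(2,1) B_def])
    show "A \<subseteq> {\<beta> \<in> PiE B W. \<forall>e\<in>EH. e \<subseteq> B \<longrightarrow> \<beta> ` e \<in> E}"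
      by (auto simp: A_def)
    show "real (card (ext Z h \<beta>)) \<le> (1 - \<alpha> / 2) * real n * d2 ^ card B * d3 ^ card (link Z h)"
      if "\<beta> \<in> A" for \<beta>
      using that by (simp add: A_def \<mu>_def mult_ac)
  qed
  have a0: "0 \<le> a"
    using \<alpha> d2 by (simp add: a_def)
  have Fs_edge: "\<exists>s\<in>S. \<exists>b\<in>B. s \<noteq> b \<and> e = {s, b}" if "e \<in> Fs" for e
  proof -
    have e: "e \<in> EH" "e \<subseteq> Z1" "e \<inter> B \<noteq> {}" "\<not> e \<subseteq> B"
      using that by (auto simp: Fs_def)
    obtain u v where uv: "e = {u, v}" "u \<noteq> v"
      using e(1) by (rule edgeE)
    show ?thesis
    proof (cases "u \<in> B")
      case True
      then have "v \<in> S"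
        using e uv by (auto simp: S_def insert_commute)
      then show ?thesis
        using True uv by (metis insert_commute)
    next
      case False
      then have "v \<in> B" "u \<in> S"
        using e uv by (auto simp: S_def)
      then show ?thesis
        using uv by blast
    qed
  qed
  have cardY: "d2 ^ f * a * real (card Y) \<le> real f * \<delta>2 * real n ^ (card S + card B)"
    unfolding f_def Y_def N_def mg_def
  proof (rule few_atypical[OF S(3) B(1) finFs S(2) WB(2,3) d2 _ cardA])
    show "A \<subseteq> PiE B W"
      by (auto simp: A_def)
    show "\<exists>x\<in>S \<union> B. \<exists>y\<in>B. x \<noteq> y \<and> e = {x, y} \<and> (x \<in> S \<or> A = PiE B W) \<and>
        cut_close E d2 (\<delta>2 * real n ^ 2) (W x) (W y)" if "e \<in> Fs" for e
    proof -
      obtain s b where "s \<in> S" "b \<in> B" "s \<noteq> b" "e = {s, b}"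
        using Fs_edge \<open>e \<in> Fs\<close> by blast
      moreover from this have "cut_close E d2 (\<delta>2 * real n ^ 2) (W s) (W b)"
        using that by (intro cut) (simp add: Fs_def)
      ultimately show ?thesis
        by blast
    qed
  qed
  have card_meet: "card {e \<in> EH. e \<subseteq> Z1 \<and> e \<inter> B \<noteq> {}} = eB + f"
  proof -
    have "e \<inter> B \<noteq> {}" if "e \<in> EH" "e \<subseteq> B" for e
      using that edgeE[of e] by blast
    then have "{e \<in> EH. e \<subseteq> Z1 \<and> e \<inter> B \<noteq> {}} = {e \<in> EH. e \<subseteq> B} \<union> Fs"
      using Z1(3) unfolding Fs_def by blast
    moreover have "{e \<in> EH. e \<subseteq> B} \<inter> Fs = {}"
      by (auto simp: Fs_def)
    ultimately show ?thesis
      using finEH finFs by (simp add: card_Un_disjoint eB_def f_def)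
  qed
  have wellZ1: "extends_well Z' x" if "Z' \<subseteq> Z1" "x \<in> Z'" for Z' x
    using that Z1 by (intro well) auto
  have meet_le: "card {e \<in> X. e \<subseteq> Z1 \<and> e \<inter> M \<noteq> {}} \<le> D * card M"
    if "M \<subseteq> VH" "X = EH \<or> X = TH" for X M
  proof -
    have "card {e \<in> X. e \<subseteq> Z1 \<and> e \<inter> M \<noteq> {}} \<le> card {e \<in> X. e \<inter> M \<noteq> {}}"
      using that(2) finEH finTH by (intro card_mono) auto
    also have "\<dots> \<le> D * card M"
      using card_edges_meeting[OF that(1)] that(2) by auto
    finally show ?thesis .
  qed
  have low: "\<alpha> ^ k \<le> (1 - \<alpha>) ^ j" "\<alpha> ^ k \<le> d3 ^ j" if "j \<le> k" for j k
  proof -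
    have "\<alpha> ^ k \<le> \<alpha> ^ j"
      using that \<alpha> by (intro power_decreasing) auto
    moreover have "\<alpha> ^ j \<le> (1 - \<alpha>) ^ j" "\<alpha> ^ j \<le> d3 ^ j"
      using \<alpha> d3 by (auto intro!: power_mono)
    ultimately show "\<alpha> ^ k \<le> (1 - \<alpha>) ^ j" "\<alpha> ^ k \<le> d3 ^ j"
      by linarith+
  qed
  have Db: "D * card B \<le> D ^ 2"
    using B(4) by (simp add: power2_eq_square)
  have cS: "card S \<le> D ^ 2"
  proof -
    have "S \<subseteq> (\<Union>b\<in>B. nb Z1 b)"
      by (auto simp: S_def nb_def insert_commute)
    moreover have "finite (\<Union>b\<in>B. nb Z1 b)"
      using B(1) Z1 by (auto simp: nb_def)
    ultimately have "card S \<le> card (\<Union>b\<in>B. nb Z1 b)"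
      by (rule card_mono[rotated])
    also have "\<dots> \<le> (\<Sum>b\<in>B. card (nb Z1 b))"
      by (rule card_UN_le[OF B(1)])
    also have "\<dots> \<le> (\<Sum>b\<in>B. D)"
      using card_nb(2)[of _ Z1] Z1 by (intro sum_mono) auto
    finally show ?thesis
      using Db by (simp add: mult.commute)
  qed
  \<comment> \<open>The contribution of the bad copies with typical restriction to \<open>S\<close>.\<close>
  have first: "2 * d2 ^ f * a * num (Z1 - B) \<le> \<alpha> / 8 * num Z1"
  proof -
    let ?y = "card {t \<in> TH. t \<subseteq> Z1 \<and> t \<inter> B \<noteq> {}}"
    let ?R = "real n ^ card B * d2 ^ (eB + f) * num (Z1 - B)"
    have R: "0 \<le> ?R"
      using d2 num_nonneg by simp
    have "\<alpha> ^ 2 \<le> (1 / 4) ^ 2"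
      using \<alpha> by (intro power_mono) auto
    then have a2: "2 * \<alpha> ^ 2 \<le> 1 / 8"
      by (simp add: power_divide)
    have "2 * d2 ^ f * a * num (Z1 - B) = 2 * \<alpha> ^ 2 * (\<alpha> * (\<alpha> ^ D * \<alpha> ^ D ^ 2) * ?R)"
      by (simp add: a_def power_add numeral_eq_Suc)
    also have "\<dots> \<le> 1 / 8 * (\<alpha> * (\<alpha> ^ D * \<alpha> ^ D ^ 2) * ?R)"
      using a2 \<alpha> mult_nonneg_nonneg[OF _ R, of "\<alpha> * (\<alpha> ^ D * \<alpha> ^ D ^ 2)"]
      by (intro mult_right_mono) auto
    also have "\<dots> = \<alpha> / 8 * ((\<alpha> ^ D * \<alpha> ^ D ^ 2) * ?R)"
      by simp
    also have "\<dots> \<le> \<alpha> / 8 * (((1 - \<alpha>) ^ card B * d3 ^ ?y) * ?R)"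
    proof (intro mult_left_mono mult_right_mono mult_mono low)
      show "?y \<le> D ^ 2"
        using meet_le[of B TH] S(4) Db by auto
    qed (use \<alpha> d3 B R in auto)
    also have "((1 - \<alpha>) ^ card B * d3 ^ ?y) * ?R =
        ((1 - \<alpha>) * real n) ^ card B * d2 ^ card {e \<in> EH. e \<subseteq> Z1 \<and> e \<inter> B \<noteq> {}} * d3 ^ ?y * num (Z1 - B)"
      by (simp add: card_meet power_mult_distrib)
    also have "\<dots> \<le> num Z1"
      by (rule num_ge_iterated[OF Z1(3,2) wellZ1])
    finally show ?thesis
      using \<alpha> by simp
  qed
  \<comment> \<open>The contribution of the bad copies with atypical restriction to \<open>S\<close>.\<close>
  have second: "a * real (card Y) * num (Z1 - (B \<union> S)) \<le> \<alpha> / 8 * num Z1"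
  proof -
    let ?x = "card {e \<in> EH. e \<subseteq> Z1 \<and> e \<inter> (B \<union> S) \<noteq> {}}"
    let ?y = "card {t \<in> TH. t \<subseteq> Z1 \<and> t \<inter> (B \<union> S) \<noteq> {}}"
    have cBS: "card (B \<union> S) = card B + card S"
      using B(1) S by (simp add: card_Un_disjoint Int_commute)
    then have cBS_le: "card (B \<union> S) \<le> D + D ^ 2"
      using B(4) cS by simp
    then have "D * card (B \<union> S) \<le> D ^ 2 + D ^ 3"
      using mult_le_mono2[OF cBS_le, of D] by (simp add: algebra_simps power2_eq_square power3_eq_cube)
    then have x: "?x \<le> D ^ 2 + D ^ 3" and y: "?y \<le> D ^ 2 + D ^ 3"
      using order_trans[OF meet_le[of "B \<union> S" EH]] order_trans[OF meet_le[of "B \<union> S" TH]] S(4,5)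
      by simp_all
    have f_le: "f \<le> D ^ 2"
      using meet_le[of B EH] S(4) Db card_meet by auto
    define R where "R = real n ^ (card B + card S) * num (Z1 - (B \<union> S))"
    have R: "0 \<le> R"
      using num_nonneg by (simp add: R_def)
    have "real f * \<delta>2 \<le> real f * (\<alpha> ^ (2 + (3 + ((D + D ^ 2) + (D ^ 2 + D ^ 3)))) * d2 ^ (f + ?x))"
    proof (intro mult_left_mono delta2_le)
      show "2 + (3 + ((D + D ^ 2) + (D ^ 2 + D ^ 3))) \<le> 20 * D ^ 3"
        using D_powers(1-3) by linarith
      show "f + ?x \<le> 20 * D ^ 3"
        using f_le x D_powers(1-3) by linarith
    qed simp
    also have "\<dots> = (real f * \<alpha> ^ 2) * (\<alpha> ^ 3 * ((\<alpha> ^ (D + D ^ 2) * \<alpha> ^ (D ^ 2 + D ^ 3)) * (d2 ^ f * d2 ^ ?x)))"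
      by (simp only: power_add mult_ac)
    also have "\<dots> \<le> 1 * (\<alpha> / 8 * (((1 - \<alpha>) ^ card (B \<union> S) * d3 ^ ?y) * (d2 ^ f * d2 ^ ?x)))"
    proof (intro mult_mono low)
      show "real f * \<alpha> ^ 2 \<le> 1"
        using f_le by (intro alpha_power_absorbs) (simp flip: of_nat_power)
      have "\<alpha> ^ 2 \<le> (1 / 4) ^ 2"
        using \<alpha> by (intro power_mono) auto
      then have "\<alpha> * \<alpha> ^ 2 \<le> \<alpha> * (1 / 8)"
        using \<alpha> by (intro mult_left_mono) (auto simp: power_divide)
      then show "\<alpha> ^ 3 \<le> \<alpha> / 8"
        by (simp add: power3_eq_cube power2_eq_square)
    qed (use \<alpha> d2 d3 cBS_le y in auto)
    finally have "real f * \<delta>2 \<le> \<alpha> / 8 * (((1 - \<alpha>) ^ card (B \<union> S) * d3 ^ ?y) * d2 ^ ?x) * d2 ^ f"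
      by (simp add: mult_ac)
    then have "real f * \<delta>2 * R \<le> (\<alpha> / 8 * (((1 - \<alpha>) ^ card (B \<union> S) * d3 ^ ?y) * d2 ^ ?x) * d2 ^ f) * R"
      using R by (rule mult_right_mono)
    moreover have "d2 ^ f * a * real (card Y) * num (Z1 - (B \<union> S)) \<le>
        real f * \<delta>2 * real n ^ (card S + card B) * num (Z1 - (B \<union> S))"
      using cardY num_nonneg by (rule mult_right_mono)
    ultimately have "d2 ^ f * (a * real (card Y) * num (Z1 - (B \<union> S))) \<le>
        d2 ^ f * (\<alpha> / 8 * (((1 - \<alpha>) ^ card (B \<union> S) * d3 ^ ?y * d2 ^ ?x) * R))"
      by (simp add: R_def mult_ac add.commute)
    then have "a * real (card Y) * num (Z1 - (B \<union> S)) \<le>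
        \<alpha> / 8 * (((1 - \<alpha>) ^ card (B \<union> S) * d3 ^ ?y * d2 ^ ?x) * R)"
      using d2 by (simp add: mult_le_cancel_left_pos)
    also have "((1 - \<alpha>) ^ card (B \<union> S) * d3 ^ ?y * d2 ^ ?x) * R =
        ((1 - \<alpha>) * real n) ^ card (B \<union> S) * d2 ^ ?x * d3 ^ ?y * num (Z1 - (B \<union> S))"
      by (simp add: R_def cBS power_mult_distrib)
    also have "\<dots> \<le> num Z1"
      using Z1(3) S(1) by (intro num_ge_iterated[OF _ Z1(2) wellZ1]) auto
    finally show ?thesis
      using \<alpha> by simp
  qed
  have Bad: "real (card Bad) \<le> 2 * d2 ^ f * a * num (Z1 - B) + a * real (card Y) * num (Z1 - (B \<union> S))"
  proof -
    let ?Q = "emb (Z1 - B)"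
    have finQ: "finite ?Q"
      using Z1 by (intro finite_emb) auto
    have SB: "S \<subseteq> Z1 - B"
      using S by auto
    have "card Bad \<le> card (SIGMA \<psi>:?Q. {\<beta> \<in> A. \<forall>e\<in>Fs. mg \<beta> (restrict \<psi> S) ` e \<in> E})"
    proof (rule card_inj_on_le[where f = "\<lambda>\<phi>. (restrict \<phi> (Z1 - B), restrict \<phi> B)"])
      show "inj_on (\<lambda>\<phi>. (restrict \<phi> (Z1 - B), restrict \<phi> B)) Bad"
      proof (rule inj_onI)
        fix \<phi> \<phi>' assume in_Bad: "\<phi> \<in> Bad" "\<phi>' \<in> Bad"
          and eq: "(restrict \<phi> (Z1 - B), restrict \<phi> B) = (restrict \<phi>' (Z1 - B), restrict \<phi>' B)"
        have ext: "\<phi> \<in> extensional Z1" "\<phi>' \<in> extensional Z1"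
          using in_Bad by (auto simp: Bad_def emb_def PiE_def)
        show "\<phi> = \<phi>'"
        proof (rule extensionalityI[OF ext])
          fix x assume "x \<in> Z1"
          then show "\<phi> x = \<phi>' x"
            using eq by (cases "x \<in> B") (metis Diff_iff prod.inject restrict_apply')+
        qed
      qed
      show "finite (SIGMA \<psi>:?Q. {\<beta> \<in> A. \<forall>e\<in>Fs. mg \<beta> (restrict \<psi> S) ` e \<in> E})"
        using finQ finA by auto
      show "(\<lambda>\<phi>. (restrict \<phi> (Z1 - B), restrict \<phi> B)) ` Bad \<subseteq>
          (SIGMA \<psi>:?Q. {\<beta> \<in> A. \<forall>e\<in>Fs. mg \<beta> (restrict \<psi> S) ` e \<in> E})"
      proof (clarify, intro SigmaI CollectI conjI ballI)
        fix \<phi> assume \<phi>: "\<phi> \<in> Bad"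
        then have emb: "\<phi> \<in> emb Z1" and "restrict \<phi> B \<in> A"
          by (auto simp: Bad_def)
        then show "restrict \<phi> B \<in> A"
          by simp
        show "restrict \<phi> (Z1 - B) \<in> ?Q"
          using emb by (rule emb_restrict) blast
        fix e assume e: "e \<in> Fs"
        obtain s b where sb: "s \<in> S" "b \<in> B" "e = {s, b}"
          using Fs_edge[OF e] by blast
        have "mg (restrict \<phi> B) (restrict (restrict \<phi> (Z1 - B)) S) ` e = \<phi> ` e"
          using sb S SB by (auto simp: mg_def)
        moreover have "\<phi> ` e \<in> E"
          using emb e by (auto simp: emb_def Fs_def)
        ultimately show "mg (restrict \<phi> B) (restrict (restrict \<phi> (Z1 - B)) S) ` e \<in> E"
          by simp
      qed
    qed
    also have "\<dots> = (\<Sum>\<psi>\<in>?Q. N (restrict \<psi> S))"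
      using finQ finA by (simp add: N_def)
    finally have "real (card Bad) \<le> (\<Sum>\<psi>\<in>?Q. real (N (restrict \<psi> S)))"
      by (simp flip: of_nat_sum)
    also have "\<dots> \<le> (\<Sum>\<psi>\<in>?Q. 2 * d2 ^ f * a + (if restrict \<psi> S \<in> Y then a else 0))"
    proof (rule sum_mono)
      fix \<psi> assume \<psi>: "\<psi> \<in> ?Q"
      show "real (N (restrict \<psi> S)) \<le> 2 * d2 ^ f * a + (if restrict \<psi> S \<in> Y then a else 0)"
      proof (cases "restrict \<psi> S \<in> Y")
        case True
        have "real (N (restrict \<psi> S)) \<le> real (card A)"
          unfolding N_def using finA by (simp add: card_mono)
        then show ?thesis
          using True cardA a0 d2 by (simp add: add_increasing)
      next
        case False
        have "restrict \<psi> S \<in> PiE S W"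
          using \<psi> SB by (auto simp: emb_def)
        then show ?thesis
          using False by (auto simp: Y_def)
      qed
    qed
    also have "\<dots> = 2 * d2 ^ f * a * num (Z1 - B) + a * real (card {\<psi> \<in> ?Q. restrict \<psi> S \<in> Y})"
      using finQ by (simp add: sum.distrib num_def mult_ac flip: sum.inter_filter)
    also have "\<dots> \<le> 2 * d2 ^ f * a * num (Z1 - B) + a * (real (card Y) * num (Z1 - (B \<union> S)))"
    proof (intro add_left_mono mult_left_mono a0)
      have "card {\<psi> \<in> ?Q. restrict \<psi> S \<in> Y} \<le> card (Y \<times> emb (Z1 - (B \<union> S)))"
      proof (rule card_inj_on_le[where f = "\<lambda>\<psi>. (restrict \<psi> S, restrict \<psi> (Z1 - (B \<union> S)))"])
        show "inj_on (\<lambda>\<psi>. (restrict \<psi> S, restrict \<psi> (Z1 - (B \<union> S)))) {\<psi> \<in> ?Q. restrict \<psi> S \<in> Y}"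
        proof (rule inj_onI)
          fix \<phi> \<phi>' assume "\<phi> \<in> {\<psi> \<in> ?Q. restrict \<psi> S \<in> Y}" "\<phi>' \<in> {\<psi> \<in> ?Q. restrict \<psi> S \<in> Y}"
            and eq: "(restrict \<phi> S, restrict \<phi> (Z1 - (B \<union> S))) = (restrict \<phi>' S, restrict \<phi>' (Z1 - (B \<union> S)))"
          then have ext: "\<phi> \<in> extensional (Z1 - B)" "\<phi>' \<in> extensional (Z1 - B)"
            by (auto simp: emb_def PiE_def)
          show "\<phi> = \<phi>'"
          proof (rule extensionalityI[OF ext])
            fix x assume "x \<in> Z1 - B"
            then show "\<phi> x = \<phi>' x"
              using eq by (cases "x \<in> S") (metis Diff_iff UnE prod.inject restrict_apply')+
          qed
        qed
        show "finite (Y \<times> emb (Z1 - (B \<union> S)))"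
          using finY finite_emb[of "Z1 - (B \<union> S)"] Z1 by auto
        have sub: "Z1 - (B \<union> S) \<subseteq> Z1 - B"
          by blast
        show "(\<lambda>\<psi>. (restrict \<psi> S, restrict \<psi> (Z1 - (B \<union> S)))) ` {\<psi> \<in> ?Q. restrict \<psi> S \<in> Y}
            \<subseteq> Y \<times> emb (Z1 - (B \<union> S))"
          using emb_restrict[OF _ sub] by blast
      qed
      then show "real (card {\<psi> \<in> ?Q. restrict \<psi> S \<in> Y}) \<le> real (card Y) * num (Z1 - (B \<union> S))"
        unfolding num_def by (simp add: card_cartesian_product flip: of_nat_mult)
    qed
    finally show ?thesis
      by (simp add: mult_ac)
  qed
  have Bad_le: "real (card Bad) \<le> \<alpha> / 4 * num Z1"
    using Bad first second by (simp add: field_simps)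
  have \<mu>: "c * real n \<le> \<alpha> / 4 * \<mu>" "0 \<le> \<mu>"
  proof -
    have "\<alpha> ^ (D + 2) * d2 ^ D = \<alpha> * (\<alpha> * (d2 ^ D * \<alpha> ^ D))"
      by simp
    also have "\<dots> \<le> \<alpha> * (1 / 4 * (d2 ^ card B * d3 ^ card (link Z h)))"
    proof (intro mult_left_mono mult_mono low)
      show "d2 ^ D \<le> d2 ^ card B"
        using B(4) d2 by (intro power_decreasing) auto
      show "card (link Z h) \<le> D"
        by (rule card_link[OF Z(2,1)])
    qed (use \<alpha> d2 d3 in auto)
    finally have "c * real n \<le> \<alpha> * (1 / 4 * (d2 ^ card B * d3 ^ card (link Z h))) * real n"
      using c by (intro mult_right_mono) auto
    then show "c * real n \<le> \<alpha> / 4 * \<mu>"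
      by (simp add: \<mu>_def mult_ac)
    show "0 \<le> \<mu>"
      using d2 d3 \<alpha> by (simp add: \<mu>_def)
  qed
  have extension: "\<phi>(h := v) \<in> emb Z"
    if \<phi>: "\<phi> \<in> emb Z1" and v: "v \<in> ext Z h (restrict \<phi> B)" "v \<notin> \<phi> ` Z1" for \<phi> v
  proof -
    have Zeq: "Z = insert h Z1" and hZ1: "h \<notin> Z1"
      using Z by (auto simp: Z1_def)
    have agree: "(\<phi>(h := v)) ` e = \<phi> ` e" if "h \<notin> e" for e
      using that by (intro image_cong) auto
    have edge: "(\<phi>(h := v)) ` e \<in> E" if e: "e \<in> EH" "e \<subseteq> Z" for e
    proof (cases "h \<in> e")
      case True
      obtain x y where xy: "e = {x, y}" "x \<noteq> y"
        using e(1) by (rule edgeE)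
      obtain b where b: "e = {h, b}" "b \<noteq> h"
        using True xy by (metis insert_commute insertE singletonD)
      then have "b \<in> B"
        using e by (auto simp: B_def nb_def)
      then have "{v, \<phi> b} \<in> E"
        using v(1) by (auto simp: ext_def B_def)
      then show ?thesis
        using b by (simp add: insert_commute)
    next
      case False
      then have "e \<subseteq> Z1"
        using e(2) by (auto simp: Z1_def)
      then show ?thesis
        using \<phi> e(1) agree[OF False] by (auto simp: emb_def)
    qed
    have hyper: "(\<phi>(h := v)) ` t \<in> F" if t: "t \<in> TH" "t \<subseteq> Z" for t
    proof (cases "h \<in> t")
      case True
      then have l: "t - {h} \<in> link Z h"
        using t by (auto simp: link_def)
      have sub: "t - {h} \<subseteq> B"
        using l unfolding B_def by (rule linkE) auto
      have "restrict \<phi> B ` (t - {h}) = \<phi> ` (t - {h})"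
        using sub by (intro image_cong) auto
      then have "insert v (\<phi> ` (t - {h})) \<in> F"
        using v(1) l by (simp only: ext_def) auto
      moreover have "(\<phi>(h := v)) ` t = insert v (\<phi> ` (t - {h}))"
        using True by auto
      ultimately show ?thesis
        by simp
    next
      case False
      then have "t \<subseteq> Z1"
        using t(2) by (auto simp: Z1_def)
      then show ?thesis
        using \<phi> t(1) agree[OF False] by (auto simp: emb_def)
    qed
    have "\<phi>(h := v) \<in> PiE Z W"
      using \<phi> v(1) unfolding Zeq by (intro PiE_fun_upd) (auto simp: emb_def ext_def)
    moreover have "inj_on (\<phi>(h := v)) Z"
      using \<phi> v(2) hZ1 unfolding Zeq by (auto simp: emb_def inj_on_def)
    ultimately show ?thesis
      using edge hyper by (simp add: emb_def)
  qed
  define X where "X \<phi> = ext Z h (restrict \<phi> B) - \<phi> ` Z1" for \<phi>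
  have finX: "finite (X \<phi>)" for \<phi>
    using W(1)[of h] Z by (auto simp: X_def ext_def)
  have cardX: "(1 - 3 * \<alpha> / 4) * \<mu> \<le> real (card (X \<phi>))" if "\<phi> \<in> emb Z1 - Bad" for \<phi>
  proof -
    have \<phi>: "\<phi> \<in> emb Z1" "restrict \<phi> B \<notin> A"
      using that by (auto simp: Bad_def)
    have "restrict \<phi> B \<in> emb B"
      using \<phi>(1) Z1(3) by (rule emb_restrict)
    then have "restrict \<phi> B \<in> PiE B W \<and> (\<forall>e\<in>EH. e \<subseteq> B \<longrightarrow> restrict \<phi> B ` e \<in> E)"
      by (simp add: emb_def)
    then have "\<not> real (card (ext Z h (restrict \<phi> B))) \<le> (1 - \<alpha> / 2) * \<mu>"
      using \<phi>(2) unfolding A_def by blast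
    then have large: "(1 - \<alpha> / 2) * \<mu> < real (card (ext Z h (restrict \<phi> B)))"
      by (rule not_le_imp_less)
    let ?used = "{y \<in> VH. W h \<inter> W y \<noteq> {}}"
    have "ext Z h (restrict \<phi> B) \<inter> \<phi> ` Z1 \<subseteq> \<phi> ` ?used"
    proof
      fix v assume v: "v \<in> ext Z h (restrict \<phi> B) \<inter> \<phi> ` Z1"
      then obtain y where y: "y \<in> Z1" "v = \<phi> y"
        by blast
      then have "v \<in> W h \<inter> W y"
        using v \<phi>(1) by (auto simp: ext_def emb_def)
      then show "v \<in> \<phi> ` ?used"
        using y Z1(2) by blast
    qed
    then have "card (ext Z h (restrict \<phi> B) \<inter> \<phi> ` Z1) \<le> card (\<phi> ` ?used)"
      using finVH by (intro card_mono) auto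
    also have "\<dots> \<le> card ?used"
      using finVH by (intro card_image_le) auto
    finally have "real (card (ext Z h (restrict \<phi> B) \<inter> \<phi> ` Z1)) \<le> \<alpha> / 4 * \<mu>"
      using class_small[of h] Z \<mu>(1) by fastforce
    moreover have "card (ext Z h (restrict \<phi> B)) = card (X \<phi>) + card (ext Z h (restrict \<phi> B) \<inter> \<phi> ` Z1)"
    proof -
      have "finite (ext Z h (restrict \<phi> B))"
        using W(1)[of h] Z by (auto simp: ext_def)
      then show ?thesis
        unfolding X_def by (simp add: card_Diff_subset_Int card_mono)
    qed
    ultimately show ?thesis
      using large by (simp add: algebra_simps)
  qed
  have finE1: "finite (emb Z1)"
    by (rule finite_emb[OF Z1(2)])
  have "card (SIGMA \<phi>:emb Z1 - Bad. X \<phi>) \<le> card (emb Z)"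
  proof (rule card_inj_on_le[where f = "\<lambda>(\<phi>, v). \<phi>(h := v)"])
    show "inj_on (\<lambda>(\<phi>, v). \<phi>(h := v)) (SIGMA \<phi>:emb Z1 - Bad. X \<phi>)"
    proof (rule inj_onI, clarify)
      fix \<phi> v \<phi>' v' assume in_emb: "\<phi> \<in> emb Z1" "\<phi>' \<in> emb Z1" and eq: "\<phi>(h := v) = \<phi>'(h := v')"
      have "\<phi> h = undefined" "\<phi>' h = undefined"
        using in_emb by (auto simp: emb_def Z1_def PiE_def extensional_def)
      then have "\<phi> = \<phi>'"
        using eq by (metis fun_upd_triv fun_upd_upd)
      moreover have "v = v'"
        using eq by (metis fun_upd_same)
      ultimately show "\<phi> = \<phi>' \<and> v = v'"
        by simp
    qed
    show "finite (emb Z)"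
      by (rule finite_emb[OF Z(1)])
    show "(\<lambda>(\<phi>, v). \<phi>(h := v)) ` (SIGMA \<phi>:emb Z1 - Bad. X \<phi>) \<subseteq> emb Z"
      using extension by (auto simp: X_def)
  qed
  then have "(\<Sum>\<phi>\<in>emb Z1 - Bad. real (card (X \<phi>))) \<le> num Z"
    using finE1 finX by (simp add: num_def flip: of_nat_sum)
  moreover have "real (card (emb Z1 - Bad)) * ((1 - 3 * \<alpha> / 4) * \<mu>) \<le> (\<Sum>\<phi>\<in>emb Z1 - Bad. real (card (X \<phi>)))"
    by (rule sum_bounded_below[OF cardX])
  moreover have "(1 - \<alpha> / 4) * num Z1 \<le> real (card (emb Z1 - Bad))"
  proof -
    have "Bad \<subseteq> emb Z1"
      by (auto simp: Bad_def)
    then have "real (card (emb Z1 - Bad)) = num Z1 - real (card Bad)"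
      using finE1 by (simp add: num_def card_Diff_subset finite_subset card_mono of_nat_diff)
    then show ?thesis
      using Bad_le by (simp add: algebra_simps)
  qed
  moreover have "0 \<le> (1 - 3 * \<alpha> / 4) * \<mu>"
    using \<alpha> \<mu>(2) by auto
  ultimately have "((1 - \<alpha> / 4) * num Z1) * ((1 - 3 * \<alpha> / 4) * \<mu>) \<le> num Z"
    by (meson mult_right_mono order_trans)
  moreover have "(1 - \<alpha>) * (\<mu> * num Z1) \<le> ((1 - \<alpha> / 4) * (1 - 3 * \<alpha> / 4)) * (\<mu> * num Z1)"
    using \<mu>(2) num_nonneg by (intro mult_right_mono) (auto simp: algebra_simps)
  ultimately have "(1 - \<alpha>) * (\<mu> * num Z1) \<le> num Z"
    by (simp add: mult_ac)
  then show ?thesis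
    unfolding extends_well_def using B(5) card_link(1)[OF Z(2,1)]
    by (simp add: \<mu>_def Z1_def mult_ac)
qed

theorem extends_well:
  assumes "Z \<subseteq> VH" "h \<in> Z"
  shows "extends_well Z h"
proof -
  have "finite Z"
    using assms finVH finite_subset by blast
  then show ?thesis
    using assms
  proof (induction Z arbitrary: h rule: finite_psubset_induct)
    case (psubset Z)
    show ?case
    proof (rule extend_one_vertex[OF psubset.prems])
      fix Z' x assume "Z' \<subset> Z" "x \<in> Z'"
      then show "extends_well Z' x"
        using psubset.IH[of Z' x] psubset.prems(1) by auto
    qed
  qed
qed

lemma num_all_ge:
  "num VH \<ge> ((1 - \<alpha>) * real n) ^ card VH * d2 ^ card EH * d3 ^ card TH"
proof -
  have nonempty: "e \<noteq> {}" "e \<subseteq> VH" if "e \<in> EH \<or> e \<in> TH" for e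
    using that EH TH by (auto simp: nsets_def)
  have "emb {} = {\<lambda>_. undefined}"
    using nonempty by (auto simp: emb_def)
  then have "num (VH - VH) = 1"
    by (simp add: num_def)
  moreover have "{e \<in> EH. e \<subseteq> VH \<and> e \<inter> VH \<noteq> {}} = EH" "{t \<in> TH. t \<subseteq> VH \<and> t \<inter> VH \<noteq> {}} = TH"
    using nonempty by blast+
  moreover have "extends_well Z x" if "Z \<subseteq> VH" "x \<in> Z" for Z x
    using that by (rule extends_well)
  ultimately show ?thesis
    using num_ge_iterated[OF order_refl order_refl] by simp
qed

end

section \<open>Copies in a regular complex\<close>

text \<open>
  Partition-respecting copies are the embeddings above with \<open>W x\<close> the host class that corresponds to
  the class of \<open>x\<close>. As the host respects the partition of the pattern, the pairs and triads used by the
  pattern are neither empty nor of density zero, hence they are regular.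
\<close>
lemma copies_lower_bounds:
  fixes H :: "'a hcomplex" and G :: "'b hcomplex"
  assumes H: "k_partite k H X" "max_degree H \<le> \<Delta>" "\<forall>i\<in>{1..k}. real (card (X i)) \<le> c * real n"
    and G: "k_partite k G V" "complex_regular k d3 \<delta>3 d2 \<delta>2 r G V" "\<forall>i\<in>{1..k}. card (V i) = n"
    and resp: "respects_partition k G V H X"
    and pos: "0 < \<Delta>" "0 < r" "0 < n" "0 < \<delta>2" "0 < d2"
    and \<alpha>: "0 < \<alpha>" "\<alpha> \<le> 1 / 4" "\<alpha> * real \<Delta> \<le> 1" "\<alpha> \<le> d3"
    and \<delta>2: "\<And>d. d = d2 \<or> d = 1 \<Longrightarrow> \<delta>2 \<le> (\<alpha> * d) ^ (20 * \<Delta> ^ 3)"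
    and r: "1 / real r \<le> \<delta>2"
    and \<delta>3: "\<delta>3 \<le> \<alpha> ^ (22 * \<Delta> ^ 2)"
    and c: "\<And>d. d = d2 \<or> d = 1 \<Longrightarrow> c \<le> \<alpha> ^ (\<Delta> + 2) * d ^ \<Delta>"
  shows "(\<forall>h\<in>verts H. real (num_copies k H X G V) \<ge> (1 - \<alpha>) * real n *
      d2 ^ (e2 H - e2 (del_vertex H h)) * d3 ^ (e3 H - e3 (del_vertex H h)) *
      real (num_copies k (del_vertex H h) X G V)) \<and>
    real (num_copies k H X G V) \<ge> ((1 - \<alpha>) * real n) ^ card (verts H) * d2 ^ e2 H * d3 ^ e3 H"
proof -
  have cH: "finite (verts H)" "edges H \<subseteq> nsets (verts H) 2" "hyperedges H \<subseteq> nsets (verts H) 3"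
    "\<And>t. t \<in> hyperedges H \<Longrightarrow> nsets t 2 \<subseteq> edges H"
    and XH: "disjoint_family_on X {1..k}" "(\<Union>i\<in>{1..k}. X i) = verts H"
      "\<And>e i. e \<in> edges H \<Longrightarrow> i \<in> {1..k} \<Longrightarrow> \<not> e \<subseteq> X i"
    using H(1) by (auto simp: k_partite_def is_complex_def)
  have cG: "finite (verts G)" "edges G \<subseteq> nsets (verts G) 2" "hyperedges G \<subseteq> nsets (verts G) 3"
    "\<And>t. t \<in> hyperedges G \<Longrightarrow> nsets t 2 \<subseteq> edges G"
    and VG: "disjoint_family_on V {1..k}" "(\<Union>i\<in>{1..k}. V i) = verts G"
    using G(1) by (auto simp: k_partite_def is_complex_def)
  have finE: "finite (edges H)" "finite (hyperedges H)"
    using cH(1-3) by (meson finite_subset finite_imp_finite_nsets)+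
  define cl where "cl x = (SOME i. i \<in> {1..k} \<and> x \<in> X i)" for x
  have cl: "cl x \<in> {1..k} \<and> x \<in> X (cl x)" if "x \<in> verts H" for x
    unfolding cl_def by (rule someI_ex) (use that XH(2) in blast)
  have cl_eq: "cl x = i" if "x \<in> X i" "i \<in> {1..k}" for x i
    using that cl[of x] XH(1,2) unfolding disjoint_family_on_def by blast
  have disV: "V i \<inter> V j = {}" if "i \<in> {1..k}" "j \<in> {1..k}" "i \<noteq> j" for i j
    using VG(1) that by (auto simp: disjoint_family_on_def)
  have finV: "finite (V i)" if "i \<in> {1..k}" for i
    using that VG(2) cG(1) by (metis UN_upper finite_subset)
  have cl_ne: "cl x \<noteq> cl y" if "{x, y} \<in> edges H" for x y
  proof
    assume eq: "cl x = cl y"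
    have "x \<in> verts H" "y \<in> verts H"
      using that cH(2) by (auto simp: nsets_def)
    then have "{x, y} \<subseteq> X (cl x)" "cl x \<in> {1..k}"
      using cl[of x] cl[of y] eq by auto
    then show False
      using XH(3)[OF that] by blast
  qed
  note resp3 = resp[unfolded respects_partition_def, THEN conjunct1, rule_format]
  note resp2 = resp[unfolded respects_partition_def, THEN conjunct2, rule_format]
  note greg = G(2)[unfolded complex_regular_def graph_regular_def, THEN conjunct1, rule_format]
  note hreg = G(2)[unfolded complex_regular_def hypergraph_regular_def, THEN conjunct2, rule_format]
  have bip: "bipartite_regular d2 \<delta>2 (edges_between (edges G) (V i) (V j)) (V i) (V j)"
    if "{x, y} \<in> edges H" "x \<in> X i" "y \<in> X j" "i \<in> {1..k}" "j \<in> {1..k}" "i < j" for x y i j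
  proof -
    have "\<exists>x\<in>X i. \<exists>y\<in>X j. {x, y} \<in> edges H"
      using that(1-3) by blast
    then have "\<exists>x\<in>V i. \<exists>y\<in>V j. {x, y} \<in> edges G"
      by (rule resp2[OF that(4-6)])
    then have "edges_between (edges G) (V i) (V j) \<noteq> {}"
      unfolding edges_between_def by blast
    then show ?thesis
      using greg[OF that(4-6)] by blast
  qed
  have edge_verts: "x \<in> verts H" "y \<in> verts H" if "{x, y} \<in> edges H" for x y
    using that cH(2) by (auto simp: nsets_def)
  have cut: "cut_close (edges G) d2 (\<delta>2 * real n ^ 2) (V (cl x)) (V (cl y))" and d2_le: "d2 \<le> 1"
    if "{x, y} \<in> edges H" for x y
  proof -
    have *: "cut_close (edges G) d2 (\<delta>2 * real n ^ 2) (V (cl x)) (V (cl y)) \<and> d2 \<le> 1"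
      if "{x, y} \<in> edges H" "cl x < cl y" for x y
    proof -
      have in_k: "cl x \<in> {1..k}" "cl y \<in> {1..k}" and in_X: "x \<in> X (cl x)" "y \<in> X (cl y)"
        using cl edge_verts[OF that(1)] by auto
      have "bipartite_regular d2 \<delta>2 (edges_between (edges G) (V (cl x)) (V (cl y))) (V (cl x)) (V (cl y))"
        by (rule bip[OF that(1) in_X in_k that(2)])
      moreover from this have "d2 \<le> 1"
        unfolding bipartite_regular_def by blast
      ultimately show ?thesis
        using bipartite_regular_imp_cut_close[of d2 \<delta>2 "edges G" "V (cl x)" "V (cl y)" n]
          disV[OF in_k] finV in_k G(3) that(2) by auto
    qed
    have "cl x < cl y \<or> cl y < cl x"
      using cl_ne[OF that] by linarith
    then show "cut_close (edges G) d2 (\<delta>2 * real n ^ 2) (V (cl x)) (V (cl y))" "d2 \<le> 1"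
      using *[of x y] *[of y x] that cut_close_sym by (auto simp: insert_commute)
  qed
  have sorted_reg: "triad_regular d3 \<delta>3 r (triad (edges G) (V i) (V j) (V l)) (hyperedges G)"
    if "{x, y, z} \<in> hyperedges H" "x \<in> X i" "y \<in> X j" "z \<in> X l"
      "i \<in> {1..k}" "j \<in> {1..k}" "l \<in> {1..k}" "i < j" "j < l" for x y z i j l
  proof -
    have "\<exists>x\<in>X i. \<exists>y\<in>X j. \<exists>z\<in>X l. {x, y, z} \<in> hyperedges H"
      using that(1-4) by blast
    then have "\<exists>x\<in>V i. \<exists>y\<in>V j. \<exists>z\<in>V l. {x, y, z} \<in> hyperedges G"
      by (rule resp3[OF that(5-7) conjI[OF that(8,9)]])
    then obtain a b c where abc: "a \<in> V i" "b \<in> V j" "c \<in> V l" "{a, b, c} \<in> hyperedges G"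
      by blast
    let ?P = "triad (edges G) (V i) (V j) (V l)"
    have "a \<noteq> b" "b \<noteq> c" "a \<noteq> c"
      using abc disV[of i j] disV[of j l] disV[of i l] that by auto
    then have "{a, b} \<in> edges G" "{b, c} \<in> edges G" "{a, c} \<in> edges G"
      using cG(4)[OF abc(4)] by (auto simp: nsets_def subset_iff)
    then have "{a, b, c} \<in> triangles ?P"
      using triangles_tripartite[of "V i" "V j" "V l"] abc disV[of i j] disV[of j l] disV[of i l] that
      unfolding triad_eq_tripartite_pairs by (auto intro!: image_eqI[of _ _ "(a, b, c)"])
    moreover have "finite (triangles ?P)"
    proof (rule finite_triangles[OF cG(1)])
      show "?P \<subseteq> nsets (verts G) 2"
        using cG(2) by (auto simp: triad_def edges_between_def)
    qed
    ultimately have "triangle_density (hyperedges G) (triangles ?P) \<noteq> 0"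
      using abc(4) triangle_density_pos by blast
    then show ?thesis
      using hreg[OF that(5-7) conjI[OF that(8,9)]] by blast
  qed
  have hyper_classes: "x \<in> verts H" "y \<in> verts H" "z \<in> verts H" "cl x \<noteq> cl y" "cl y \<noteq> cl z" "cl x \<noteq> cl z"
    if "{x, y, z} \<in> hyperedges H" for x y z
  proof -
    have "card {x, y, z} = 3"
      using that cH(3) by (auto simp: nsets_def)
    then have "x \<noteq> y" "y \<noteq> z" "x \<noteq> z"
      by (auto simp: card_insert_if split: if_splits)
    then have "{x, y} \<in> edges H" "{y, z} \<in> edges H" "{x, z} \<in> edges H"
      using cH(4)[OF that] by (auto simp: nsets_def subset_iff)
    then show "x \<in> verts H" "y \<in> verts H" "z \<in> verts H" "cl x \<noteq> cl y" "cl y \<noteq> cl z" "cl x \<noteq> cl z"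
      using edge_verts cl_ne by blast+
  qed
  have reg: "triad_regular d3 \<delta>3 r (triad (edges G) (V (cl x)) (V (cl y)) (V (cl z))) (hyperedges G)"
    if h: "{x, y, z} \<in> hyperedges H" for x y z
  proof -
    have s: "triad_regular d3 \<delta>3 r (triad (edges G) (V (cl x)) (V (cl y)) (V (cl z))) (hyperedges G)"
      if "{x, y, z} \<in> hyperedges H" "cl x < cl y" "cl y < cl z" for x y z
      using cl hyper_classes(1-3)[OF that(1)] that by (intro sorted_reg[of x y z]) auto
    consider "cl x < cl y" "cl y < cl z" | "cl x < cl z" "cl z < cl y" | "cl y < cl x" "cl x < cl z"
      | "cl y < cl z" "cl z < cl x" | "cl z < cl x" "cl x < cl y" | "cl z < cl y" "cl y < cl x"
      using hyper_classes(4-6)[OF h] by linarith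
    then show ?thesis
    proof cases
      case 1 then show ?thesis using s[of x y z] h by simp
    next
      case 2 then show ?thesis using s[of x z y] h by (simp add: insert_commute triad_perm(1))
    next
      case 3 then show ?thesis using s[of y x z] h by (simp add: insert_commute triad_perm(2))
    next
      case 4 then show ?thesis using s[of y z x] h by (simp add: insert_commute triad_perm(3))
    next
      case 5 then show ?thesis using s[of z x y] h by (simp add: insert_commute triad_perm(4))
    next
      case 6 then show ?thesis using s[of z y x] h by (simp add: insert_commute triad_perm(5))
    qed
  qed
  have \<delta>3_1: "\<delta>3 \<le> 1"
  proof -
    have "\<alpha> ^ (22 * \<Delta> ^ 2) \<le> 1"
      using \<alpha> by (intro power_le_one) auto
    then show ?thesis
      using \<delta>3 by linarith
  qed
  have d3_le: "d3 \<le> 2" if "t \<in> hyperedges H" for t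
  proof -
    have "card t = 3"
      using that cH(3) by (auto simp: nsets_def)
    then obtain x y z where "t = {x, y, z}"
      by (auto simp: card_3_iff)
    then show ?thesis
      using triad_regular_density_le[OF reg pos(2) \<delta>3_1] that by blast
  qed
  \<comment> \<open>If the pattern has no edges, nothing is known about \<open>d2\<close>, which may even exceed \<open>1\<close>; then it only
    occurs with exponent \<open>0\<close> and may be replaced by \<open>1\<close>. The same applies to \<open>d3\<close>.\<close>
  define p where "p = (if edges H = {} then 1 else d2)"
  define q where "q = (if hyperedges H = {} then 1 else d3)"
  have p: "p = d2 \<or> p = 1" "0 < p" "p \<le> 1"
  proof -
    show "p = d2 \<or> p = 1" "0 < p"
      using pos by (auto simp: p_def)
    show "p \<le> 1"
    proof (cases "edges H = {}")
      case False
      then obtain e where e: "e \<in> edges H"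
        by blast
      then obtain x y where "e = {x, y}"
        using cH(2) by (auto simp: nsets_def card_2_iff)
      then show ?thesis
        using d2_le e by (auto simp: p_def)
    qed (simp add: p_def)
  qed
  have deg: "card {e \<in> edges H. x \<in> e} \<le> \<Delta> \<and> card {t \<in> hyperedges H. x \<in> t} \<le> \<Delta>" if "x \<in> verts H" for x
  proof -
    have "degree H x \<le> max_degree H"
      unfolding max_degree_def using that cH(1) by (intro Max_ge) auto
    then show ?thesis
      using H(2) by (auto simp: degree_def)
  qed
  interpret extension_setting "verts H" "edges H" "hyperedges H" "\<lambda>x. V (cl x)" "edges G" "hyperedges G"
    n r \<Delta> p q \<delta>2 \<delta>3 \<alpha> c
  proof
    show "finite (verts H)" "edges H \<subseteq> nsets (verts H) 2" "hyperedges H \<subseteq> nsets (verts H) 3"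
      by (rule cH)+
    show "nsets t 2 \<subseteq> edges H" if "t \<in> hyperedges H" for t
      using that by (rule cH)
    show "card {e \<in> edges H. x \<in> e} \<le> \<Delta>" "card {t \<in> hyperedges H. x \<in> t} \<le> \<Delta>" if "x \<in> verts H" for x
      using deg[OF that] by auto
    show "finite (V (cl x))" "card (V (cl x)) = n" if "x \<in> verts H" for x
      using cl[OF that] finV G(3) by auto
    show "0 < n" "1 \<le> \<Delta>" "0 < p" "p \<le> 1" "0 < \<alpha>" "\<alpha> \<le> 1 / 4" "\<alpha> * real \<Delta> \<le> 1" "0 \<le> \<delta>2"
      "\<delta>3 \<le> \<alpha> ^ (22 * \<Delta> ^ 2)"
      using pos p \<alpha> \<delta>3 by auto
    show "\<alpha> \<le> q" "q \<le> 2"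
      using \<alpha> d3_le by (auto simp: q_def)
    show "\<delta>2 \<le> (\<alpha> * p) ^ (20 * \<Delta> ^ 3)" "c \<le> \<alpha> ^ (\<Delta> + 2) * p ^ \<Delta>"
      using \<delta>2 c p(1) by blast+
    show "2 \<le> real r * p ^ (\<Delta> ^ 2 + \<Delta>)"
    proof -
      have D: "\<Delta> ^ 2 \<le> \<Delta> ^ 3" "\<Delta> \<le> \<Delta> ^ 3" "1 \<le> \<Delta> ^ 3"
        using pos(1) by (auto intro: power_increasing self_le_power)
      have "\<delta>2 \<le> \<alpha> ^ (20 * \<Delta> ^ 3) * p ^ (20 * \<Delta> ^ 3)"
        using \<delta>2[OF p(1)] by (simp add: power_mult_distrib)
      also have "\<dots> \<le> \<alpha> ^ 1 * p ^ (\<Delta> ^ 2 + \<Delta>)"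
        using D \<alpha> p by (intro mult_mono power_decreasing) auto
      also have "\<dots> \<le> 1 / 2 * p ^ (\<Delta> ^ 2 + \<Delta>)"
        using \<alpha> p by (intro mult_right_mono) auto
      finally have "1 / real r \<le> 1 / 2 * p ^ (\<Delta> ^ 2 + \<Delta>)"
        using r by linarith
      then show ?thesis
        using pos(2) by (simp add: field_simps)
    qed
    show "cut_close (edges G) p (\<delta>2 * real n ^ 2) (V (cl x)) (V (cl y))" if "{x, y} \<in> edges H" for x y
      using cut[OF that] that by (auto simp: p_def)
    show "lower_regular q \<delta>3 r (edges G) (hyperedges G) (V (cl x)) (V (cl y)) (V (cl z))"
      if t: "{x, y, z} \<in> hyperedges H" for x y z
    proof -
      have "q = d3"
        using t by (auto simp: q_def)
      moreover have "cl x \<in> {1..k}" "cl y \<in> {1..k}" "cl z \<in> {1..k}"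
        using hyper_classes(1-3)[OF t] cl by auto
      ultimately show ?thesis
        using triad_regular_imp_lower_regular[OF reg[OF t]] disV hyper_classes(4-6)[OF t] finV by simp
    qed
    show "real (card {y \<in> verts H. V (cl x) \<inter> V (cl y) \<noteq> {}}) \<le> c * real n" if "x \<in> verts H" for x
    proof -
      have "{y \<in> verts H. V (cl x) \<inter> V (cl y) \<noteq> {}} \<subseteq> X (cl x)"
      proof clarify
        fix y assume y: "y \<in> verts H" "V (cl x) \<inter> V (cl y) \<noteq> {}"
        then have "cl x = cl y"
          using disV[of "cl x" "cl y"] cl[OF that] cl[of y] by blast
        then show "y \<in> X (cl x)"
          using cl[OF y(1)] by simp
      qed
      moreover have "finite (X (cl x))"
        using cl[OF that] XH(2) cH(1) by (metis UN_upper finite_subset)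
      ultimately have "card {y \<in> verts H. V (cl x) \<inter> V (cl y) \<noteq> {}} \<le> card (X (cl x))"
        by (rule card_mono[rotated])
      then show ?thesis
        using H(3) cl[OF that] by fastforce
    qed
  qed
  have copies_eq: "copies k (induced H Z) X G V = emb Z" if Z: "Z \<subseteq> verts H" for Z
  proof -
    have "(\<phi> \<in> PiE Z (\<lambda>_. verts G) \<and> (\<forall>i\<in>{1..k}. \<phi> ` (X i \<inter> Z) \<subseteq> V i)) \<longleftrightarrow>
        \<phi> \<in> PiE Z (\<lambda>x. V (cl x))" for \<phi>
    proof
      assume a: "\<phi> \<in> PiE Z (\<lambda>_. verts G) \<and> (\<forall>i\<in>{1..k}. \<phi> ` (X i \<inter> Z) \<subseteq> V i)"
      then have "\<phi> x \<in> V (cl x)" if "x \<in> Z" for x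
        using cl[of x] that Z by blast
      then show "\<phi> \<in> PiE Z (\<lambda>x. V (cl x))"
        using a by (auto simp: PiE_def)
    next
      assume a: "\<phi> \<in> PiE Z (\<lambda>x. V (cl x))"
      have "V (cl x) \<subseteq> verts G" if "x \<in> Z" for x
        using cl[of x] that Z VG(2) by blast
      then have "\<phi> \<in> PiE Z (\<lambda>_. verts G)"
        using a PiE_mono by blast
      moreover have "\<phi> ` (X i \<inter> Z) \<subseteq> V i" if "i \<in> {1..k}" for i
        using a cl_eq that by (auto simp: PiE_iff)
      ultimately show "\<phi> \<in> PiE Z (\<lambda>_. verts G) \<and> (\<forall>i\<in>{1..k}. \<phi> ` (X i \<inter> Z) \<subseteq> V i)"
        by blast
    qed
    note eq = this
    show ?thesis
    proof (rule set_eqI)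
      fix \<phi>
      show "\<phi> \<in> copies k (induced H Z) X G V \<longleftrightarrow> \<phi> \<in> emb Z"
        using eq[of \<phi>] unfolding copies_def emb_def induced_def by auto
    qed
  qed
  have sub: "e \<subseteq> verts H" if "e \<in> edges H \<or> e \<in> hyperedges H" for e
    using that cH(2,3) by (auto simp: nsets_def)
  have "induced H (verts H) = H"
  proof -
    have "{e \<in> edges H. e \<subseteq> verts H} = edges H" "{t \<in> hyperedges H. t \<subseteq> verts H} = hyperedges H"
      using sub by blast+
    then show ?thesis
      by (simp add: induced_def)
  qed
  then have all: "real (num_copies k H X G V) = num (verts H)"
    using copies_eq[of "verts H"] by (simp add: num_def)
  have dp: "p ^ j = d2 ^ j" if "j \<le> e2 H" for j
    using that by (cases "edges H = {}") (auto simp: p_def)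
  have dq: "q ^ j = d3 ^ j" if "j \<le> e3 H" for j
    using that by (cases "hyperedges H = {}") (auto simp: q_def)
  have diff: "card {e \<in> Y. e \<subseteq> verts H \<and> h \<in> e} = card Y - card {e \<in> Y. e \<subseteq> verts H - {h}}"
    if "Y = edges H \<or> Y = hyperedges H" for Y h
  proof -
    have "{e \<in> Y. e \<subseteq> verts H \<and> h \<in> e} = Y - {e \<in> Y. e \<subseteq> verts H - {h}}"
      using sub that by blast
    moreover have "finite {e \<in> Y. e \<subseteq> verts H - {h}}"
      using that finE by auto
    ultimately show ?thesis
      by (simp only:) (rule card_Diff_subset, auto)
  qed
  show ?thesis
  proof (intro conjI ballI)
    fix h assume h: "h \<in> verts H"
    have "extends_well (verts H) h"
      using h by (intro extends_well) auto
    then show "real (num_copies k H X G V) \<ge> (1 - \<alpha>) * real n *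
        d2 ^ (e2 H - e2 (del_vertex H h)) * d3 ^ (e3 H - e3 (del_vertex H h)) *
        real (num_copies k (del_vertex H h) X G V)"
      using copies_eq[of "verts H - {h}"]
        diff[of "edges H" h] diff[of "hyperedges H" h]
      by (simp add: extends_well_def all dp dq del_vertex_def num_def induced_def)
  next
    show "real (num_copies k H X G V) \<ge> ((1 - \<alpha>) * real n) ^ card (verts H) * d2 ^ e2 H * d3 ^ e3 H"
      using num_all_ge by (simp add: all dp dq)
  qed
qed

section \<open>The hierarchy of constants\<close>

text \<open>
  Functions of the form \<open>x \<mapsto> exp (- C / x\<^sup>j)\<close> lie below \<open>x\<^bsup>q\<^esup>\<close> even for exponents \<open>q\<close> that grow
  polynomially in \<open>1 / x\<close>. This is what the hierarchy requires, as \<open>\<Delta>\<close>, on which the exponents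
  depend, is bounded by \<open>1 / \<alpha>\<close> only.
\<close>
lemma exp_le_power:
  assumes "0 < x" "real q / x \<le> t"
  shows "exp (- t) \<le> x ^ q"
proof -
  have "1 / x \<le> exp (1 / x)"
    using exp_ge_add_one_self[of "1 / x"] by linarith
  then have "exp (- (1 / x)) \<le> x"
    using assms(1) by (simp add: exp_minus field_simps)
  then have "exp (- (1 / x)) ^ q \<le> x ^ q"
    by (intro power_mono) auto
  moreover have "exp (- (1 / x)) ^ q = exp (- (real q / x))"
    by (simp flip: exp_of_nat_mult)
  ultimately show ?thesis
    using assms(2) by (smt (verit) exp_le_cancel_iff)
qed

text \<open>
  A product of squashed numbers lies below each of the numbers, so that a single inequality between
  constants yields several.
\<close>
definition squash :: "real \<Rightarrow> real" where "squash x = x / (1 + x)"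

lemma squash:
  assumes "0 < x"
  shows "0 < squash x" "squash x < 1" "squash x \<le> x" "x < y \<Longrightarrow> squash x < squash y"
  using assms by (auto simp: squash_def field_simps)

lemma pos_incr1I:
  assumes "\<And>x. 0 < x \<Longrightarrow> 0 < f x" "\<And>x y. 0 < x \<Longrightarrow> x < y \<Longrightarrow> f x < f y"
  shows "pos_incr1 f"
  using assms by (auto simp: pos_incr1_def strict_mono_on_def)

lemma pos_incr1_exp_power: "0 < C \<Longrightarrow> 0 < q \<Longrightarrow> pos_incr1 (\<lambda>x. exp (- (C / x ^ q)))"
  by (rule pos_incr1I) (auto intro!: divide_strict_left_mono power_strict_mono)

lemma pos_incr3_squash: "pos_incr3 (\<lambda>x y z. squash x * squash y * squash z / 4)"
  unfolding pos_incr3_def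
  by (auto intro!: pos_incr1I mult_pos_pos mult_strict_right_mono mult_strict_left_mono simp: squash)

lemma pos_incr2_exp: "pos_incr2 (\<lambda>a d. exp (- (3 / a ^ 2 + 1 / (a * d))))"
proof -
  have "3 / y ^ 2 < 3 / x ^ 2" "1 / (y * d) < 1 / (x * d)" "1 / (d * y) < 1 / (d * x)"
    if "0 < d" "0 < x" "x < y" for x y d :: real
    using that by (auto intro!: divide_strict_left_mono power_strict_mono)
  then show ?thesis
    unfolding pos_incr2_def by (auto intro!: pos_incr1I) (smt (verit))
qed

text \<open>
  With \<open>m = min \<delta>3 d2\<close> one has \<open>m \<le> \<alpha> \<le> 1 / \<Delta>\<close> and \<open>m \<le> d2\<close>. The exponents \<open>22 \<Delta>\<^sup>2\<close> and \<open>40 \<Delta>\<^sup>3\<close>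
  of \<open>\<alpha>\<close> and \<open>m\<close> that the extension argument asks for are therefore at most \<open>22 / \<alpha>\<^sup>2\<close> and
  \<open>40 / m\<^sup>3\<close>, which leads to the functions \<open>?f4\<close> and \<open>?f3\<close>; the function \<open>?f6\<close> arises in the same way.
  The bound \<open>1 / r \<le> \<delta>2\<close> allows tuples that are long enough, because \<open>\<delta>2\<close> lies below the power of
  \<open>d2\<close> whose reciprocal is the required length.
\<close>
theorem lemma3:
  shows "\<exists>(f1 :: real \<Rightarrow> real) (f2 :: real \<Rightarrow> real) (f3 :: real \<Rightarrow> real) (f4 :: real \<Rightarrow> real)
           (f5 :: real \<Rightarrow> real \<Rightarrow> real \<Rightarrow> real) (f6 :: real \<Rightarrow> real \<Rightarrow> real).
    pos_incr1 f1 \<and> pos_incr1 f2 \<and> pos_incr1 f3 \<and> pos_incr1 f4 \<and> pos_incr3 f5 \<and> pos_incr2 f6 \<and>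
    (\<forall>(\<Delta>::nat) (k::nat) (r::nat) (n0::nat)
       (c::real) (\<alpha>::real) (d2::real) (d3::real) (\<delta>2::real) (\<delta>3::real).
       0 < \<Delta> \<and> 0 < k \<and> 0 < r \<and> 0 < n0 \<and>
       0 < c \<and> 0 < \<alpha> \<and> 0 < d2 \<and> 0 < d3 \<and> 0 < \<delta>2 \<and> 0 < \<delta>3 \<and>
       1 / real n0 \<le> f1 (1 / real r) \<and>
       1 / real r \<le> f2 \<delta>2 \<and>
       \<delta>2 \<le> f3 (min \<delta>3 d2) \<and>
       min \<delta>3 d2 \<le> \<delta>3 \<and>
       \<delta>3 \<le> f4 \<alpha> \<and>
       \<alpha> \<le> f5 d3 (1 / real \<Delta>) (1 / real k) \<and>
       c \<le> f6 \<alpha> d2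
       \<longrightarrow>
       (\<forall>n\<ge>n0. \<forall>(H :: 'a hcomplex) X (G :: 'b hcomplex) V.
          k_partite k H X \<and> max_degree H \<le> \<Delta> \<and>
          (\<forall>i\<in>{1..k}. real (card (X i)) \<le> c * real n) \<and>
          k_partite k G V \<and> complex_regular k d3 \<delta>3 d2 \<delta>2 r G V \<and>
          (\<forall>i\<in>{1..k}. card (V i) = n) \<and>
          respects_partition k G V H X
          \<longrightarrow>
          (\<forall>h\<in>verts H.
             real (num_copies k H X G V) \<ge>
               (1 - \<alpha>) * real n *
               d2 ^ (e2 H - e2 (del_vertex H h)) * d3 ^ (e3 H - e3 (del_vertex H h)) *
               real (num_copies k (del_vertex H h) X G V)) \<and>
          real (num_copies k H X G V) \<ge>
            ((1 - \<alpha>) * real n) ^ card (verts H) * d2 ^ e2 H * d3 ^ e3 H))"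
proof -
  let ?f3 = "\<lambda>x::real. exp (- (40 / x ^ 4))"
  let ?f4 = "\<lambda>x::real. exp (- (22 / x ^ 3))"
  let ?f5 = "\<lambda>x y z. squash x * squash y * squash z / 4"
  let ?f6 = "\<lambda>a d::real. exp (- (3 / a ^ 2 + 1 / (a * d)))"
  show ?thesis
  proof (rule exI[of _ "\<lambda>x. x"], rule exI[of _ "\<lambda>x. x"], rule exI[of _ ?f3], rule exI[of _ ?f4],
      rule exI[of _ ?f5], rule exI[of _ ?f6], intro conjI)
    show "pos_incr1 (\<lambda>x. x)"
      by (rule pos_incr1I)
    then show "pos_incr1 (\<lambda>x. x)" .
    show "pos_incr1 ?f3" "pos_incr1 ?f4"
      by (simp_all add: pos_incr1_exp_power)
    show "pos_incr3 ?f5" "pos_incr2 ?f6"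
      by (rule pos_incr3_squash pos_incr2_exp)+
  next
    show "\<forall>(\<Delta>::nat) (k::nat) (r::nat) (n0::nat)
       (c::real) (\<alpha>::real) (d2::real) (d3::real) (\<delta>2::real) (\<delta>3::real).
       0 < \<Delta> \<and> 0 < k \<and> 0 < r \<and> 0 < n0 \<and>
       0 < c \<and> 0 < \<alpha> \<and> 0 < d2 \<and> 0 < d3 \<and> 0 < \<delta>2 \<and> 0 < \<delta>3 \<and>
       1 / real n0 \<le> 1 / real r \<and>
       1 / real r \<le> \<delta>2 \<and>
       \<delta>2 \<le> ?f3 (min \<delta>3 d2) \<and>
       min \<delta>3 d2 \<le> \<delta>3 \<and>
       \<delta>3 \<le> ?f4 \<alpha> \<and>
       \<alpha> \<le> ?f5 d3 (1 / real \<Delta>) (1 / real k) \<and>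
       c \<le> ?f6 \<alpha> d2
       \<longrightarrow>
       (\<forall>n\<ge>n0. \<forall>(H :: 'a hcomplex) X (G :: 'b hcomplex) V.
          k_partite k H X \<and> max_degree H \<le> \<Delta> \<and>
          (\<forall>i\<in>{1..k}. real (card (X i)) \<le> c * real n) \<and>
          k_partite k G V \<and> complex_regular k d3 \<delta>3 d2 \<delta>2 r G V \<and>
          (\<forall>i\<in>{1..k}. card (V i) = n) \<and>
          respects_partition k G V H X
          \<longrightarrow>
          (\<forall>h\<in>verts H.
             real (num_copies k H X G V) \<ge>
               (1 - \<alpha>) * real n *
               d2 ^ (e2 H - e2 (del_vertex H h)) * d3 ^ (e3 H - e3 (del_vertex H h)) *
               real (num_copies k (del_vertex H h) X G V)) \<and>
          real (num_copies k H X G V) \<ge>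
            ((1 - \<alpha>) * real n) ^ card (verts H) * d2 ^ e2 H * d3 ^ e3 H)"
    proof (intro allI impI, elim conjE)
      fix \<Delta> k r n0 n :: nat and c \<alpha> d2 d3 \<delta>2 \<delta>3 :: real
        and H :: "'a hcomplex" and X and G :: "'b hcomplex" and V
      assume pos: "0 < \<Delta>" "0 < k" "0 < r" "0 < n0" "0 < c" "0 < \<alpha>" "0 < d2" "0 < d3" "0 < \<delta>2" "0 < \<delta>3"
        and r: "1 / real r \<le> \<delta>2" and \<delta>2: "\<delta>2 \<le> ?f3 (min \<delta>3 d2)" and \<delta>3: "\<delta>3 \<le> ?f4 \<alpha>"
        and \<alpha>: "\<alpha> \<le> ?f5 d3 (1 / real \<Delta>) (1 / real k)" and c: "c \<le> ?f6 \<alpha> d2" and n: "n0 \<le> n"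
        and hyps: "k_partite k H X" "max_degree H \<le> \<Delta>" "\<forall>i\<in>{1..k}. real (card (X i)) \<le> c * real n"
          "k_partite k G V" "complex_regular k d3 \<delta>3 d2 \<delta>2 r G V" "\<forall>i\<in>{1..k}. card (V i) = n"
          "respects_partition k G V H X"
      define s1 s2 s3 where "s1 = squash d3" and "s2 = squash (1 / real \<Delta>)" and "s3 = squash (1 / real k)"
      have s: "0 < s1" "0 < s2" "0 < s3" "s1 < 1" "s2 < 1" "s3 < 1" "s1 \<le> d3" "s2 \<le> 1 / real \<Delta>"
        using pos squash by (auto simp: s1_def s2_def s3_def)
      have prod: "s1 * s2 * s3 \<le> s1" "s1 * s2 * s3 \<le> s2" "s1 * s2 * s3 \<le> 1"
      proof -
        have *: "s1 * s2 \<le> s1" "s1 * s2 \<le> s2"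
          using s by (simp_all add: mult_left_le_one_le mult_right_le_one_le)
        moreover have "s1 * s2 * s3 \<le> s1 * s2"
          using s by (intro mult_right_le_one_le) auto
        ultimately show "s1 * s2 * s3 \<le> s1" "s1 * s2 * s3 \<le> s2" "s1 * s2 * s3 \<le> 1"
          using s by linarith+
      qed
      have prod0: "0 < s1 * s2 * s3"
        using s by simp
      have \<alpha>': "\<alpha> \<le> s1 * s2 * s3 / 4"
        using \<alpha> by (simp add: s1_def s2_def s3_def)
      have a: "\<alpha> \<le> 1 / 4" "\<alpha> \<le> d3" "\<alpha> \<le> 1 / real \<Delta>"
        using \<alpha>' prod prod0 s by linarith+
      then have aD: "\<alpha> * real \<Delta> \<le> 1" and D_le: "real \<Delta> \<le> 1 / \<alpha>"
        using pos by (simp_all add: field_simps)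
      have \<delta>3_le: "\<delta>3 \<le> \<alpha> ^ (22 * \<Delta> ^ 2)"
      proof -
        have "real (22 * \<Delta> ^ 2) / \<alpha> \<le> 22 * (1 / \<alpha>) ^ 2 / \<alpha>"
          using D_le pos by (intro divide_right_mono) (auto intro!: power_mono)
        also have "\<dots> = 22 / \<alpha> ^ 3"
          by (simp add: power2_eq_square power3_eq_cube)
        finally show ?thesis
          using \<delta>3 exp_le_power[OF pos(6)] by (meson order_trans)
      qed
      define m where "m = min \<delta>3 d2"
      have \<delta>3_\<alpha>: "\<delta>3 \<le> \<alpha>"
      proof -
        have "\<alpha> ^ (22 * \<Delta> ^ 2) \<le> \<alpha> ^ 1"
          using a pos by (intro power_decreasing) (auto simp: Suc_le_eq)
        then show ?thesis
          using \<delta>3_le by simp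
      qed
      have m: "0 < m" "m \<le> \<alpha>" "m \<le> d2" "m \<le> 1"
        using pos \<delta>3_\<alpha> a by (auto simp: m_def)
      have \<delta>2_le: "\<delta>2 \<le> (\<alpha> * d) ^ (20 * \<Delta> ^ 3)" if "d = d2 \<or> d = 1" for d
      proof -
        have "real \<Delta> \<le> 1 / m"
          using D_le m pos by (meson divide_left_mono frac_le order_refl order_trans zero_le_one)
        then have "real (2 * (20 * \<Delta> ^ 3)) / m \<le> 40 * (1 / m) ^ 3 / m"
          using m by (intro divide_right_mono) (auto intro!: power_mono)
        also have "\<dots> = 40 / m ^ 4"
          by (simp add: numeral_eq_Suc)
        finally have "exp (- (40 / m ^ 4)) \<le> m ^ (2 * (20 * \<Delta> ^ 3))"
          by (rule exp_le_power[OF m(1)])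
        also have "\<dots> = (m * m) ^ (20 * \<Delta> ^ 3)"
          by (simp only: power_mult power2_eq_square)
        also have "\<dots> \<le> (\<alpha> * d) ^ (20 * \<Delta> ^ 3)"
          using that m pos by (intro power_mono mult_mono) auto
        finally show ?thesis
          using \<delta>2 by (simp add: m_def)
      qed
      have c_le: "c \<le> \<alpha> ^ (\<Delta> + 2) * d ^ \<Delta>" if d: "d = d2 \<or> d = 1" for d
      proof -
        have "real (\<Delta> + 2) / \<alpha> \<le> (3 * (1 / \<alpha>)) / \<alpha>"
        proof (intro divide_right_mono)
          have "1 \<le> 1 / \<alpha>"
            using a pos by (simp add: field_simps)
          then show "real (\<Delta> + 2) \<le> 3 * (1 / \<alpha>)"
            using D_le by simp
        qed (use pos in simp)
        also have "\<dots> = 3 / \<alpha> ^ 2"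
          by (simp add: power2_eq_square)
        finally have 1: "exp (- (3 / \<alpha> ^ 2)) \<le> \<alpha> ^ (\<Delta> + 2)"
          by (rule exp_le_power[OF pos(6)])
        have "real \<Delta> / d2 \<le> (1 / \<alpha>) / d2"
          using D_le pos by (intro divide_right_mono) auto
        also have "\<dots> = 1 / (\<alpha> * d2)"
          by simp
        finally have "exp (- (1 / (\<alpha> * d2))) \<le> d2 ^ \<Delta>"
          by (rule exp_le_power[OF pos(7)])
        then have 2: "exp (- (1 / (\<alpha> * d2))) \<le> d ^ \<Delta>"
          using d pos by auto
        have "c \<le> exp (- (3 / \<alpha> ^ 2)) * exp (- (1 / (\<alpha> * d2)))"
          using c by (simp add: mult_exp_exp)
        also have "\<dots> \<le> \<alpha> ^ (\<Delta> + 2) * d ^ \<Delta>"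
          using 1 2 pos by (intro mult_mono) auto
        finally show ?thesis .
      qed
      show "(\<forall>h\<in>verts H. real (num_copies k H X G V) \<ge> (1 - \<alpha>) * real n *
            d2 ^ (e2 H - e2 (del_vertex H h)) * d3 ^ (e3 H - e3 (del_vertex H h)) *
            real (num_copies k (del_vertex H h) X G V)) \<and>
          real (num_copies k H X G V) \<ge> ((1 - \<alpha>) * real n) ^ card (verts H) * d2 ^ e2 H * d3 ^ e3 H"
        using pos n a aD r
        by (intro copies_lower_bounds[OF hyps(1-7)] \<delta>2_le c_le \<delta>3_le) auto
    qed
  qed
qed

end
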